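(* Let $R$ be a commutative ring, let $A$ be a separable $R$-algebra that is finitely generated projective over $R$, and let $M$ be a left $A$-module that is finitely generated projective over $R$, is cyclic as an $A$-module, and satisfies $\operatorname{End}_A(M)\cong R$ as $R$-algebras. Let $e(M)\in\mathcal{Z}(A)$ be the central idempotent $e(M)=[A:M]_\beta^{-1}z(M)$ associated with $M$ (defined in the context). Then: (a) $e(M)A\cong\operatorname{End}_R(M)$ and $\operatorname{rank}_R e(M)A=(\operatorname{rank}_R M)^2$. (b) $\chi_{\mathrm{reg}}\,e(M)=(\operatorname{rank}_R M)\,\chi_M$, where $\chi_{\mathrm{reg}}$ is the regular character of $A$; that is, $\chi_{\mathrm{reg}}(e(M)a)=(\operatorname{rank}_R M)\,\chi_M(a)$ for all $a\in A$.
   Context: $\mathcal{Z}(A)$ is the center of $A$. For a finitely generated projective $R$-module $N$, $\operatorname{Tr}\colon\operatorname{End}_R(N)\cong N\otimes_R N^\vee\to R$ is the trace map and $\operatorname{rank}_R N=\operatorname{Tr}(1_N)\in R$ is the Hattori–Stallings rank. For $a\in A$, $a_M\in\operatorname{End}_R(M)$ is the action of $a$ on $M$ and $\chi_M(a)=\operatorname{Tr}(a_M)$ is the character of $M$. The regular character is $\chi_{\mathrm{reg}}(a)=\operatorname{Tr}(x\mapsto ax)$, the trace being taken on $A$. The dual $A^\vee=\operatorname{Hom}_R(A,R)$ is an $(A,A)$-bimodule via $(afb)(x)=f(bxa)$. Definition of $e(M)$. Since $\operatorname{End}_A(M)\cong R$, $A$ is faithful over $R$; by a theorem of Endo and Watanabe,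 $A$ is then a symmetric algebra, i.e. there is an $R$-bilinear form $\beta\colon A\times A\to R$ that is nonsingular ($a\mapsto\beta(\cdot,a)$ is an isomorphism $A\to A^\vee$), associative ($\beta(xy,z)=\beta(x,yz)$) and symmetric. Fix such a $\beta$. Let $z(M)\in\mathcal{Z}(A)$ be the element determined by $\chi_M(a)=\beta(a,z(M))$ for all $a\in A$. The central character $\omega_M\colon\mathcal{Z}(A)\to R$ is defined by $x_M=\omega_M(x)1_M$ for $x\in\mathcal{Z}(A)$, and $[A:M]_\beta:=\omega_M(z(M))\in R$. Under the hypotheses, $M\cong Ae$ for some idempotent $e\in A$, $[A:M]_\beta$ is invertible in $R$, and $e(M):=[A:M]_\beta^{-1}z(M)$ is an idempotent in $\mathcal{Z}(A)$ satisfying $\omega_M(e(M))=1$ and $x\,e(M)=\omega_M(x)e(M)$ for all $x\in\mathcal{Z}(A)$. *)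

theory Defs
  imports "HOL-Algebra.Module" "HOL-Algebra.QuotRing" "HOL-Algebra.Free_Abelian_Groups"
begin

section \<open>Modules and algebras over rings\<close>

text \<open>
  The library locale \<^locale>\<open>module\<close> requires a commutative base ring, and the library locale
  \<^locale>\<open>algebra\<close> requires the algebra to be commutative; both restrictions have to be dropped here.
  Rings are unital and the zero ring is allowed, as everywhere in HOL-Algebra. The fields
  \<open>mult\<close> and \<open>one\<close> that a \<open>module\<close> record inherits from rings are irrelevant for modules.
\<close>

locale left_module = S?: ring S + P?: abelian_group P
  for S :: "('s, 'k) ring_scheme" (structure) and P :: "('s, 'p, 'l) module_scheme" (structure) +
  assumes smult_closed:
      "\<lbrakk>a \<in> carrier S; x \<in> carrier P\<rbrakk> \<Longrightarrow> a \<odot>\<^bsub>P\<^esub> x \<in> carrier P"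
    and smult_l_distr:
      "\<lbrakk>a \<in> carrier S; b \<in> carrier S; x \<in> carrier P\<rbrakk> \<Longrightarrow>
       (a \<oplus>\<^bsub>S\<^esub> b) \<odot>\<^bsub>P\<^esub> x = a \<odot>\<^bsub>P\<^esub> x \<oplus>\<^bsub>P\<^esub> b \<odot>\<^bsub>P\<^esub> x"
    and smult_r_distr:
      "\<lbrakk>a \<in> carrier S; x \<in> carrier P; y \<in> carrier P\<rbrakk> \<Longrightarrow>
       a \<odot>\<^bsub>P\<^esub> (x \<oplus>\<^bsub>P\<^esub> y) = a \<odot>\<^bsub>P\<^esub> x \<oplus>\<^bsub>P\<^esub> a \<odot>\<^bsub>P\<^esub> y"
    and smult_assoc:
      "\<lbrakk>a \<in> carrier S; b \<in> carrier S; x \<in> carrier P\<rbrakk> \<Longrightarrow>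
       (a \<otimes>\<^bsub>S\<^esub> b) \<odot>\<^bsub>P\<^esub> x = a \<odot>\<^bsub>P\<^esub> (b \<odot>\<^bsub>P\<^esub> x)"
    and smult_one:
      "x \<in> carrier P \<Longrightarrow> \<one>\<^bsub>S\<^esub> \<odot>\<^bsub>P\<^esub> x = x"

locale assoc_algebra = module R A + ring A
  for R :: "('r, 'k) ring_scheme" (structure) and A :: "('r, 'a, 'l) module_scheme" (structure) +
  assumes smult_mult_left:
      "\<lbrakk>r \<in> carrier R; x \<in> carrier A; y \<in> carrier A\<rbrakk> \<Longrightarrow>
       (r \<odot>\<^bsub>A\<^esub> x) \<otimes>\<^bsub>A\<^esub> y = r \<odot>\<^bsub>A\<^esub> (x \<otimes>\<^bsub>A\<^esub> y)"
    and smult_mult_right: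
      "\<lbrakk>r \<in> carrier R; x \<in> carrier A; y \<in> carrier A\<rbrakk> \<Longrightarrow>
       x \<otimes>\<^bsub>A\<^esub> (r \<odot>\<^bsub>A\<^esub> y) = r \<odot>\<^bsub>A\<^esub> (x \<otimes>\<^bsub>A\<^esub> y)"

text \<open>For commutative \<open>S\<close> this is also \<open>S\<close> as an algebra over itself.\<close>

definition regular_module :: "('s, 'k) ring_scheme \<Rightarrow> ('s, 's) module" where
  "regular_module S =
     \<lparr>carrier = carrier S, mult = mult S, one = one S, ring.zero = ring.zero S, add = add S,
      smult = mult S\<rparr>"

text \<open>The \<open>R\<close>-module underlying an \<open>A\<close>-module, via \<open>r \<mapsto> r 1\<^sub>A\<close>.\<close>

definition restrict_scalars ::
  "('r, 'k) ring_scheme \<Rightarrow> ('r, 'a, 'l) module_scheme \<Rightarrow> ('a, 'm, 'n) module_scheme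
    \<Rightarrow> ('r, 'm) module" where
  "restrict_scalars R A M =
     \<lparr>carrier = carrier M, mult = mult M, one = one M, ring.zero = ring.zero M, add = add M,
      smult = (\<lambda>r x. (r \<odot>\<^bsub>A\<^esub> \<one>\<^bsub>A\<^esub>) \<odot>\<^bsub>M\<^esub> x)\<rparr>"

definition Hom ::
  "('s, 'k) ring_scheme \<Rightarrow> ('s, 'p, 'l) module_scheme \<Rightarrow> ('s, 'q, 'n) module_scheme
    \<Rightarrow> ('p \<Rightarrow> 'q) set" where
  "Hom S P Q =
     {f \<in> carrier P \<rightarrow>\<^sub>E carrier Q.
        (\<forall>x\<in>carrier P. \<forall>y\<in>carrier P. f (x \<oplus>\<^bsub>P\<^esub> y) = f x \<oplus>\<^bsub>Q\<^esub> f y) \<and>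
        (\<forall>s\<in>carrier S. \<forall>x\<in>carrier P. f (s \<odot>\<^bsub>P\<^esub> x) = s \<odot>\<^bsub>Q\<^esub> f x)}"

definition dual :: "('r, 'k) ring_scheme \<Rightarrow> ('r, 'p, 'l) module_scheme \<Rightarrow> ('p \<Rightarrow> 'r) set" where
  "dual R N = Hom R N (regular_module R)"

definition cyclic_module :: "('s, 'k) ring_scheme \<Rightarrow> ('s, 'p, 'l) module_scheme \<Rightarrow> bool" where
  "cyclic_module S P \<longleftrightarrow> (\<exists>x\<in>carrier P. carrier P = (\<lambda>s. s \<odot>\<^bsub>P\<^esub> x) ` carrier S)"

definition finitely_generated :: "('s, 'k) ring_scheme \<Rightarrow> ('s, 'p, 'l) module_scheme \<Rightarrow> bool" where
  "finitely_generated S P \<longleftrightarrow>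
     (\<exists>X. finite X \<and> X \<subseteq> carrier P \<and>
        carrier P = {(\<Oplus>\<^bsub>P\<^esub>x\<in>X. c x \<odot>\<^bsub>P\<^esub> x) | c. c \<in> X \<rightarrow> carrier S})"

definition free_module :: "('s, 'k) ring_scheme \<Rightarrow> 'i set \<Rightarrow> ('s, 'i \<Rightarrow> 's) module" where
  "free_module S I =
     \<lparr>carrier = {f \<in> I \<rightarrow>\<^sub>E carrier S. finite {i \<in> I. f i \<noteq> \<zero>\<^bsub>S\<^esub>}},
      mult = undefined, one = undefined,
      ring.zero = (\<lambda>i\<in>I. \<zero>\<^bsub>S\<^esub>),
      add = (\<lambda>f g. \<lambda>i\<in>I. f i \<oplus>\<^bsub>S\<^esub> g i),
      smult = (\<lambda>s f. \<lambda>i\<in>I. s \<otimes>\<^bsub>S\<^esub> f i)\<rparr>"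

text \<open>
  Projective means: isomorphic to a direct summand of a free module. It is no restriction that the
  basis \<open>I\<close> is a set over the element type of \<open>P\<close>: a projective \<open>P\<close> is a direct summand of the free
  module on the set \<open>carrier P\<close>.
\<close>

definition projective :: "('s, 'k) ring_scheme \<Rightarrow> ('s, 'p, 'l) module_scheme \<Rightarrow> bool" where
  "projective S P \<longleftrightarrow>
     (\<exists>(I :: 'p set). \<exists>\<iota>\<in>Hom S P (free_module S I). \<exists>\<pi>\<in>Hom S (free_module S I) P.
        \<forall>x\<in>carrier P. \<pi> (\<iota> x) = x)"

text \<open>
  The algebra of \<open>S\<close>-linear endomorphisms of \<open>P\<close>; scalars act on values by \<open>act\<close>. The scalars
  may come from a ring other than \<open>S\<close>.
\<close>

definition End_algebra ::
  "('s, 'k) ring_scheme \<Rightarrow> ('s, 'p, 'l) module_scheme \<Rightarrow> ('r \<Rightarrow> 'p \<Rightarrow> 'p)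
    \<Rightarrow> ('r, 'p \<Rightarrow> 'p) module" where
  "End_algebra S P act =
     \<lparr>carrier = Hom S P P,
      mult = (\<lambda>f g. compose (carrier P) f g),
      one = (\<lambda>x\<in>carrier P. x),
      ring.zero = (\<lambda>x\<in>carrier P. \<zero>\<^bsub>P\<^esub>),
      add = (\<lambda>f g. \<lambda>x\<in>carrier P. f x \<oplus>\<^bsub>P\<^esub> g x),
      smult = (\<lambda>r f. \<lambda>x\<in>carrier P. act r (f x))\<rparr>"

definition algebra_iso ::
  "('r, 'k) ring_scheme \<Rightarrow> ('r, 'a, 'l) module_scheme \<Rightarrow> ('r, 'b, 'n) module_scheme \<Rightarrow> bool" where
  "algebra_iso R A B \<longleftrightarrow>
     (\<exists>\<phi>\<in>ring_iso A B. \<forall>r\<in>carrier R. \<forall>x\<in>carrier A. \<phi> (r \<odot>\<^bsub>A\<^esub> x) = r \<odot>\<^bsub>B\<^esub> \<phi> x)"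

definition center :: "('a, 'k) ring_scheme \<Rightarrow> 'a set" where
  "center A = {z \<in> carrier A. \<forall>a\<in>carrier A. z \<otimes>\<^bsub>A\<^esub> a = a \<otimes>\<^bsub>A\<^esub> z}"


section \<open>Separable algebras\<close>

text \<open>
  \<open>A\<close> is separable over \<open>R\<close> if it is projective as a left module over its enveloping algebra
  \<open>A \<otimes>\<^sub>R A\<^sup>o\<^sup>p\<close>. The tensor product of two algebras is built as the free abelian group on pairs
  modulo the bilinearity relations; \<open>pair_ring\<close> extends the componentwise product of pairs
  biadditively to this free abelian group.
\<close>

definition opposite_ring :: "('a, 'k) ring_scheme \<Rightarrow> ('a, 'k) ring_scheme" where
  "opposite_ring A = A\<lparr>mult := (\<lambda>x y. y \<otimes>\<^bsub>A\<^esub> x)\<rparr>"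

definition pair_ring ::
  "('a, 'k) ring_scheme \<Rightarrow> ('b, 'l) ring_scheme \<Rightarrow> (('a \<times> 'b) \<Rightarrow>\<^sub>0 int) ring" where
  "pair_ring A B =
     \<lparr>carrier = carrier (free_Abelian_group (carrier A \<times> carrier B)),
      mult = (\<lambda>u v. frag_extend (\<lambda>(a, b). frag_extend (\<lambda>(c, d).
                frag_of (a \<otimes>\<^bsub>A\<^esub> c, b \<otimes>\<^bsub>B\<^esub> d)) v) u),
      one = frag_of (\<one>\<^bsub>A\<^esub>, \<one>\<^bsub>B\<^esub>),
      ring.zero = 0,
      add = (+)\<rparr>"

definition bilinearity_relators ::
  "('r, 'k) ring_scheme \<Rightarrow> ('r, 'a, 'l) module_scheme \<Rightarrow> ('r, 'b, 'n) module_scheme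
    \<Rightarrow> (('a \<times> 'b) \<Rightarrow>\<^sub>0 int) set" where
  "bilinearity_relators R A B =
     {frag_of (a \<oplus>\<^bsub>A\<^esub> a', b) - frag_of (a, b) - frag_of (a', b) | a a' b.
        a \<in> carrier A \<and> a' \<in> carrier A \<and> b \<in> carrier B} \<union>
     {frag_of (a, b \<oplus>\<^bsub>B\<^esub> b') - frag_of (a, b) - frag_of (a, b') | a b b'.
        a \<in> carrier A \<and> b \<in> carrier B \<and> b' \<in> carrier B} \<union>
     {frag_of (r \<odot>\<^bsub>A\<^esub> a, b) - frag_of (a, r \<odot>\<^bsub>B\<^esub> b) | r a b.
        r \<in> carrier R \<and> a \<in> carrier A \<and> b \<in> carrier B}"

definition tensor_algebra ::
  "('r, 'k) ring_scheme \<Rightarrow> ('r, 'a, 'l) module_scheme \<Rightarrow> ('r, 'b, 'n) module_scheme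
    \<Rightarrow> (('a \<times> 'b) \<Rightarrow>\<^sub>0 int) set ring" where
  "tensor_algebra R A B =
     pair_ring A B Quot
       generate (free_Abelian_group (carrier A \<times> carrier B)) (bilinearity_relators R A B)"

definition enveloping_algebra ::
  "('r, 'k) ring_scheme \<Rightarrow> ('r, 'a, 'l) module_scheme \<Rightarrow> (('a \<times> 'a) \<Rightarrow>\<^sub>0 int) set ring" where
  "enveloping_algebra R A = tensor_algebra R A (opposite_ring A)"

text \<open>
  \<open>A\<close> as a left module over its enveloping algebra, \<open>(a \<otimes> b) x = a x b\<close>. The value on a coset
  \<open>X\<close> is computed from any representative \<open>u \<in> X\<close>.
\<close>

definition enveloping_module ::
  "('r, 'a, 'l) module_scheme \<Rightarrow> ((('a \<times> 'a) \<Rightarrow>\<^sub>0 int) set, 'a) module" where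
  "enveloping_module A =
     \<lparr>carrier = carrier A, mult = mult A, one = one A, ring.zero = ring.zero A, add = add A,
      smult = (\<lambda>X x. the_elem ((\<lambda>u. \<Oplus>\<^bsub>A\<^esub>p\<in>Poly_Mapping.keys u.
                 [Poly_Mapping.lookup u p] \<cdot>\<^bsub>A\<^esub> (fst p \<otimes>\<^bsub>A\<^esub> x \<otimes>\<^bsub>A\<^esub> snd p)) ` X))\<rparr>"

definition separable :: "('r, 'k) ring_scheme \<Rightarrow> ('r, 'a, 'l) module_scheme \<Rightarrow> bool" where
  "separable R A \<longleftrightarrow> projective (enveloping_algebra R A) (enveloping_module A)"


section \<open>Traces, ranks and characters\<close>

text \<open>
  For finitely generated projective \<open>N\<close>, the map \<open>N \<otimes>\<^sub>R N\<^sup>\<or> \<rightarrow> End\<^sub>R(N)\<close> sending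
  \<open>x \<otimes> f\<close> to \<open>y \<mapsto> f(y) x\<close> is an isomorphism; the trace is its inverse followed by evaluation
  \<open>x \<otimes> f \<mapsto> f(x)\<close>. The elements of the tensor product are written as finite sums of pure tensors.
\<close>

definition Tr ::
  "('r, 'k) ring_scheme \<Rightarrow> ('r, 'p, 'l) module_scheme \<Rightarrow> ('p \<Rightarrow> 'p) \<Rightarrow> 'r" where
  "Tr R N \<phi> =
     (THE t. \<exists>(n :: nat) x f.
        x \<in> {..<n} \<rightarrow> carrier N \<and> f \<in> {..<n} \<rightarrow> dual R N \<and>
        (\<forall>y\<in>carrier N. \<phi> y = (\<Oplus>\<^bsub>N\<^esub>i\<in>{..<n}. f i y \<odot>\<^bsub>N\<^esub> x i)) \<and>
        t = (\<Oplus>\<^bsub>R\<^esub>i\<in>{..<n}. f i (x i)))"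

text \<open>The Hattori--Stallings rank, an element of \<open>R\<close>.\<close>

definition hs_rank :: "('r, 'k) ring_scheme \<Rightarrow> ('r, 'p, 'l) module_scheme \<Rightarrow> 'r" where
  "hs_rank R N = Tr R N (\<lambda>x\<in>carrier N. x)"

definition character ::
  "('r, 'k) ring_scheme \<Rightarrow> ('r, 'a, 'l) module_scheme \<Rightarrow> ('a, 'm, 'n) module_scheme
    \<Rightarrow> 'a \<Rightarrow> 'r" where
  "character R A M a = Tr R (restrict_scalars R A M) (\<lambda>x\<in>carrier M. a \<odot>\<^bsub>M\<^esub> x)"

definition regular_character ::
  "('r, 'k) ring_scheme \<Rightarrow> ('r, 'a, 'l) module_scheme \<Rightarrow> 'a \<Rightarrow> 'r" where
  "regular_character R A a = Tr R A (\<lambda>x\<in>carrier A. a \<otimes>\<^bsub>A\<^esub> x)"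


section \<open>Symmetric algebras and the central idempotent of a module\<close>

text \<open>
  In the nonsingularity condition, \<open>a \<mapsto> \<beta>(\<cdot>, a)\<close> is automatically \<open>R\<close>-linear by bilinearity, so
  that it is an isomorphism onto the dual as soon as it is bijective.
\<close>

definition symmetrizing_form ::
  "('r, 'k) ring_scheme \<Rightarrow> ('r, 'a, 'l) module_scheme \<Rightarrow> ('a \<Rightarrow> 'a \<Rightarrow> 'r) \<Rightarrow> bool" where
  "symmetrizing_form R A \<beta> \<longleftrightarrow>
     (\<forall>a\<in>carrier A. (\<lambda>x\<in>carrier A. \<beta> x a) \<in> dual R A \<and> (\<lambda>x\<in>carrier A. \<beta> a x) \<in> dual R A) \<and>
     bij_betw (\<lambda>a. \<lambda>x\<in>carrier A. \<beta> x a) (carrier A) (dual R A) \<and>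
     (\<forall>x\<in>carrier A. \<forall>y\<in>carrier A. \<forall>z\<in>carrier A. \<beta> (x \<otimes>\<^bsub>A\<^esub> y) z = \<beta> x (y \<otimes>\<^bsub>A\<^esub> z)) \<and>
     (\<forall>x\<in>carrier A. \<forall>y\<in>carrier A. \<beta> x y = \<beta> y x)"

definition character_element ::
  "('r, 'k) ring_scheme \<Rightarrow> ('r, 'a, 'l) module_scheme \<Rightarrow> ('a \<Rightarrow> 'a \<Rightarrow> 'r)
    \<Rightarrow> ('a, 'm, 'n) module_scheme \<Rightarrow> 'a" where
  "character_element R A \<beta> M =
     (THE z. z \<in> center A \<and> (\<forall>a\<in>carrier A. character R A M a = \<beta> a z))"

definition central_character ::
  "('r, 'k) ring_scheme \<Rightarrow> ('r, 'a, 'l) module_scheme \<Rightarrow> ('a, 'm, 'n) module_scheme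
    \<Rightarrow> 'a \<Rightarrow> 'r" where
  "central_character R A M x =
     (THE r. r \<in> carrier R \<and>
        (\<forall>m\<in>carrier M. x \<odot>\<^bsub>M\<^esub> m = r \<odot>\<^bsub>restrict_scalars R A M\<^esub> m))"

definition module_index ::
  "('r, 'k) ring_scheme \<Rightarrow> ('r, 'a, 'l) module_scheme \<Rightarrow> ('a \<Rightarrow> 'a \<Rightarrow> 'r)
    \<Rightarrow> ('a, 'm, 'n) module_scheme \<Rightarrow> 'r" where
  "module_index R A \<beta> M = central_character R A M (character_element R A \<beta> M)"

definition central_idempotent ::
  "('r, 'k) ring_scheme \<Rightarrow> ('r, 'a, 'l) module_scheme \<Rightarrow> ('a \<Rightarrow> 'a \<Rightarrow> 'r)
    \<Rightarrow> ('a, 'm, 'n) module_scheme \<Rightarrow> 'a" where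
  "central_idempotent R A \<beta> M =
     inv\<^bsub>R\<^esub> (module_index R A \<beta> M) \<odot>\<^bsub>A\<^esub> character_element R A \<beta> M"

text \<open>For a central idempotent \<open>e\<close>, the ideal \<open>eA\<close> as an algebra with identity element \<open>e\<close>.\<close>

definition ideal_algebra ::
  "('r, 'a, 'l) module_scheme \<Rightarrow> 'a \<Rightarrow> ('r, 'a, 'l) module_scheme" where
  "ideal_algebra A e = A\<lparr>carrier := (\<lambda>a. e \<otimes>\<^bsub>A\<^esub> a) ` carrier A, one := e\<rparr>"

end

theory Submission
  imports Defs
begin

text \<open>
  Everything follows from one consequence of separability: the surjection \<open>A \<rightarrow> M\<close>, \<open>a \<mapsto> a m\<^sub>0\<close>,
  given by a generator \<open>m\<^sub>0\<close> has an \<open>A\<close>-linear section \<open>s\<close>. Since \<open>M\<close> is projective over \<open>R\<close> there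
  is an \<open>R\<close>-linear section, and it is made \<open>A\<close>-linear by averaging over a separability idempotent
  (\<open>separable_splitting\<close>, \<open>cyclic_section\<close>).

  For \<open>x \<in> M\<close> the map \<open>y \<mapsto> s(y) x\<close> is an \<open>A\<close>-endomorphism of \<open>M\<close>, hence multiplication by a scalar
  \<open>coord x\<close>. Read in the other variable, the element \<open>s(y)\<close> acts on \<open>M\<close> as the rank-one map
  \<open>x \<mapsto> coord(x) y\<close>, whose trace is \<open>coord y\<close>. With \<open>z\<close> the element representing the character
  \<open>\<chi>\<close> of \<open>M\<close>, and \<open>w = [A : M]\<^sub>\<beta>\<close> the scalar by which it acts,
  \<open>coord y = \<chi>(s y) = \<beta>(s y, z) = \<beta>(s(z y), 1) = w \<beta>(s y, 1)\<close>
  (\<open>coord_form\<close>). Taking \<open>y = m\<^sub>0\<close>, where \<open>coord\<close> is \<open>1\<close>, shows that \<open>w\<close> is invertible, and then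
  \<open>\<epsilon> = w\<^sup>-\<^sup>1 z\<close> acts on \<open>M\<close> as the identity.

  Two facts identify \<open>\<epsilon> A\<close> with \<open>End\<^sub>R(M)\<close>. If \<open>a\<close> and \<open>b\<close> act equally on \<open>M\<close> then \<open>\<epsilon> a = \<epsilon> b\<close>,
  because \<open>\<beta>(c, \<epsilon> a) = w\<^sup>-\<^sup>1 \<chi>(c a)\<close> depends only on the action of \<open>a\<close> (\<open>eps_eqI\<close>). And every
  \<open>y \<mapsto> g(y) x\<close> with \<open>g \<in> M\<^sup>\<or>\<close> is the action of an element of \<open>A\<close>, obtained by representing
  \<open>a \<mapsto> g(a m\<^sub>0)\<close> through \<open>\<beta>\<close> (\<open>rank_one_action\<close>); such maps span \<open>End\<^sub>R(M)\<close>.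

  A dual basis \<open>(e\<^sub>k, d\<^sub>k)\<close> of \<open>M\<close> therefore lifts to matrix units \<open>u\<^sub>k\<^sub>l \<in> \<epsilon> A\<close> acting by
  \<open>y \<mapsto> d\<^sub>l(y) e\<^sub>k\<close>, and \<open>\<epsilon> x = \<Sum> d\<^sub>k(x e\<^sub>l) u\<^sub>k\<^sub>l\<close> for all \<open>x \<in> A\<close>. This one expansion computes both the
  rank of \<open>\<epsilon> A\<close> and the trace of \<open>x \<mapsto> \<epsilon> a x\<close> on \<open>A\<close>: each is
  \<open>\<Sum> d\<^sub>k(a e\<^sub>k) d\<^sub>l(e\<^sub>l) = \<chi>(a) rank(M)\<close>, with \<open>a = 1\<close> in the first case.
\<close>

section \<open>Finite sums and linear maps\<close>

lemma additive_zero: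
  assumes "abelian_group P" "abelian_group Q" "f \<in> carrier P \<rightarrow> carrier Q"
    and "\<And>x y. \<lbrakk>x \<in> carrier P; y \<in> carrier P\<rbrakk> \<Longrightarrow> f (x \<oplus>\<^bsub>P\<^esub> y) = f x \<oplus>\<^bsub>Q\<^esub> f y"
  shows "f \<zero>\<^bsub>P\<^esub> = \<zero>\<^bsub>Q\<^esub>"
proof -
  interpret P: abelian_group P by fact
  interpret Q: abelian_group Q by fact
  have c: "f \<zero>\<^bsub>P\<^esub> \<in> carrier Q" using assms(3) by auto
  have "f \<zero>\<^bsub>P\<^esub> \<oplus>\<^bsub>Q\<^esub> f \<zero>\<^bsub>P\<^esub> = f \<zero>\<^bsub>P\<^esub>"
    using assms(4)[of "\<zero>\<^bsub>P\<^esub>" "\<zero>\<^bsub>P\<^esub>"] by simp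
  then show ?thesis using c Q.add.l_cancel_one by blast
qed

lemma additive_finsum:
  assumes "abelian_group P" "abelian_group Q" "f \<in> carrier P \<rightarrow> carrier Q"
    and "\<And>x y. \<lbrakk>x \<in> carrier P; y \<in> carrier P\<rbrakk> \<Longrightarrow> f (x \<oplus>\<^bsub>P\<^esub> y) = f x \<oplus>\<^bsub>Q\<^esub> f y"
    and "x \<in> J \<rightarrow> carrier P"
  shows "f (\<Oplus>\<^bsub>P\<^esub>j\<in>J. x j) = (\<Oplus>\<^bsub>Q\<^esub>j\<in>J. f (x j))"
proof -
  interpret P: abelian_group P by fact
  interpret Q: abelian_group Q by fact
  note z = additive_zero[OF assms(1-4)]
  show ?thesis
    using assms(5)
  proof (induction J rule: infinite_finite_induct)
    case (insert j J)
    have "f (\<Oplus>\<^bsub>P\<^esub>j\<in>insert j J. x j) = f (x j \<oplus>\<^bsub>P\<^esub> (\<Oplus>\<^bsub>P\<^esub>j\<in>J. x j))"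
      using insert by simp
    also have "\<dots> = f (x j) \<oplus>\<^bsub>Q\<^esub> (\<Oplus>\<^bsub>Q\<^esub>j\<in>J. f (x j))"
      using insert by (subst assms(4)) auto
    also have "\<dots> = (\<Oplus>\<^bsub>Q\<^esub>j\<in>insert j J. f (x j))"
      using insert assms(3) by (subst Q.finsum_insert) (auto simp: Pi_def)
    finally show ?case .
  qed (simp_all add: z)
qed

lemma (in abelian_group) finsum_swap:
  assumes "finite I" "finite J" "\<And>i j. \<lbrakk>i \<in> I; j \<in> J\<rbrakk> \<Longrightarrow> f i j \<in> carrier G"
  shows "(\<Oplus>i\<in>I. \<Oplus>j\<in>J. f i j) = (\<Oplus>j\<in>J. \<Oplus>i\<in>I. f i j)"
  using assms(1,3)
proof (induction I)
  case (insert i I)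
  have "(\<Oplus>i\<in>insert i I. \<Oplus>j\<in>J. f i j) = (\<Oplus>j\<in>J. f i j) \<oplus> (\<Oplus>j\<in>J. \<Oplus>i\<in>I. f i j)"
    using insert by (simp add: Pi_def)
  also have "\<dots> = (\<Oplus>j\<in>J. f i j \<oplus> (\<Oplus>i\<in>I. f i j))"
    using insert by (subst finsum_addf) (auto simp: Pi_def)
  also have "\<dots> = (\<Oplus>j\<in>J. \<Oplus>i\<in>insert i I. f i j)"
    using insert by (intro finsum_cong') (auto simp: Pi_def)
  finally show ?case .
qed simp

lemma (in abelian_group) finsum_product:
  assumes "finite I" "finite J" "\<And>i j. \<lbrakk>i \<in> I; j \<in> J\<rbrakk> \<Longrightarrow> f i j \<in> carrier G"
  shows "(\<Oplus>p\<in>I \<times> J. f (fst p) (snd p)) = (\<Oplus>i\<in>I. \<Oplus>j\<in>J. f i j)"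
  using assms(1,3)
proof (induction I)
  case (insert i I)
  have d: "insert i I \<times> J = Pair i ` J \<union> I \<times> J" by auto
  have "(\<Oplus>p\<in>insert i I \<times> J. f (fst p) (snd p))
      = (\<Oplus>p\<in>Pair i ` J. f (fst p) (snd p)) \<oplus> (\<Oplus>p\<in>I \<times> J. f (fst p) (snd p))"
    unfolding d using insert assms(2) by (intro finsum_Un_disjoint) auto
  also have "(\<Oplus>p\<in>Pair i ` J. f (fst p) (snd p)) = (\<Oplus>j\<in>J. f i j)"
    using insert assms(2) by (subst finsum_reindex) (auto simp: inj_on_def)
  finally show ?case using insert by (simp add: Pi_def)
qed simp

lemma Hom_memI:
  assumes "\<And>x. x \<in> carrier P \<Longrightarrow> f x \<in> carrier Q"
    and "\<And>x y. \<lbrakk>x \<in> carrier P; y \<in> carrier P; x \<oplus>\<^bsub>P\<^esub> y \<in> carrier P\<rbrakk> \<Longrightarrow> f (x \<oplus>\<^bsub>P\<^esub> y) = f x \<oplus>\<^bsub>Q\<^esub> f y"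
    and "\<And>s x. \<lbrakk>s \<in> carrier S; x \<in> carrier P; s \<odot>\<^bsub>P\<^esub> x \<in> carrier P\<rbrakk> \<Longrightarrow> f (s \<odot>\<^bsub>P\<^esub> x) = s \<odot>\<^bsub>Q\<^esub> f x"
    and "\<And>x y. \<lbrakk>x \<in> carrier P; y \<in> carrier P\<rbrakk> \<Longrightarrow> x \<oplus>\<^bsub>P\<^esub> y \<in> carrier P"
    and "\<And>s x. \<lbrakk>s \<in> carrier S; x \<in> carrier P\<rbrakk> \<Longrightarrow> s \<odot>\<^bsub>P\<^esub> x \<in> carrier P"
  shows "restrict f (carrier P) \<in> Hom S P Q"
  using assms unfolding Hom_def by auto

lemma Hom_D:
  assumes "f \<in> Hom S P Q"
  shows "x \<in> carrier P \<Longrightarrow> f x \<in> carrier Q"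
    and "x \<in> carrier P \<Longrightarrow> y \<in> carrier P \<Longrightarrow> f (x \<oplus>\<^bsub>P\<^esub> y) = f x \<oplus>\<^bsub>Q\<^esub> f y"
    and "s \<in> carrier S \<Longrightarrow> x \<in> carrier P \<Longrightarrow> f (s \<odot>\<^bsub>P\<^esub> x) = s \<odot>\<^bsub>Q\<^esub> f x"
    and "f \<in> extensional (carrier P)"
  using assms by (auto simp: Hom_def PiE_def)

lemma Hom_finsum:
  assumes "abelian_group P" "abelian_group Q" "f \<in> Hom S P Q" "x \<in> J \<rightarrow> carrier P"
  shows "f (\<Oplus>\<^bsub>P\<^esub>j\<in>J. x j) = (\<Oplus>\<^bsub>Q\<^esub>j\<in>J. f (x j))"
  using assms by (intro additive_finsum) (auto simp: Hom_def)

lemma regular_module_simps [simp]: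
  "carrier (regular_module S) = carrier S"
  "a \<oplus>\<^bsub>regular_module S\<^esub> b = a \<oplus>\<^bsub>S\<^esub> b"
  "\<zero>\<^bsub>regular_module S\<^esub> = \<zero>\<^bsub>S\<^esub>"
  "a \<odot>\<^bsub>regular_module S\<^esub> b = a \<otimes>\<^bsub>S\<^esub> b"
  "a \<otimes>\<^bsub>regular_module S\<^esub> b = a \<otimes>\<^bsub>S\<^esub> b"
  "\<one>\<^bsub>regular_module S\<^esub> = \<one>\<^bsub>S\<^esub>"
  by (simp_all add: regular_module_def)

lemma restrict_scalars_simps [simp]:
  "carrier (restrict_scalars R A M) = carrier M"
  "x \<oplus>\<^bsub>restrict_scalars R A M\<^esub> y = x \<oplus>\<^bsub>M\<^esub> y"
  "\<zero>\<^bsub>restrict_scalars R A M\<^esub> = \<zero>\<^bsub>M\<^esub>"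
  "r \<odot>\<^bsub>restrict_scalars R A M\<^esub> x = (r \<odot>\<^bsub>A\<^esub> \<one>\<^bsub>A\<^esub>) \<odot>\<^bsub>M\<^esub> x"
  by (simp_all add: restrict_scalars_def)

lemma dual_D:
  assumes "f \<in> dual R N"
  shows "x \<in> carrier N \<Longrightarrow> f x \<in> carrier R"
    and "x \<in> carrier N \<Longrightarrow> y \<in> carrier N \<Longrightarrow> f (x \<oplus>\<^bsub>N\<^esub> y) = f x \<oplus>\<^bsub>R\<^esub> f y"
    and "r \<in> carrier R \<Longrightarrow> x \<in> carrier N \<Longrightarrow> f (r \<odot>\<^bsub>N\<^esub> x) = r \<otimes>\<^bsub>R\<^esub> f x"
  using assms by (auto simp: Hom_def dual_def)

section \<open>Traces\<close>

text \<open>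
  The index set is an arbitrary finite set, so that pairs of indices can serve as indices later.
\<close>

definition dual_basis ::
  "('r, 'k) ring_scheme \<Rightarrow> ('r, 'p, 'l) module_scheme \<Rightarrow> 'j set \<Rightarrow> ('j \<Rightarrow> 'p) \<Rightarrow> ('j \<Rightarrow> 'p \<Rightarrow> 'r) \<Rightarrow> bool"
  where "dual_basis R N J e d \<longleftrightarrow> finite J \<and> e \<in> J \<rightarrow> carrier N \<and> d \<in> J \<rightarrow> dual R N \<and>
    (\<forall>y\<in>carrier N. y = (\<Oplus>\<^bsub>N\<^esub>j\<in>J. d j y \<odot>\<^bsub>N\<^esub> e j))"

context module
begin

lemma dual_finsum:
  assumes "f \<in> dual R M" "x \<in> J \<rightarrow> carrier M"
  shows "f (\<Oplus>\<^bsub>M\<^esub>j\<in>J. x j) = (\<Oplus>j\<in>J. f (x j))"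
  using assms by (intro additive_finsum M.abelian_group_axioms R.abelian_group_axioms)
    (auto simp: dual_D)

text \<open>
  The value of a tensor representing \<open>\<phi>\<close> under evaluation does not depend on the tensor: expanding each
  \<open>x k\<close> in a dual basis turns it into an expression in \<open>\<phi>\<close> alone. This is what makes the definite
  description in the definition of the trace meaningful.
\<close>

lemma trace_of_tensor:
  assumes db: "dual_basis R M J e d"
    and "finite K" "x \<in> K \<rightarrow> carrier M" "f \<in> K \<rightarrow> dual R M"
    and \<phi>: "\<And>y. y \<in> carrier M \<Longrightarrow> \<phi> y = (\<Oplus>\<^bsub>M\<^esub>k\<in>K. f k y \<odot>\<^bsub>M\<^esub> x k)"
  shows "(\<Oplus>k\<in>K. f k (x k)) = (\<Oplus>j\<in>J. d j (\<phi> (e j)))"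
proof -
  have J: "finite J" and e: "\<And>j. j \<in> J \<Longrightarrow> e j \<in> carrier M" and d: "\<And>j. j \<in> J \<Longrightarrow> d j \<in> dual R M"
    and ex: "\<And>y. y \<in> carrier M \<Longrightarrow> y = (\<Oplus>\<^bsub>M\<^esub>j\<in>J. d j y \<odot>\<^bsub>M\<^esub> e j)"
    using db by (auto simp: dual_basis_def)
  have x: "\<And>k. k \<in> K \<Longrightarrow> x k \<in> carrier M" and f: "\<And>k. k \<in> K \<Longrightarrow> f k \<in> dual R M"
    using assms by auto
  note [simp] = e d x f dual_D[of _ R M]
  have 1: "f k (x k) = (\<Oplus>j\<in>J. f k (e j) \<otimes> d j (x k))" if k: "k \<in> K" for k
  proof -
    have "f k (x k) = f k (\<Oplus>\<^bsub>M\<^esub>j\<in>J. d j (x k) \<odot>\<^bsub>M\<^esub> e j)" using ex[of "x k"] k by simp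
    also have "\<dots> = (\<Oplus>j\<in>J. f k (d j (x k) \<odot>\<^bsub>M\<^esub> e j))" using k by (intro dual_finsum) auto
    also have "\<dots> = (\<Oplus>j\<in>J. f k (e j) \<otimes> d j (x k))"
      using k by (intro R.finsum_cong') (auto simp: R.m_comm)
    finally show ?thesis .
  qed
  have 2: "d j (\<phi> (e j)) = (\<Oplus>k\<in>K. f k (e j) \<otimes> d j (x k))" if j: "j \<in> J" for j
  proof -
    have "d j (\<phi> (e j)) = d j (\<Oplus>\<^bsub>M\<^esub>k\<in>K. f k (e j) \<odot>\<^bsub>M\<^esub> x k)" using \<phi>[of "e j"] j by simp
    also have "\<dots> = (\<Oplus>k\<in>K. d j (f k (e j) \<odot>\<^bsub>M\<^esub> x k))" using j by (intro dual_finsum) auto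
    also have "\<dots> = (\<Oplus>k\<in>K. f k (e j) \<otimes> d j (x k))"
      using j by (intro R.finsum_cong') auto
    finally show ?thesis .
  qed
  have "(\<Oplus>k\<in>K. f k (x k)) = (\<Oplus>k\<in>K. \<Oplus>j\<in>J. f k (e j) \<otimes> d j (x k))"
    by (intro R.finsum_cong') (auto simp: 1[symmetric])
  also have "\<dots> = (\<Oplus>j\<in>J. \<Oplus>k\<in>K. f k (e j) \<otimes> d j (x k))"
    using J assms(2) by (intro R.finsum_swap) auto
  also have "\<dots> = (\<Oplus>j\<in>J. d j (\<phi> (e j)))"
    by (intro R.finsum_cong') (auto simp: 2)
  finally show ?thesis .
qed

lemma Tr_eqI:
  assumes db: "dual_basis R M J e d"
    and K: "finite K" and x: "x \<in> K \<rightarrow> carrier M" and f: "f \<in> K \<rightarrow> dual R M"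
    and \<phi>: "\<And>y. y \<in> carrier M \<Longrightarrow> \<phi> y = (\<Oplus>\<^bsub>M\<^esub>k\<in>K. f k y \<odot>\<^bsub>M\<^esub> x k)"
  shows "Tr R M \<phi> = (\<Oplus>k\<in>K. f k (x k))"
  unfolding Tr_def
proof (rule the_equality)
  obtain h where h: "bij_betw h {..<card K} K"
    using ex_bij_betw_nat_finite[OF K] by (auto simp: atLeast0LessThan)
  have reindex: "finsum G F K = (\<Oplus>\<^bsub>G\<^esub>i\<in>{..<card K}. F (h i))"
    if "abelian_monoid G" "F \<in> K \<rightarrow> carrier G" for F and G :: "('z, 'y) ring_scheme"
  proof -
    interpret G: abelian_monoid G by fact
    have "F \<in> h ` {..<card K} \<rightarrow> carrier G" "inj_on h {..<card K}"
      using h that(2) by (simp_all only: bij_betw_def)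
    from G.finsum_reindex[OF this] show ?thesis
      using h by (simp only: bij_betw_def)
  qed
  have hK: "h i \<in> K" if "i < card K" for i
    using h that by (auto dest: bij_betwE)
  have xK: "\<And>k. k \<in> K \<Longrightarrow> x k \<in> carrier M" and fK: "\<And>k. k \<in> K \<Longrightarrow> f k \<in> dual R M"
    using x f by auto
  show "\<exists>(n::nat) x' f'. x' \<in> {..<n} \<rightarrow> carrier M \<and> f' \<in> {..<n} \<rightarrow> dual R M \<and>
      (\<forall>y\<in>carrier M. \<phi> y = (\<Oplus>\<^bsub>M\<^esub>i\<in>{..<n}. f' i y \<odot>\<^bsub>M\<^esub> x' i)) \<and>
      (\<Oplus>k\<in>K. f k (x k)) = (\<Oplus>i\<in>{..<n}. f' i (x' i))"
  proof (intro exI[of _ "card K"] exI[of _ "\<lambda>i. x (h i)"] exI[of _ "\<lambda>i. f (h i)"] conjI ballI)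
    show "(\<lambda>i. x (h i)) \<in> {..<card K} \<rightarrow> carrier M" "(\<lambda>i. f (h i)) \<in> {..<card K} \<rightarrow> dual R M"
      using xK fK hK by auto
    show "(\<Oplus>k\<in>K. f k (x k)) = (\<Oplus>i\<in>{..<card K}. f (h i) (x (h i)))"
      by (intro reindex R.abelian_monoid_axioms Pi_I dual_D(1)[OF fK] xK)
    fix y assume y: "y \<in> carrier M"
    show "\<phi> y = (\<Oplus>\<^bsub>M\<^esub>i\<in>{..<card K}. f (h i) y \<odot>\<^bsub>M\<^esub> x (h i))"
      unfolding \<phi>[OF y]
      by (intro reindex M.abelian_monoid_axioms Pi_I smult_closed dual_D(1)[OF fK] xK y)
  qed
next
  fix t
  assume "\<exists>(n::nat) x' f'. x' \<in> {..<n} \<rightarrow> carrier M \<and> f' \<in> {..<n} \<rightarrow> dual R M \<and>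
      (\<forall>y\<in>carrier M. \<phi> y = (\<Oplus>\<^bsub>M\<^esub>i\<in>{..<n}. f' i y \<odot>\<^bsub>M\<^esub> x' i)) \<and>
      t = (\<Oplus>i\<in>{..<n}. f' i (x' i))"
  then obtain n :: nat and x' f' where "x' \<in> {..<n} \<rightarrow> carrier M" "f' \<in> {..<n} \<rightarrow> dual R M"
      "\<And>y. y \<in> carrier M \<Longrightarrow> \<phi> y = (\<Oplus>\<^bsub>M\<^esub>i\<in>{..<n}. f' i y \<odot>\<^bsub>M\<^esub> x' i)"
    and t: "t = (\<Oplus>i\<in>{..<n}. f' i (x' i))"
    by blast
  then show "t = (\<Oplus>k\<in>K. f k (x k))"
    using trace_of_tensor[OF db finite_lessThan, of x' n f' \<phi>] trace_of_tensor[OF db K x f \<phi>]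
    by simp
qed

lemma Tr_dual_basis:
  assumes db: "dual_basis R M J e d" and \<phi>: "\<phi> \<in> Hom R M M"
  shows "Tr R M \<phi> = (\<Oplus>j\<in>J. d j (\<phi> (e j)))"
proof -
  have J: "finite J" and e: "\<And>j. j \<in> J \<Longrightarrow> e j \<in> carrier M" and d: "\<And>j. j \<in> J \<Longrightarrow> d j \<in> dual R M"
    and ex: "\<And>y. y \<in> carrier M \<Longrightarrow> y = (\<Oplus>\<^bsub>M\<^esub>j\<in>J. d j y \<odot>\<^bsub>M\<^esub> e j)"
    using db by (auto simp: dual_basis_def)
  note [simp] = e d dual_D[of _ R M] Hom_D[OF \<phi>]
  show ?thesis
  proof (rule Tr_eqI[OF db J, of "\<lambda>j. \<phi> (e j)" d])
    fix y assume y: "y \<in> carrier M"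
    have "\<phi> y = \<phi> (\<Oplus>\<^bsub>M\<^esub>j\<in>J. d j y \<odot>\<^bsub>M\<^esub> e j)" using ex[OF y] by simp
    also have "\<dots> = (\<Oplus>\<^bsub>M\<^esub>j\<in>J. \<phi> (d j y \<odot>\<^bsub>M\<^esub> e j))"
      using y by (intro Hom_finsum[OF M.abelian_group_axioms M.abelian_group_axioms \<phi>]) auto
    also have "\<dots> = (\<Oplus>\<^bsub>M\<^esub>j\<in>J. d j y \<odot>\<^bsub>M\<^esub> \<phi> (e j))"
      using y by (intro M.finsum_cong') auto
    finally show "\<phi> y = (\<Oplus>\<^bsub>M\<^esub>j\<in>J. d j y \<odot>\<^bsub>M\<^esub> \<phi> (e j))" .
  qed auto
qed

lemma Hom_compose:
  assumes \<phi>: "\<phi> \<in> Hom R M M" and \<psi>: "\<psi> \<in> Hom R M M"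
  shows "compose (carrier M) \<phi> \<psi> \<in> Hom R M M"
  unfolding compose_def using Hom_D[OF \<phi>] Hom_D[OF \<psi>] by (intro Hom_memI) auto

text \<open>
  The vectors \<open>\<phi> (e j)\<close> and functionals \<open>d j \<circ> \<psi>\<close> represent \<open>\<phi> \<circ> \<psi>\<close>, and evaluating them on each
  other gives the trace of \<open>\<psi> \<circ> \<phi>\<close> computed in the dual basis.
\<close>

lemma Tr_compose_commute:
  assumes db: "dual_basis R M J e d" and \<phi>: "\<phi> \<in> Hom R M M" and \<psi>: "\<psi> \<in> Hom R M M"
  shows "Tr R M (compose (carrier M) \<phi> \<psi>) = Tr R M (compose (carrier M) \<psi> \<phi>)"
proof -
  have J: "finite J" and e: "\<And>j. j \<in> J \<Longrightarrow> e j \<in> carrier M" and d: "\<And>j. j \<in> J \<Longrightarrow> d j \<in> dual R M"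
    and ex: "\<And>y. y \<in> carrier M \<Longrightarrow> y = (\<Oplus>\<^bsub>M\<^esub>j\<in>J. d j y \<odot>\<^bsub>M\<^esub> e j)"
    using db by (auto simp: dual_basis_def)
  note [simp] = e d dual_D[of _ R M] Hom_D[OF \<phi>] Hom_D[OF \<psi>]
  let ?f = "\<lambda>j. restrict (\<lambda>y. d j (\<psi> y)) (carrier M)"
  have "Tr R M (compose (carrier M) \<phi> \<psi>) = (\<Oplus>j\<in>J. ?f j (\<phi> (e j)))"
  proof (rule Tr_eqI[OF db J])
    show "?f \<in> J \<rightarrow> dual R M"
      unfolding dual_def by (intro Pi_I Hom_memI) auto
    fix y assume y: "y \<in> carrier M"
    have "\<phi> (\<psi> y) = \<phi> (\<Oplus>\<^bsub>M\<^esub>j\<in>J. d j (\<psi> y) \<odot>\<^bsub>M\<^esub> e j)" using ex[of "\<psi> y"] y by simp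
    also have "\<dots> = (\<Oplus>\<^bsub>M\<^esub>j\<in>J. \<phi> (d j (\<psi> y) \<odot>\<^bsub>M\<^esub> e j))"
      using y by (intro Hom_finsum[OF M.abelian_group_axioms M.abelian_group_axioms \<phi>]) auto
    also have "\<dots> = (\<Oplus>\<^bsub>M\<^esub>j\<in>J. ?f j y \<odot>\<^bsub>M\<^esub> \<phi> (e j))"
      using y by (intro M.finsum_cong') auto
    finally show "compose (carrier M) \<phi> \<psi> y = (\<Oplus>\<^bsub>M\<^esub>j\<in>J. ?f j y \<odot>\<^bsub>M\<^esub> \<phi> (e j))"
      using y by (simp add: compose_eq)
  qed auto
  also have "\<dots> = (\<Oplus>j\<in>J. d j (compose (carrier M) \<psi> \<phi> (e j)))"
    by (intro R.finsum_cong') (auto simp: compose_eq)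
  also have "\<dots> = Tr R M (compose (carrier M) \<psi> \<phi>)"
    by (rule Tr_dual_basis[OF db Hom_compose[OF \<psi> \<phi>], symmetric])
  finally show ?thesis .
qed

end

section \<open>Dual bases of finitely generated projective modules\<close>

definition free_basis :: "('s, 'k) ring_scheme \<Rightarrow> 'i set \<Rightarrow> 'i \<Rightarrow> 'i \<Rightarrow> 's" where
  "free_basis S I i = (\<lambda>j\<in>I. if j = i then \<one>\<^bsub>S\<^esub> else \<zero>\<^bsub>S\<^esub>)"

text \<open>
  The set \<open>I\<close> may be infinite, but each element of the free module is a finite combination of basis
  vectors. The statement allows any finite index set containing the support of
  \<open>c\<close>, so that one set can be used for all coordinate vectors of a finitely generated module.
\<close>

lemma Hom_free_module_expand:
  assumes "ring S" "abelian_group P" and \<pi>: "\<pi> \<in> Hom S (free_module S I) P"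
    and c: "c \<in> carrier (free_module S I)"
    and J: "finite J" "J \<subseteq> I" "\<And>i. i \<in> I - J \<Longrightarrow> c i = \<zero>\<^bsub>S\<^esub>"
  shows "\<pi> c = (\<Oplus>\<^bsub>P\<^esub>i\<in>J. c i \<odot>\<^bsub>P\<^esub> \<pi> (free_basis S I i))"
proof -
  interpret S: ring S by fact
  interpret P: abelian_group P by fact
  let ?F = "free_module S I"
  let ?r = "\<lambda>J. \<lambda>j\<in>I. if j \<in> J then c j else \<zero>\<^bsub>S\<^esub>"
  have cI: "\<And>i. i \<in> I \<Longrightarrow> c i \<in> carrier S" and cx: "c \<in> extensional I"
    using c by (auto simp: free_module_def PiE_def)
  have r: "?r K \<in> carrier ?F" if "finite K" for K
    using cI that by (auto simp: free_module_def intro: finite_subset[of _ K])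
  have b: "free_basis S I i \<in> carrier ?F" for i
    by (auto simp: free_module_def free_basis_def intro: finite_subset[of _ "{i}"])
  have pr: "\<pi> f \<in> carrier P" if "f \<in> carrier ?F" for f
    using Hom_D(1)[OF \<pi> that] .
  have "\<pi> (?r J) = (\<Oplus>\<^bsub>P\<^esub>i\<in>J. c i \<odot>\<^bsub>P\<^esub> \<pi> (free_basis S I i))"
    using J(1,2)
  proof (induction J)
    case empty
    have "?r {} \<oplus>\<^bsub>?F\<^esub> ?r {} = ?r {}"
      by (auto simp: free_module_def)
    then have "\<pi> (?r {}) \<oplus>\<^bsub>P\<^esub> \<pi> (?r {}) = \<pi> (?r {})"
      using Hom_D(2)[OF \<pi> r r, of "{}" "{}"] by simp
    then show ?case
      using pr[OF r, of "{}"] P.add.l_cancel_one by (simp add: restrict_def)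
  next
    case (insert i J)
    have s: "c i \<odot>\<^bsub>?F\<^esub> free_basis S I i \<in> carrier ?F"
      using insert cI by (auto simp: free_module_def free_basis_def intro: finite_subset[of _ "{i}"])
    have m: "c j \<odot>\<^bsub>P\<^esub> \<pi> (free_basis S I j) \<in> carrier P" if "j \<in> insert i J" for j
    proof -
      have "c j \<odot>\<^bsub>?F\<^esub> free_basis S I j \<in> carrier ?F"
        using that insert cI by (auto simp: free_module_def free_basis_def intro: finite_subset[of _ "{j}"])
      then have "\<pi> (c j \<odot>\<^bsub>?F\<^esub> free_basis S I j) \<in> carrier P"
        by (rule pr)
      then show ?thesis
        using Hom_D(3)[OF \<pi> cI b, of j j] that insert by auto
    qed
    have "?r (insert i J) = c i \<odot>\<^bsub>?F\<^esub> free_basis S I i \<oplus>\<^bsub>?F\<^esub> ?r J"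
      using insert cI by (auto simp: free_module_def free_basis_def fun_eq_iff)
    then have "\<pi> (?r (insert i J)) = \<pi> (c i \<odot>\<^bsub>?F\<^esub> free_basis S I i) \<oplus>\<^bsub>P\<^esub> \<pi> (?r J)"
      using Hom_D(2)[OF \<pi> s r] insert by simp
    also have "\<dots> = (\<Oplus>\<^bsub>P\<^esub>j\<in>insert i J. c j \<odot>\<^bsub>P\<^esub> \<pi> (free_basis S I j))"
      using insert m Hom_D(3)[OF \<pi> cI b, of i i] by (simp add: Pi_def restrict_def)
    finally show ?case .
  qed
  moreover have "?r J = c"
    using J(3) cx by (auto simp: fun_eq_iff extensional_def)
  ultimately show ?thesis by simp
qed

text \<open>
  The coordinates of the finitely many generators under an embedding into a free module have finite
  support \<open>J\<close> altogether, and so the coordinates of every element vanish outside \<open>J\<close>.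
\<close>

lemma finitely_generated_projective_dual_basis:
  fixes R :: "('r, 'k) ring_scheme" and N :: "('r, 'p, 'l) module_scheme"
  assumes "module R N" "finitely_generated R N" "projective R N"
  obtains J :: "'p set" and e d where "dual_basis R N J e d"
proof -
  interpret M: module R N by fact
  obtain X where X: "finite X" "X \<subseteq> carrier N"
    and gen: "carrier N = {(\<Oplus>\<^bsub>N\<^esub>x\<in>X. c x \<odot>\<^bsub>N\<^esub> x) | c. c \<in> X \<rightarrow> carrier R}"
    using assms(2) unfolding finitely_generated_def by blast
  obtain I :: "'p set" and \<iota> \<pi> where \<iota>: "\<iota> \<in> Hom R N (free_module R I)" and \<pi>: "\<pi> \<in> Hom R (free_module R I) N"
    and id: "\<And>x. x \<in> carrier N \<Longrightarrow> \<pi> (\<iota> x) = x"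
    using assms(3) unfolding projective_def by blast
  define J where "J = (\<Union>x\<in>X. {i\<in>I. \<iota> x i \<noteq> \<zero>\<^bsub>R\<^esub>})"
  define d where "d i = (\<lambda>y\<in>carrier N. \<iota> y i)" for i
  have \<iota>F: "\<iota> x i \<in> carrier R" if "x \<in> carrier N" "i \<in> I" for x i
    using Hom_D(1)[OF \<iota> that(1)] that(2) by (auto simp: free_module_def)
  have "finite {i\<in>I. \<iota> x i \<noteq> \<zero>\<^bsub>R\<^esub>}" if "x \<in> X" for x
    using Hom_D(1)[OF \<iota>, of x] that X by (auto simp: free_module_def)
  then have J: "finite J" "J \<subseteq> I"
    using X by (auto simp: J_def)
  have d: "d i \<in> dual R N" if "i \<in> I" for i
    unfolding d_def dual_def using Hom_D(2,3)[OF \<iota>] that \<iota>F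
    by (intro Hom_memI) (auto simp: free_module_def)
  have zero: "\<iota> y i = \<zero>\<^bsub>R\<^esub>" if y: "y \<in> carrier N" and i: "i \<in> I - J" for y i
  proof -
    obtain c where c: "c \<in> X \<rightarrow> carrier R" and yc: "y = (\<Oplus>\<^bsub>N\<^esub>x\<in>X. c x \<odot>\<^bsub>N\<^esub> x)"
      using y gen by auto
    have di: "d i \<in> dual R N" using d i by simp
    have x0: "d i x = \<zero>\<^bsub>R\<^esub>" if "x \<in> X" for x
      using that i X by (auto simp: J_def d_def)
    have "d i y = (\<Oplus>\<^bsub>R\<^esub>x\<in>X. d i (c x \<odot>\<^bsub>N\<^esub> x))"
      unfolding yc using c X by (intro M.dual_finsum di) auto
    also have "\<dots> = (\<Oplus>\<^bsub>R\<^esub>x\<in>X. \<zero>\<^bsub>R\<^esub>)"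
      using c X x0 by (intro M.R.finsum_cong') (auto simp: dual_D[OF di] Pi_iff subset_iff)
    finally show ?thesis using y by (simp add: d_def)
  qed
  have "dual_basis R N J (\<lambda>i. \<pi> (free_basis R I i)) d"
    unfolding dual_basis_def
  proof (intro conjI ballI)
    show "(\<lambda>i. \<pi> (free_basis R I i)) \<in> J \<rightarrow> carrier N"
      by (intro Pi_I Hom_D(1)[OF \<pi>])
        (auto simp: free_module_def free_basis_def intro: finite_subset[of _ "{_}"])
    then have f: "\<pi> (free_basis R I i) \<in> carrier N" if "i \<in> J" for i using that by auto
    show "d \<in> J \<rightarrow> dual R N" using d J by auto
    fix y assume y: "y \<in> carrier N"
    have "y = \<pi> (\<iota> y)" using id y by simp
    also have "\<dots> = (\<Oplus>\<^bsub>N\<^esub>i\<in>J. \<iota> y i \<odot>\<^bsub>N\<^esub> \<pi> (free_basis R I i))"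
      using y zero J Hom_D(1)[OF \<iota> y]
      by (intro Hom_free_module_expand M.R.ring_axioms M.M.abelian_group_axioms \<pi>) auto
    also have "\<dots> = (\<Oplus>\<^bsub>N\<^esub>i\<in>J. d i y \<odot>\<^bsub>N\<^esub> \<pi> (free_basis R I i))"
      using y f J \<iota>F by (intro M.M.finsum_cong') (auto simp: d_def subset_iff)
    finally show "y = (\<Oplus>\<^bsub>N\<^esub>i\<in>J. d i y \<odot>\<^bsub>N\<^esub> \<pi> (free_basis R I i))" .
  qed fact
  then show ?thesis by (rule that)
qed

lemma restrict_scalars_module:
  assumes "assoc_algebra R A" "left_module A M"
  shows "module R (restrict_scalars R A M)"
proof -
  interpret A: assoc_algebra R A by fact
  interpret M: left_module A M by fact
  have [simp]: "r \<odot>\<^bsub>A\<^esub> \<one>\<^bsub>A\<^esub> \<in> carrier A" if "r \<in> carrier R" for r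
    using that by simp
  show ?thesis
  proof (rule moduleI)
    show "cring R" by (rule A.R.is_cring)
    show "abelian_group (restrict_scalars R A M)"
      using M.P.l_neg by (intro abelian_groupI) (auto simp: M.P.a_ac intro: M.P.a_inv_closed)
    fix a b x assume ab: "a \<in> carrier R" "b \<in> carrier R" and x: "x \<in> carrier (restrict_scalars R A M)"
    have "(a \<otimes>\<^bsub>R\<^esub> b) \<odot>\<^bsub>A\<^esub> \<one>\<^bsub>A\<^esub> = (a \<odot>\<^bsub>A\<^esub> \<one>\<^bsub>A\<^esub>) \<otimes>\<^bsub>A\<^esub> (b \<odot>\<^bsub>A\<^esub> \<one>\<^bsub>A\<^esub>)"
      using ab by (simp add: A.smult_mult_left A.smult_assoc1)
    then show "a \<otimes>\<^bsub>R\<^esub> b \<odot>\<^bsub>restrict_scalars R A M\<^esub> x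
        = a \<odot>\<^bsub>restrict_scalars R A M\<^esub> (b \<odot>\<^bsub>restrict_scalars R A M\<^esub> x)"
      using ab x by (simp add: M.smult_assoc)
  qed (auto simp: M.smult_closed M.smult_l_distr M.smult_r_distr M.smult_one A.smult_l_distr A.smult_one)
qed

section \<open>The tensor product of algebras as a ring\<close>

lemma opposite_ring_simps [simp]:
  "carrier (opposite_ring A) = carrier A"
  "a \<otimes>\<^bsub>opposite_ring A\<^esub> b = b \<otimes>\<^bsub>A\<^esub> a"
  "\<one>\<^bsub>opposite_ring A\<^esub> = \<one>\<^bsub>A\<^esub>"
  "\<zero>\<^bsub>opposite_ring A\<^esub> = \<zero>\<^bsub>A\<^esub>"
  "a \<oplus>\<^bsub>opposite_ring A\<^esub> b = a \<oplus>\<^bsub>A\<^esub> b"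
  by (simp_all add: opposite_ring_def)

lemma smult_opposite_ring [simp]:
  fixes A :: "('r, 'a, 'l) module_scheme"
  shows "r \<odot>\<^bsub>opposite_ring A\<^esub> a = r \<odot>\<^bsub>A\<^esub> a"
  by (simp add: opposite_ring_def)

lemma opposite_ring_algebra:
  assumes "assoc_algebra R A"
  shows "assoc_algebra R (opposite_ring A)"
proof -
  interpret A: assoc_algebra R A by fact
  have ag: "abelian_group (opposite_ring A)"
    using A.M.l_neg by (intro abelian_groupI) (auto simp: A.M.a_ac intro: A.M.a_inv_closed)
  have "module R (opposite_ring A)"
    by (intro moduleI ag A.R.is_cring)
      (auto simp: A.smult_l_distr A.smult_r_distr A.smult_assoc1)
  moreover have "ring (opposite_ring A)"
    by (intro ringI ag monoidI) (auto simp: A.m_assoc A.l_distr A.r_distr)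
  ultimately show ?thesis
    by (intro assoc_algebra.intro assoc_algebra_axioms.intro)
      (auto simp: A.smult_mult_left A.smult_mult_right)
qed

lemma frag_extend_pointwise_add:
  "frag_extend (\<lambda>p. F p + G p) u = frag_extend F u + frag_extend G u"
  by (simp add: frag_extend_def frag_cmul_distrib2 sum.distrib)

lemma frag_extend_pointwise_minus:
  "frag_extend (\<lambda>p. - F p) u = - frag_extend F u"
  unfolding frag_extend_def sum_negf[symmetric] by (intro sum.cong refl poly_mapping_eqI) simp

lemma pair_ring_simps [simp]:
  "x \<in> carrier (pair_ring A B) \<longleftrightarrow> Poly_Mapping.keys x \<subseteq> carrier A \<times> carrier B"
  "x \<oplus>\<^bsub>pair_ring A B\<^esub> y = x + y"
  "\<zero>\<^bsub>pair_ring A B\<^esub> = 0"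
  "\<one>\<^bsub>pair_ring A B\<^esub> = frag_of (\<one>\<^bsub>A\<^esub>, \<one>\<^bsub>B\<^esub>)"
  by (simp_all add: pair_ring_def)

lemma pair_ring_mult_of [simp]:
  "frag_of (a, b) \<otimes>\<^bsub>pair_ring A B\<^esub> frag_of (c, d) = frag_of (a \<otimes>\<^bsub>A\<^esub> c, b \<otimes>\<^bsub>B\<^esub> d)"
  by (simp add: pair_ring_def)

lemma pair_ring_mult_additive:
  "(u + v) \<otimes>\<^bsub>pair_ring A B\<^esub> w = u \<otimes>\<^bsub>pair_ring A B\<^esub> w + v \<otimes>\<^bsub>pair_ring A B\<^esub> w"
  "(- u) \<otimes>\<^bsub>pair_ring A B\<^esub> w = - (u \<otimes>\<^bsub>pair_ring A B\<^esub> w)"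
  "(u - v) \<otimes>\<^bsub>pair_ring A B\<^esub> w = u \<otimes>\<^bsub>pair_ring A B\<^esub> w - v \<otimes>\<^bsub>pair_ring A B\<^esub> w"
  "0 \<otimes>\<^bsub>pair_ring A B\<^esub> w = 0"
  "w \<otimes>\<^bsub>pair_ring A B\<^esub> (u + v) = w \<otimes>\<^bsub>pair_ring A B\<^esub> u + w \<otimes>\<^bsub>pair_ring A B\<^esub> v"
  "w \<otimes>\<^bsub>pair_ring A B\<^esub> (- u) = - (w \<otimes>\<^bsub>pair_ring A B\<^esub> u)"
  "w \<otimes>\<^bsub>pair_ring A B\<^esub> (u - v) = w \<otimes>\<^bsub>pair_ring A B\<^esub> u - w \<otimes>\<^bsub>pair_ring A B\<^esub> v"
  "w \<otimes>\<^bsub>pair_ring A B\<^esub> 0 = 0"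
proof -
  show 1: "(u + v) \<otimes>\<^bsub>pair_ring A B\<^esub> w = u \<otimes>\<^bsub>pair_ring A B\<^esub> w + v \<otimes>\<^bsub>pair_ring A B\<^esub> w" for u v
    by (simp add: pair_ring_def frag_extend_add)
  show 2: "(- u) \<otimes>\<^bsub>pair_ring A B\<^esub> w = - (u \<otimes>\<^bsub>pair_ring A B\<^esub> w)" for u
    by (simp add: pair_ring_def frag_extend_minus)
  show "(u - v) \<otimes>\<^bsub>pair_ring A B\<^esub> w = u \<otimes>\<^bsub>pair_ring A B\<^esub> w - v \<otimes>\<^bsub>pair_ring A B\<^esub> w"
    by (simp only: 1 2 diff_conv_add_uminus)
  show "0 \<otimes>\<^bsub>pair_ring A B\<^esub> w = 0"
    by (simp add: pair_ring_def)
  show 3: "w \<otimes>\<^bsub>pair_ring A B\<^esub> (u + v) = w \<otimes>\<^bsub>pair_ring A B\<^esub> u + w \<otimes>\<^bsub>pair_ring A B\<^esub> v" for u v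
    by (simp add: pair_ring_def frag_extend_add case_prod_unfold frag_extend_pointwise_add)
  show 4: "w \<otimes>\<^bsub>pair_ring A B\<^esub> (- u) = - (w \<otimes>\<^bsub>pair_ring A B\<^esub> u)" for u
    by (simp add: pair_ring_def frag_extend_minus case_prod_unfold frag_extend_pointwise_minus)
  show "w \<otimes>\<^bsub>pair_ring A B\<^esub> (u - v) = w \<otimes>\<^bsub>pair_ring A B\<^esub> u - w \<otimes>\<^bsub>pair_ring A B\<^esub> v"
    by (simp only: 3 4 diff_conv_add_uminus)
  show "w \<otimes>\<^bsub>pair_ring A B\<^esub> 0 = 0"
    using 3[of 0 0] by simp
qed

text \<open>
  Maps on formal combinations are compared generator by generator; all the identities in question are
  additive in each argument.
\<close>

lemmas frag_on_induct = free_Abelian_group_induct[consumes 1, case_names zero diff gen]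

lemma keys_diff_subset: "Poly_Mapping.keys x \<subseteq> S \<Longrightarrow> Poly_Mapping.keys y \<subseteq> S \<Longrightarrow> Poly_Mapping.keys (x - y) \<subseteq> S"
  using keys_diff[of x y] by blast

lemma pair_ring_is_ring:
  assumes "ring A" "ring B"
  shows "ring (pair_ring A B)"
proof -
  interpret A: ring A by fact
  interpret B: ring B by fact
  let ?P = "pair_ring A B" and ?S = "carrier A \<times> carrier B"
  have add: "Poly_Mapping.keys (x + y) \<subseteq> ?S"
    if "Poly_Mapping.keys x \<subseteq> ?S" "Poly_Mapping.keys y \<subseteq> ?S" for x y :: "'a \<times> 'c \<Rightarrow>\<^sub>0 int"
    using that keys_add[of x y] by blast
  have closed: "Poly_Mapping.keys (u \<otimes>\<^bsub>?P\<^esub> v) \<subseteq> ?S"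
    if u: "Poly_Mapping.keys u \<subseteq> ?S" and v: "Poly_Mapping.keys v \<subseteq> ?S" for u v
    using u
  proof (induction u rule: frag_on_induct)
    case (gen p)
    show ?case
      using v
    proof (induction v rule: frag_on_induct)
      case (gen q)
      then show ?case using \<open>p \<in> ?S\<close> by (cases p; cases q) auto
    qed (simp_all add: pair_ring_mult_additive keys_diff_subset)
  qed (simp_all add: pair_ring_mult_additive keys_diff_subset)
  have one: "frag_of (\<one>\<^bsub>A\<^esub>, \<one>\<^bsub>B\<^esub>) \<otimes>\<^bsub>?P\<^esub> u = u" "u \<otimes>\<^bsub>?P\<^esub> frag_of (\<one>\<^bsub>A\<^esub>, \<one>\<^bsub>B\<^esub>) = u"
    if u: "Poly_Mapping.keys u \<subseteq> ?S" for u
    using u by (induction u rule: frag_on_induct) (auto simp: pair_ring_mult_additive)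
  have assoc: "(u \<otimes>\<^bsub>?P\<^esub> v) \<otimes>\<^bsub>?P\<^esub> w = u \<otimes>\<^bsub>?P\<^esub> (v \<otimes>\<^bsub>?P\<^esub> w)"
    if u: "Poly_Mapping.keys u \<subseteq> ?S" and v: "Poly_Mapping.keys v \<subseteq> ?S"
      and w: "Poly_Mapping.keys w \<subseteq> ?S" for u v w
    using u
  proof (induction u rule: frag_on_induct)
    case (gen p)
    show ?case
      using v
    proof (induction v rule: frag_on_induct)
      case (gen q)
      show ?case
        using w
      proof (induction w rule: frag_on_induct)
        case (gen r)
        then show ?case using \<open>p \<in> ?S\<close> \<open>q \<in> ?S\<close> by (cases p; cases q; cases r) (auto simp: A.m_assoc B.m_assoc)
      qed (auto simp: pair_ring_mult_additive)
    qed (auto simp: pair_ring_mult_additive)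
  qed (auto simp: pair_ring_mult_additive)
  show ?thesis
  proof (intro ringI abelian_groupI monoidI)
    fix x assume "x \<in> carrier ?P"
    then show "\<exists>y\<in>carrier ?P. y \<oplus>\<^bsub>?P\<^esub> x = \<zero>\<^bsub>?P\<^esub>"
      by (intro bexI[of _ "-x"]) auto
  qed (auto simp: add[simplified] closed[simplified] one assoc pair_ring_mult_additive add.assoc add.commute
        dest: subsetD[OF add] subsetD[OF closed] subsetD)
qed

abbreviation tensor_relations ::
  "('r, 'k) ring_scheme \<Rightarrow> ('r, 'a, 'l) module_scheme \<Rightarrow> ('r, 'b, 'n) module_scheme
    \<Rightarrow> (('a \<times> 'b) \<Rightarrow>\<^sub>0 int) set" where
  "tensor_relations R A B \<equiv>
     generate (free_Abelian_group (carrier A \<times> carrier B)) (bilinearity_relators R A B)"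

lemma bilinearity_relator_cases:
  assumes "k \<in> bilinearity_relators R A B"
  obtains (left) a a' b where "a \<in> carrier A" "a' \<in> carrier A" "b \<in> carrier B"
      "k = frag_of (a \<oplus>\<^bsub>A\<^esub> a', b) - frag_of (a, b) - frag_of (a', b)"
  | (right) a b b' where "a \<in> carrier A" "b \<in> carrier B" "b' \<in> carrier B"
      "k = frag_of (a, b \<oplus>\<^bsub>B\<^esub> b') - frag_of (a, b) - frag_of (a, b')"
  | (scalar) r a b where "r \<in> carrier R" "a \<in> carrier A" "b \<in> carrier B"
      "k = frag_of (r \<odot>\<^bsub>A\<^esub> a, b) - frag_of (a, r \<odot>\<^bsub>B\<^esub> b)"
  using assms unfolding bilinearity_relators_def by blast

lemma bilinearity_relatorI:
  "\<lbrakk>a \<in> carrier A; a' \<in> carrier A; b \<in> carrier B\<rbrakk> \<Longrightarrow>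
    frag_of (a \<oplus>\<^bsub>A\<^esub> a', b) - frag_of (a, b) - frag_of (a', b) \<in> bilinearity_relators R A B"
  "\<lbrakk>a \<in> carrier A; b \<in> carrier B; b' \<in> carrier B\<rbrakk> \<Longrightarrow>
    frag_of (a, b \<oplus>\<^bsub>B\<^esub> b') - frag_of (a, b) - frag_of (a, b') \<in> bilinearity_relators R A B"
  "\<lbrakk>r \<in> carrier R; a \<in> carrier A; b \<in> carrier B\<rbrakk> \<Longrightarrow>
    frag_of (r \<odot>\<^bsub>A\<^esub> a, b) - frag_of (a, r \<odot>\<^bsub>B\<^esub> b) \<in> bilinearity_relators R A B"
  unfolding bilinearity_relators_def by blast+

lemma bilinearity_relators_closed:
  assumes "assoc_algebra R A" "assoc_algebra R B"
  shows "bilinearity_relators R A B \<subseteq> carrier (free_Abelian_group (carrier A \<times> carrier B))"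
proof
  interpret A: assoc_algebra R A by fact
  interpret B: assoc_algebra R B by fact
  fix k assume "k \<in> bilinearity_relators R A B"
  then show "k \<in> carrier (free_Abelian_group (carrier A \<times> carrier B))"
    by (cases rule: bilinearity_relator_cases) (simp_all add: keys_diff_subset)
qed

lemma tensor_relations_subgroup:
  assumes "assoc_algebra R A" "assoc_algebra R B"
  shows "subgroup (tensor_relations R A B) (free_Abelian_group (carrier A \<times> carrier B))"
  by (intro group.generate_is_subgroup bilinearity_relators_closed assms group_free_Abelian_group)

text \<open>
  A generator \<open>(c, d)\<close> times a bilinearity relator is again a relator of the same kind, by
  distributivity and compatibility with scalars; by additivity the subgroup generated by the relators
  absorbs products with arbitrary elements.
\<close>

lemma tensor_relations_ideal:
  assumes "assoc_algebra R A" "assoc_algebra R B"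
  shows "ideal (tensor_relations R A B) (pair_ring A B)"
proof -
  interpret A: assoc_algebra R A by fact
  interpret B: assoc_algebra R B by fact
  interpret P: ring "pair_ring A B"
    by (intro pair_ring_is_ring A.ring_axioms B.ring_axioms)
  let ?P = "pair_ring A B" and ?S = "carrier A \<times> carrier B"
  let ?F = "free_Abelian_group ?S" and ?K = "tensor_relations R A B"
  note sub = tensor_relations_subgroup[OF assms]
  have K0: "0 \<in> ?K" using subgroup.one_closed[OF sub] by simp
  have Kin: "Poly_Mapping.keys x \<subseteq> ?S" if "x \<in> ?K" for x
    using subgroup.mem_carrier[OF sub that] by simp
  have Kadd: "x + y \<in> ?K" if "x \<in> ?K" "y \<in> ?K" for x y
    using subgroup.m_closed[OF sub that] by simp
  have Kminus: "- x \<in> ?K" if "x \<in> ?K" for x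
    using subgroup.m_inv_closed[OF sub that] Kin[OF that] by simp
  have Kdiff: "x - y \<in> ?K" if "x \<in> ?K" "y \<in> ?K" for x y
    using Kadd[OF that(1) Kminus[OF that(2)]] by simp
  define T where "T = {k. Poly_Mapping.keys k \<subseteq> ?S \<and>
      (\<forall>u. Poly_Mapping.keys u \<subseteq> ?S \<longrightarrow> u \<otimes>\<^bsub>?P\<^esub> k \<in> ?K \<and> k \<otimes>\<^bsub>?P\<^esub> u \<in> ?K)}"
  have "?K \<subseteq> T"
  proof (rule group.generate_subgroup_incl[OF group_free_Abelian_group])
    show "subgroup T ?F"
    proof (rule group.subgroupI[OF group_free_Abelian_group])
      have "0 \<in> T" using K0 by (auto simp: T_def pair_ring_mult_additive)
      then show "T \<noteq> {}" by auto
      show "T \<subseteq> carrier ?F" by (auto simp: T_def)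
      fix x assume x: "x \<in> T"
      then show "inv\<^bsub>?F\<^esub> x \<in> T"
        using Kminus by (simp add: T_def pair_ring_mult_additive)
      fix y assume y: "y \<in> T"
      show "x \<otimes>\<^bsub>?F\<^esub> y \<in> T"
        using x y Kadd P.a_closed[of x y] by (simp add: T_def pair_ring_mult_additive)
    qed
    show "bilinearity_relators R A B \<subseteq> T"
    proof
      fix k assume k: "k \<in> bilinearity_relators R A B"
      have "u \<otimes>\<^bsub>?P\<^esub> k \<in> ?K \<and> k \<otimes>\<^bsub>?P\<^esub> u \<in> ?K" if "Poly_Mapping.keys u \<subseteq> ?S" for u
        using that
      proof (induction u rule: frag_on_induct)
        case zero
        then show ?case using K0 by (simp add: pair_ring_mult_additive)
      next
        case (diff u v)
        then show ?case using Kdiff by (simp add: pair_ring_mult_additive)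
      next
        case (gen p)
        obtain c d where p: "p = (c, d)" "c \<in> carrier A" "d \<in> carrier B" using gen by auto
        have "frag_of p \<otimes>\<^bsub>?P\<^esub> k \<in> bilinearity_relators R A B \<and> k \<otimes>\<^bsub>?P\<^esub> frag_of p \<in> bilinearity_relators R A B"
          using k
        proof (cases rule: bilinearity_relator_cases)
          case (left a a' b)
          then show ?thesis
            using p by (simp add: pair_ring_mult_additive A.l_distr A.r_distr bilinearity_relatorI)
        next
          case (right a b b')
          then show ?thesis
            using p by (simp add: pair_ring_mult_additive B.l_distr B.r_distr bilinearity_relatorI)
        next
          case (scalar r a b)
          then show ?thesis
            using p by (simp add: pair_ring_mult_additive A.smult_mult_left A.smult_mult_right
                B.smult_mult_left B.smult_mult_right bilinearity_relatorI)
        qed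
        then show ?case by (blast intro: generate.incl)
      qed
      then show "k \<in> T"
        using subsetD[OF bilinearity_relators_closed[OF assms] k] by (simp add: T_def)
    qed
  qed
  then have "\<And>k u. \<lbrakk>k \<in> ?K; Poly_Mapping.keys u \<subseteq> ?S\<rbrakk> \<Longrightarrow> u \<otimes>\<^bsub>?P\<^esub> k \<in> ?K \<and> k \<otimes>\<^bsub>?P\<^esub> u \<in> ?K"
    by (auto simp: T_def)
  moreover have "add_monoid ?P = ?F"
    by (simp add: pair_ring_def free_Abelian_group_def)
  ultimately show ?thesis
    using sub by (intro idealI P.ring_axioms) simp_all
qed

section \<open>Balanced maps on the tensor product\<close>

definition balanced_map ::
  "('r, 'k) ring_scheme \<Rightarrow> ('r, 'a, 'l) module_scheme \<Rightarrow> ('r, 'b, 'n) module_scheme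
    \<Rightarrow> ('s, 'p, 'q) module_scheme \<Rightarrow> ('a \<Rightarrow> 'b \<Rightarrow> 'p) \<Rightarrow> bool" where
  "balanced_map R A B N f \<longleftrightarrow>
    (\<forall>a\<in>carrier A. \<forall>b\<in>carrier B. f a b \<in> carrier N) \<and>
    (\<forall>a\<in>carrier A. \<forall>a'\<in>carrier A. \<forall>b\<in>carrier B. f (a \<oplus>\<^bsub>A\<^esub> a') b = f a b \<oplus>\<^bsub>N\<^esub> f a' b) \<and>
    (\<forall>a\<in>carrier A. \<forall>b\<in>carrier B. \<forall>b'\<in>carrier B. f a (b \<oplus>\<^bsub>B\<^esub> b') = f a b \<oplus>\<^bsub>N\<^esub> f a b') \<and>
    (\<forall>r\<in>carrier R. \<forall>a\<in>carrier A. \<forall>b\<in>carrier B. f (r \<odot>\<^bsub>A\<^esub> a) b = f a (r \<odot>\<^bsub>B\<^esub> b))"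

text \<open>
  The additive extension of a map on generators to formal integer combinations, written exactly as the
  sum through which elements of the enveloping algebra act on \<open>A\<close>.
\<close>

definition frag_sum :: "('p, 'q) ring_scheme \<Rightarrow> ('i \<Rightarrow> 'p) \<Rightarrow> ('i \<Rightarrow>\<^sub>0 int) \<Rightarrow> 'p" where
  "frag_sum N f u = (\<Oplus>\<^bsub>N\<^esub>p\<in>Poly_Mapping.keys u. [(Poly_Mapping.lookup u p)] \<cdot>\<^bsub>N\<^esub> f p)"

context abelian_group
begin

lemma int_add_pow_simps:
  fixes i j :: int
  assumes "x \<in> carrier G"
  shows "[i] \<cdot> x \<in> carrier G" "[(i + j)] \<cdot> x = [i] \<cdot> x \<oplus> [j] \<cdot> x" "[(0::int)] \<cdot> x = \<zero>" "[(1::int)] \<cdot> x = x"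
  using assms group.int_pow_closed[OF a_group, of x i] group.int_pow_mult[OF a_group, of x i j]
    group.int_pow_1[OF a_group, of x]
  by (simp_all add: add_pow_def int_pow_def2)

text \<open>
  Lets two combinations with different supports be summed over a common index set.
\<close>

lemma frag_sum_superset:
  assumes "f \<in> S \<rightarrow> carrier G" "finite T" "Poly_Mapping.keys u \<subseteq> T" "T \<subseteq> S"
  shows "frag_sum G f u = (\<Oplus>p\<in>T. [(Poly_Mapping.lookup u p)] \<cdot> f p)"
  unfolding frag_sum_def
proof (rule add.finprod_mono_neutral_cong_left)
  fix i assume i: "i \<in> T - Poly_Mapping.keys u"
  then have "f i \<in> carrier G" using assms by auto
  then show "[(Poly_Mapping.lookup u i)] \<cdot> f i = \<zero>"
    using i by (simp add: in_keys_iff int_add_pow_simps)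
qed (use assms in \<open>auto intro!: int_add_pow_simps\<close>)

lemma frag_sum_closed:
  assumes "f \<in> S \<rightarrow> carrier G" "Poly_Mapping.keys u \<subseteq> S"
  shows "frag_sum G f u \<in> carrier G"
  unfolding frag_sum_def using assms by (auto intro!: finsum_closed int_add_pow_simps)

lemma frag_sum_add:
  assumes f: "f \<in> S \<rightarrow> carrier G" and u: "Poly_Mapping.keys u \<subseteq> S" and v: "Poly_Mapping.keys v \<subseteq> S"
  shows "frag_sum G f (u + v) = frag_sum G f u \<oplus> frag_sum G f v"
proof -
  let ?T = "Poly_Mapping.keys u \<union> Poly_Mapping.keys v"
  have fc: "f p \<in> carrier G" if "p \<in> ?T" for p using f u v that by auto
  have "frag_sum G f (u + v) = (\<Oplus>p\<in>?T. [(Poly_Mapping.lookup (u + v) p)] \<cdot> f p)"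
    using u v keys_add[of u v] by (intro frag_sum_superset[OF f]) auto
  also have "\<dots> = (\<Oplus>p\<in>?T. [(Poly_Mapping.lookup u p)] \<cdot> f p \<oplus> [(Poly_Mapping.lookup v p)] \<cdot> f p)"
    using fc by (intro finsum_cong') (auto simp: lookup_add int_add_pow_simps)
  also have "\<dots> = (\<Oplus>p\<in>?T. [(Poly_Mapping.lookup u p)] \<cdot> f p) \<oplus> (\<Oplus>p\<in>?T. [(Poly_Mapping.lookup v p)] \<cdot> f p)"
    using fc by (intro finsum_addf) (auto simp: int_add_pow_simps)
  also have "\<dots> = frag_sum G f u \<oplus> frag_sum G f v"
    using u v by (simp add: frag_sum_superset[OF f, of ?T])
  finally show ?thesis .
qed

lemma frag_sum_of:
  assumes "f p \<in> carrier G"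
  shows "frag_sum G f (frag_of p) = f p"
  using assms by (simp add: frag_sum_def int_add_pow_simps)

lemma frag_sum_diff:
  assumes f: "f \<in> S \<rightarrow> carrier G" and u: "Poly_Mapping.keys u \<subseteq> S" and v: "Poly_Mapping.keys v \<subseteq> S"
  shows "frag_sum G f (u - v) = frag_sum G f u \<ominus> frag_sum G f v"
proof -
  have "frag_sum G f u = frag_sum G f (u - v) \<oplus> frag_sum G f v"
    using frag_sum_add[OF f keys_diff_subset[OF u v] v] by simp
  then show ?thesis
    using frag_sum_closed[OF f keys_diff_subset[OF u v]] frag_sum_closed[OF f v]
    by (simp add: minus_eq a_assoc r_neg)
qed

lemma frag_sum_zero: "frag_sum G f 0 = \<zero>"
  by (simp add: frag_sum_def)

lemma frag_sum_pointwise_add: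
  assumes f: "f \<in> S \<rightarrow> carrier G" and g: "g \<in> S \<rightarrow> carrier G" and u: "Poly_Mapping.keys u \<subseteq> S"
  shows "frag_sum G (\<lambda>p. f p \<oplus> g p) u = frag_sum G f u \<oplus> frag_sum G g u"
  using u
proof (induction u rule: frag_on_induct)
  case (diff x y)
  have fg: "(\<lambda>p. f p \<oplus> g p) \<in> S \<rightarrow> carrier G" using f g by auto
  note c = frag_sum_closed[OF f diff(1)] frag_sum_closed[OF f diff(2)]
    frag_sum_closed[OF g diff(1)] frag_sum_closed[OF g diff(2)]
  show ?case
    using diff.IH c by (simp add: frag_sum_diff[OF fg] frag_sum_diff[OF f] frag_sum_diff[OF g] diff.hyps
        minus_eq minus_add a_ac)
next
  case (gen p)
  then show ?case using f g by (simp add: frag_sum_of Pi_iff)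
qed (simp add: frag_sum_zero)

lemma frag_sum_cong:
  assumes "\<And>p. p \<in> S \<Longrightarrow> f p = g p" "g \<in> S \<rightarrow> carrier G" "Poly_Mapping.keys u \<subseteq> S"
  shows "frag_sum G f u = frag_sum G g u"
  unfolding frag_sum_def using assms
  by (intro finsum_cong') (auto intro!: int_add_pow_simps simp: subset_iff)

lemma add_diff_diff:
  assumes "x \<in> carrier G" "y \<in> carrier G"
  shows "x \<oplus> y \<ominus> x \<ominus> y = \<zero>"
proof -
  have "x \<oplus> y \<ominus> x \<ominus> y = (x \<oplus> \<ominus> x) \<oplus> (y \<oplus> \<ominus> y)"
    using assms unfolding minus_eq by (simp only: a_ac a_inv_closed a_closed)
  then show ?thesis using assms by (simp add: r_neg)
qed

end

lemma additive_frag_sum: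
  assumes "abelian_group P" "abelian_group Q" "h \<in> carrier P \<rightarrow> carrier Q"
    and "\<And>x y. \<lbrakk>x \<in> carrier P; y \<in> carrier P\<rbrakk> \<Longrightarrow> h (x \<oplus>\<^bsub>P\<^esub> y) = h x \<oplus>\<^bsub>Q\<^esub> h y"
    and f: "f \<in> S \<rightarrow> carrier P" and u: "Poly_Mapping.keys u \<subseteq> S"
  shows "h (frag_sum P f u) = frag_sum Q (\<lambda>p. h (f p)) u"
proof -
  interpret P: abelian_group P by fact
  interpret Q: abelian_group Q by fact
  have hf: "(\<lambda>p. h (f p)) \<in> S \<rightarrow> carrier Q" using assms by auto
  have hd: "h (x \<ominus>\<^bsub>P\<^esub> y) = h x \<ominus>\<^bsub>Q\<^esub> h y" if "x \<in> carrier P" "y \<in> carrier P" for x y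
  proof -
    have "h x = h (x \<ominus>\<^bsub>P\<^esub> y \<oplus>\<^bsub>P\<^esub> y)"
      using that by (simp add: P.minus_eq P.a_assoc P.l_neg)
    also have "\<dots> = h (x \<ominus>\<^bsub>P\<^esub> y) \<oplus>\<^bsub>Q\<^esub> h y"
      using that by (intro assms(4)) auto
    finally show ?thesis
      using that funcset_mem[OF assms(3)] by (simp add: Q.minus_eq Q.a_assoc Q.r_neg)
  qed
  show ?thesis
    using u
  proof (induction u rule: frag_on_induct)
    case (diff x y)
    note c = P.frag_sum_closed[OF f diff(1)] P.frag_sum_closed[OF f diff(2)]
    show ?case
      using diff.IH c by (simp add: P.frag_sum_diff[OF f] Q.frag_sum_diff[OF hf] diff.hyps hd)
  next
    case (gen p)
    then show ?case using f hf by (simp add: P.frag_sum_of Q.frag_sum_of Pi_iff)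
  qed (simp add: P.frag_sum_zero Q.frag_sum_zero additive_zero[OF assms(1-4)])
qed

text \<open>
  The universal property of the tensor product, in the form used below: a balanced map kills the
  relations, so its extension is constant on cosets.
\<close>

lemma frag_sum_tensor_relation:
  assumes "assoc_algebra R A" "assoc_algebra R B" "abelian_group N"
    and f: "balanced_map R A B N f" and k: "k \<in> tensor_relations R A B"
  shows "frag_sum N (case_prod f) k = \<zero>\<^bsub>N\<^esub>"
proof -
  interpret A: assoc_algebra R A by fact
  interpret B: assoc_algebra R B by fact
  interpret N: abelian_group N by fact
  let ?S = "carrier A \<times> carrier B" and ?f = "case_prod f"
  let ?F = "free_Abelian_group ?S"
  have fS: "?f \<in> ?S \<rightarrow> carrier N" using f by (auto simp: balanced_map_def)
  have fc: "f a b \<in> carrier N" if "a \<in> carrier A" "b \<in> carrier B" for a b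
    using f that by (auto simp: balanced_map_def)
  note rel = bilinearity_relators_closed[OF assms(1,2)]
  define T where "T = {k. Poly_Mapping.keys k \<subseteq> ?S \<and> frag_sum N ?f k = \<zero>\<^bsub>N\<^esub>}"
  have d: "frag_sum N ?f (u - v) = frag_sum N ?f u \<ominus>\<^bsub>N\<^esub> frag_sum N ?f v"
    if "Poly_Mapping.keys u \<subseteq> ?S" "Poly_Mapping.keys v \<subseteq> ?S" for u v
    by (rule N.frag_sum_diff[OF fS that])
  have "tensor_relations R A B \<subseteq> T"
  proof (rule group.generate_subgroup_incl[OF group_free_Abelian_group])
    have z: "frag_sum N ?f 0 = \<zero>\<^bsub>N\<^esub>" by (simp add: frag_sum_def)
    show "subgroup T ?F"
    proof (rule group.subgroupI[OF group_free_Abelian_group])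
      show "T \<noteq> {}" using z by (auto simp: T_def intro: exI[of _ 0])
      show "T \<subseteq> carrier ?F" by (auto simp: T_def)
      fix x assume x: "x \<in> T"
      then show "inv\<^bsub>?F\<^esub> x \<in> T"
        using d[of 0 x] z by (simp add: T_def N.minus_eq)
      fix y assume y: "y \<in> T"
      show "x \<otimes>\<^bsub>?F\<^esub> y \<in> T"
        using x y N.frag_sum_add[OF fS, of x y] keys_add[of x y] by (auto simp: T_def)
    qed
    show "bilinearity_relators R A B \<subseteq> T"
    proof
      fix k assume k: "k \<in> bilinearity_relators R A B"
      from k have "frag_sum N ?f k = \<zero>\<^bsub>N\<^esub>"
      proof (cases rule: bilinearity_relator_cases)
        case (left a a' b)
        then have "f (a \<oplus>\<^bsub>A\<^esub> a') b = f a b \<oplus>\<^bsub>N\<^esub> f a' b"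
          using f by (auto simp: balanced_map_def)
        with left show ?thesis
          by (simp add: d keys_diff_subset N.frag_sum_of fc N.add_diff_diff)
      next
        case (right a b b')
        then have "f a (b \<oplus>\<^bsub>B\<^esub> b') = f a b \<oplus>\<^bsub>N\<^esub> f a b'"
          using f by (auto simp: balanced_map_def)
        with right show ?thesis
          by (simp add: d keys_diff_subset N.frag_sum_of fc N.add_diff_diff)
      next
        case (scalar r a b)
        then have "f (r \<odot>\<^bsub>A\<^esub> a) b = f a (r \<odot>\<^bsub>B\<^esub> b)"
          using f by (auto simp: balanced_map_def)
        with scalar show ?thesis
          by (simp add: d keys_diff_subset N.frag_sum_of fc N.minus_eq N.r_neg)
      qed
      then show "k \<in> T" using subsetD[OF rel k] by (simp add: T_def)
    qed
  qed
  then show ?thesis using k by (auto simp: T_def)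
qed

lemma frag_sum_coset:
  assumes "assoc_algebra R A" "assoc_algebra R B" "abelian_group N"
    and f: "balanced_map R A B N f"
    and w: "Poly_Mapping.keys w \<subseteq> carrier A \<times> carrier B"
    and v: "v \<in> tensor_relations R A B +>\<^bsub>pair_ring A B\<^esub> w"
  shows "frag_sum N (case_prod f) v = frag_sum N (case_prod f) w"
proof -
  interpret N: abelian_group N by fact
  interpret K: ideal "tensor_relations R A B" "pair_ring A B"
    by (rule tensor_relations_ideal[OF assms(1,2)])
  have fS: "case_prod f \<in> carrier A \<times> carrier B \<rightarrow> carrier N"
    using f by (auto simp: balanced_map_def)
  obtain k where k: "k \<in> tensor_relations R A B" and vk: "v = k + w"
    using v unfolding a_r_coset_def r_coset_def by auto
  have "Poly_Mapping.keys k \<subseteq> carrier A \<times> carrier B" using K.a_Hcarr[OF k] by simp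
  then show ?thesis
    using N.frag_sum_add[OF fS _ w, of k] frag_sum_tensor_relation[OF assms(1-4) k]
      N.frag_sum_closed[OF fS w] vk by simp
qed

section \<open>Separability and splittings\<close>

lemma enveloping_module_simps [simp]:
  "carrier (enveloping_module A) = carrier A"
  "x \<oplus>\<^bsub>enveloping_module A\<^esub> y = x \<oplus>\<^bsub>A\<^esub> y"
  "\<zero>\<^bsub>enveloping_module A\<^esub> = \<zero>\<^bsub>A\<^esub>"
  "finsum (enveloping_module A) = finsum A"
  by (simp_all add: enveloping_module_def finsum_def finprod_def fun_eq_iff)

lemma tensor_algebra_is_ring:
  assumes "assoc_algebra R A" "assoc_algebra R B"
  shows "ring (tensor_algebra R A B)"
  unfolding tensor_algebra_def by (rule ideal.quotient_is_ring[OF tensor_relations_ideal[OF assms]])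

lemma carrier_tensor_algebra:
  "carrier (tensor_algebra R A B) =
    {tensor_relations R A B +>\<^bsub>pair_ring A B\<^esub> u | u. Poly_Mapping.keys u \<subseteq> carrier A \<times> carrier B}"
  by (auto simp: tensor_algebra_def FactRing_def A_RCOSETS_def')

lemma tensor_algebra_mult:
  assumes "assoc_algebra R A" "assoc_algebra R B"
    and "Poly_Mapping.keys u \<subseteq> carrier A \<times> carrier B" "Poly_Mapping.keys v \<subseteq> carrier A \<times> carrier B"
  shows "(tensor_relations R A B +>\<^bsub>pair_ring A B\<^esub> u) \<otimes>\<^bsub>tensor_algebra R A B\<^esub>
      (tensor_relations R A B +>\<^bsub>pair_ring A B\<^esub> v) =
      tensor_relations R A B +>\<^bsub>pair_ring A B\<^esub> (u \<otimes>\<^bsub>pair_ring A B\<^esub> v)"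
  unfolding tensor_algebra_def
  using ideal.rcoset_mult_add[OF tensor_relations_ideal[OF assms(1,2)]] assms(3,4)
  by (simp add: FactRing_def)

text \<open>
  The scalar multiplication is defined from all representatives of a coset at once; as
  \<open>(a, b) \<mapsto> a x b\<close> is balanced they all give the same value.
\<close>

lemma enveloping_smult:
  assumes "assoc_algebra R A" "x \<in> carrier A"
    and u: "Poly_Mapping.keys u \<subseteq> carrier A \<times> carrier A"
  shows "(tensor_relations R A (opposite_ring A) +>\<^bsub>pair_ring A (opposite_ring A)\<^esub> u) \<odot>\<^bsub>enveloping_module A\<^esub> x
    = frag_sum A (\<lambda>(a, b). a \<otimes>\<^bsub>A\<^esub> x \<otimes>\<^bsub>A\<^esub> b) u" (is "?X \<odot>\<^bsub>_\<^esub> x = _")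
proof -
  interpret A: assoc_algebra R A by fact
  let ?B = "opposite_ring A"
  note B = opposite_ring_algebra[OF assms(1)]
  interpret K: ideal "tensor_relations R A ?B" "pair_ring A ?B"
    by (rule tensor_relations_ideal[OF assms(1) B])
  let ?g = "frag_sum A (\<lambda>(a, b). a \<otimes>\<^bsub>A\<^esub> x \<otimes>\<^bsub>A\<^esub> b)"
  have "balanced_map R A ?B A (\<lambda>a b. a \<otimes>\<^bsub>A\<^esub> x \<otimes>\<^bsub>A\<^esub> b)"
    using assms(2) by (simp add: balanced_map_def A.l_distr A.r_distr A.smult_mult_left A.smult_mult_right)
  then have "?g v = ?g u" if "v \<in> ?X" for v
    using frag_sum_coset[OF assms(1) B A.M.abelian_group_axioms _ _ that] u by simp
  moreover have "u \<in> ?X" using K.a_rcos_self[of u] u by simp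
  ultimately have "?g ` ?X = {?g u}" by blast
  then show ?thesis
    by (simp add: enveloping_module_def frag_sum_def case_prod_unfold)
qed

text \<open>
  A separability idempotent in coordinates. Let \<open>\<iota>\<close> and \<open>\<pi>\<close> exhibit \<open>A\<close> as a direct summand of a free
  module over the enveloping algebra \<open>E\<close>. The coordinates \<open>c i\<close> of \<open>\<iota>(1)\<close> satisfy
  \<open>(a \<otimes> 1) c i = (1 \<otimes> a) c i\<close>, both sides being the coordinate of \<open>\<iota>(a)\<close>, while \<open>\<pi>(\<iota>(1)) = 1\<close> says
  that \<open>\<Sum> c i \<cdot> p i = 1\<close> for the images \<open>p i\<close> of the basis vectors. Here \<open>v i\<close> represents \<open>c i\<close>; keeping
  the \<open>p i\<close> separate from the \<open>v i\<close> avoids forming the idempotent \<open>\<Sum> c i (p i \<otimes> 1)\<close> itself.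
\<close>

lemma separability_representatives:
  fixes R :: "('r, 'k) ring_scheme" and A :: "('r, 'a, 'l) module_scheme"
  assumes A: "assoc_algebra R A" and "separable R A"
  obtains J :: "'a set" and p v where "finite J" "p \<in> J \<rightarrow> carrier A"
    "\<And>i. i \<in> J \<Longrightarrow> Poly_Mapping.keys (v i) \<subseteq> carrier A \<times> carrier A"
    "(\<Oplus>\<^bsub>A\<^esub>i\<in>J. frag_sum A (\<lambda>(a, b). a \<otimes>\<^bsub>A\<^esub> p i \<otimes>\<^bsub>A\<^esub> b) (v i)) = \<one>\<^bsub>A\<^esub>"
    "\<And>i a. \<lbrakk>i \<in> J; a \<in> carrier A\<rbrakk> \<Longrightarrow>
      frag_of (a, \<one>\<^bsub>A\<^esub>) \<otimes>\<^bsub>pair_ring A (opposite_ring A)\<^esub> v i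
        - frag_of (\<one>\<^bsub>A\<^esub>, a) \<otimes>\<^bsub>pair_ring A (opposite_ring A)\<^esub> v i
      \<in> tensor_relations R A (opposite_ring A)"
proof -
  interpret A: assoc_algebra R A by fact
  let ?B = "opposite_ring A" and ?M = "enveloping_module A"
  let ?E = "enveloping_algebra R A" and ?P = "pair_ring A (opposite_ring A)"
  let ?K = "tensor_relations R A (opposite_ring A)"
  note B = opposite_ring_algebra[OF A]
  note EA = enveloping_algebra_def[of R A]
  interpret K: ideal ?K ?P by (rule tensor_relations_ideal[OF A B])
  interpret E: ring ?E unfolding EA by (rule tensor_algebra_is_ring[OF A B])
  have M: "abelian_group ?M"
    using A.M.l_neg by (intro abelian_groupI) (auto simp: A.M.a_ac intro: A.M.a_inv_closed)
  obtain I :: "'a set" and \<iota> \<pi> where \<iota>: "\<iota> \<in> Hom ?E ?M (free_module ?E I)" and \<pi>: "\<pi> \<in> Hom ?E (free_module ?E I) ?M"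
    and id: "\<And>x. x \<in> carrier A \<Longrightarrow> \<pi> (\<iota> x) = x"
    using assms(2) unfolding separable_def projective_def enveloping_module_simps by blast
  define c where "c = \<iota> \<one>\<^bsub>A\<^esub>"
  define J where "J = {i\<in>I. c i \<noteq> \<zero>\<^bsub>?E\<^esub>}"
  define p where "p i = \<pi> (free_basis ?E I i)" for i
  have cF: "c \<in> carrier (free_module ?E I)"
    unfolding c_def using Hom_D(1)[OF \<iota>, of "\<one>\<^bsub>A\<^esub>"] by simp
  then have cE: "c i \<in> carrier ?E" if "i \<in> I" for i
    using that by (auto simp: free_module_def)
  have J: "finite J" "J \<subseteq> I"
    using cF by (auto simp: J_def free_module_def)
  have "\<exists>u. Poly_Mapping.keys u \<subseteq> carrier A \<times> carrier A \<and> c i = ?K +>\<^bsub>?P\<^esub> u" if "i \<in> J" for i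
    using cE[of i] that J unfolding EA carrier_tensor_algebra by auto
  then obtain v where v: "\<And>i. i \<in> J \<Longrightarrow> Poly_Mapping.keys (v i) \<subseteq> carrier A \<times> carrier A"
      and cv: "\<And>i. i \<in> J \<Longrightarrow> c i = ?K +>\<^bsub>?P\<^esub> v i"
    by metis
  have p: "p i \<in> carrier A" for i
    using Hom_D(1)[OF \<pi>, of "free_basis ?E I i"]
    by (auto simp: p_def free_module_def free_basis_def intro: finite_subset[of _ "{i}"])
  have "\<one>\<^bsub>A\<^esub> = \<pi> c" unfolding c_def using id by simp
  also have "\<dots> = (\<Oplus>\<^bsub>?M\<^esub>i\<in>J. c i \<odot>\<^bsub>?M\<^esub> p i)"
    unfolding p_def using J
    by (intro Hom_free_module_expand[OF E.ring_axioms M \<pi> cF]) (auto simp: J_def)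
  also have "\<dots> = (\<Oplus>\<^bsub>A\<^esub>i\<in>J. frag_sum A (\<lambda>(a, b). a \<otimes>\<^bsub>A\<^esub> p i \<otimes>\<^bsub>A\<^esub> b) (v i))"
    unfolding enveloping_module_simps
  proof (intro A.M.finsum_cong' refl Pi_I)
    fix i assume i: "i \<in> J"
    show "frag_sum A (\<lambda>(a, b). a \<otimes>\<^bsub>A\<^esub> p i \<otimes>\<^bsub>A\<^esub> b) (v i) \<in> carrier A"
      using p by (intro A.M.frag_sum_closed[OF _ v[OF i]]) auto
    show "c i \<odot>\<^bsub>?M\<^esub> p i = frag_sum A (\<lambda>(a, b). a \<otimes>\<^bsub>A\<^esub> p i \<otimes>\<^bsub>A\<^esub> b) (v i)"
      unfolding cv[OF i] by (rule enveloping_smult[OF A p v[OF i]])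
  qed
  finally have 1: "(\<Oplus>\<^bsub>A\<^esub>i\<in>J. frag_sum A (\<lambda>(a, b). a \<otimes>\<^bsub>A\<^esub> p i \<otimes>\<^bsub>A\<^esub> b) (v i)) = \<one>\<^bsub>A\<^esub>" by simp
  have "frag_of (a, \<one>\<^bsub>A\<^esub>) \<otimes>\<^bsub>?P\<^esub> v i - frag_of (\<one>\<^bsub>A\<^esub>, a) \<otimes>\<^bsub>?P\<^esub> v i \<in> ?K"
    if i: "i \<in> J" and a: "a \<in> carrier A" for i a
  proof -
    \<comment> \<open>Applied to \<open>a \<otimes> 1\<close> and to \<open>1 \<otimes> a\<close>, both of which send \<open>1\<close> to \<open>a\<close>.\<close>
    have act: "\<iota> a i = ?K +>\<^bsub>?P\<^esub> (frag_of (b, d) \<otimes>\<^bsub>?P\<^esub> v i)"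
      if bd: "b \<in> carrier A" "d \<in> carrier A" "b \<otimes>\<^bsub>A\<^esub> d = a" for b d
    proof -
      let ?X = "?K +>\<^bsub>?P\<^esub> frag_of (b, d)"
      have X: "?X \<in> carrier ?E"
        unfolding EA carrier_tensor_algebra using bd by (auto intro!: exI[of _ "frag_of (b, d)"])
      have "?X \<odot>\<^bsub>?M\<^esub> \<one>\<^bsub>A\<^esub> = frag_sum A (\<lambda>(a, b). a \<otimes>\<^bsub>A\<^esub> \<one>\<^bsub>A\<^esub> \<otimes>\<^bsub>A\<^esub> b) (frag_of (b, d))"
        using bd by (intro enveloping_smult[OF A]) auto
      then have "?X \<odot>\<^bsub>?M\<^esub> \<one>\<^bsub>A\<^esub> = a"
        using bd a by (simp add: A.M.frag_sum_of)
      then have "\<iota> a = ?X \<odot>\<^bsub>free_module ?E I\<^esub> c"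
        using Hom_D(3)[OF \<iota> X, of "\<one>\<^bsub>A\<^esub>"] by (simp add: c_def)
      then have "\<iota> a i = ?X \<otimes>\<^bsub>?E\<^esub> c i"
        using i J by (auto simp: free_module_def)
      then show ?thesis
        using tensor_algebra_mult[OF A B, of "frag_of (b, d)" "v i"] bd v[OF i]
        by (simp add: cv[OF i] EA)
    qed
    let ?y = "frag_of (a, \<one>\<^bsub>A\<^esub>) \<otimes>\<^bsub>?P\<^esub> v i" and ?z = "frag_of (\<one>\<^bsub>A\<^esub>, a) \<otimes>\<^bsub>?P\<^esub> v i"
    have yz: "?y \<in> carrier ?P" "?z \<in> carrier ?P"
      using a v[OF i] by (auto intro!: K.m_closed simp del: pair_ring_simps(1)) (auto)
    have "\<ominus>\<^bsub>?P\<^esub> ?z = - ?z"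
      using yz by (intro K.minus_equality) auto
    then have "?y \<ominus>\<^bsub>?P\<^esub> ?z = ?y - ?z" by (simp add: a_minus_def)
    moreover have "?y \<ominus>\<^bsub>?P\<^esub> ?z \<in> ?K"
      using K.quotient_eq_iff_same_a_r_cos[OF K.ideal_axioms yz] act[of a "\<one>\<^bsub>A\<^esub>"] act[of "\<one>\<^bsub>A\<^esub>" a] a
      by simp
    ultimately show ?thesis by simp
  qed
  then show ?thesis using that[of J p v] J v p 1 by auto
qed

text \<open>
  In the enveloping algebra \<open>(a \<otimes> 1) (x \<otimes> y) = a x \<otimes> y\<close>, but \<open>(1 \<otimes> a) (x \<otimes> y) = x \<otimes> y a\<close>, since the
  second factor multiplies in the opposite ring.
\<close>

lemma balanced_map_commutes:
  assumes A: "assoc_algebra R A" and N: "abelian_group N"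
    and f: "balanced_map R A (opposite_ring A) N f"
    and v: "Poly_Mapping.keys v \<subseteq> carrier A \<times> carrier A" and a: "a \<in> carrier A"
    and K: "frag_of (a, \<one>\<^bsub>A\<^esub>) \<otimes>\<^bsub>pair_ring A (opposite_ring A)\<^esub> v
        - frag_of (\<one>\<^bsub>A\<^esub>, a) \<otimes>\<^bsub>pair_ring A (opposite_ring A)\<^esub> v
      \<in> tensor_relations R A (opposite_ring A)"
  shows "frag_sum N (\<lambda>(x, y). f (a \<otimes>\<^bsub>A\<^esub> x) y) v = frag_sum N (\<lambda>(x, y). f x (y \<otimes>\<^bsub>A\<^esub> a)) v"
proof -
  interpret A: assoc_algebra R A by fact
  interpret N: abelian_group N by fact
  let ?P = "pair_ring A (opposite_ring A)" and ?S = "carrier A \<times> carrier A"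
  interpret P: ring ?P
    by (intro pair_ring_is_ring A.ring_axioms assoc_algebra.axioms(2)[OF opposite_ring_algebra[OF A]])
  have fS: "case_prod f \<in> ?S \<rightarrow> carrier N"
    using f by (auto simp: balanced_map_def)
  have mult: "Poly_Mapping.keys (frag_of (b, d) \<otimes>\<^bsub>?P\<^esub> u) \<subseteq> ?S \<and>
      frag_sum N (case_prod f) (frag_of (b, d) \<otimes>\<^bsub>?P\<^esub> u) = frag_sum N (\<lambda>(x, y). f (b \<otimes>\<^bsub>A\<^esub> x) (y \<otimes>\<^bsub>A\<^esub> d)) u"
    if bd: "b \<in> carrier A" "d \<in> carrier A" and u: "Poly_Mapping.keys u \<subseteq> ?S" for b d u
    using u
  proof (induction u rule: frag_on_induct)
    case zero
    then show ?case by (simp add: pair_ring_mult_additive N.frag_sum_zero)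
  next
    case (diff x y)
    have g: "(\<lambda>(x, y). f (b \<otimes>\<^bsub>A\<^esub> x) (y \<otimes>\<^bsub>A\<^esub> d)) \<in> ?S \<rightarrow> carrier N"
      using f bd by (auto simp: balanced_map_def)
    show ?case
      using diff by (simp add: pair_ring_mult_additive keys_diff_subset N.frag_sum_diff[OF fS] N.frag_sum_diff[OF g])
  next
    case (gen q)
    then show ?case
      using bd fS by (auto simp: Pi_iff N.frag_sum_of split: prod.splits)
  qed
  let ?y = "frag_of (a, \<one>\<^bsub>A\<^esub>) \<otimes>\<^bsub>?P\<^esub> v" and ?z = "frag_of (\<one>\<^bsub>A\<^esub>, a) \<otimes>\<^bsub>?P\<^esub> v"
  have y: "Poly_Mapping.keys ?y \<subseteq> ?S" and z: "Poly_Mapping.keys ?z \<subseteq> ?S"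
    using mult[OF _ _ v] a by auto
  have "frag_sum N (case_prod f) ?y \<ominus>\<^bsub>N\<^esub> frag_sum N (case_prod f) ?z = \<zero>\<^bsub>N\<^esub>"
    using N.frag_sum_diff[OF fS y z] frag_sum_tensor_relation[OF A opposite_ring_algebra[OF A] N f K] by simp
  moreover have "frag_sum N (case_prod f) ?y
      = frag_sum N (case_prod f) ?y \<ominus>\<^bsub>N\<^esub> frag_sum N (case_prod f) ?z \<oplus>\<^bsub>N\<^esub> frag_sum N (case_prod f) ?z"
    using N.frag_sum_closed[OF fS y] N.frag_sum_closed[OF fS z] by (simp add: N.minus_eq N.a_assoc N.l_neg)
  ultimately have "frag_sum N (case_prod f) ?y = frag_sum N (case_prod f) ?z"
    using N.frag_sum_closed[OF fS y] N.frag_sum_closed[OF fS z] by simp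
  moreover have "frag_sum N (case_prod f) ?y = frag_sum N (\<lambda>(x, y). f (a \<otimes>\<^bsub>A\<^esub> x) y) v"
  proof -
    have "frag_sum N (case_prod f) ?y = frag_sum N (\<lambda>(x, y). f (a \<otimes>\<^bsub>A\<^esub> x) (y \<otimes>\<^bsub>A\<^esub> \<one>\<^bsub>A\<^esub>)) v"
      using mult[OF _ _ v] a by simp
    also have "\<dots> = frag_sum N (\<lambda>(x, y). f (a \<otimes>\<^bsub>A\<^esub> x) y) v"
      using f a by (intro N.frag_sum_cong[OF _ _ v]) (auto simp: balanced_map_def)
    finally show ?thesis .
  qed
  moreover have "frag_sum N (case_prod f) ?z = frag_sum N (\<lambda>(x, y). f x (y \<otimes>\<^bsub>A\<^esub> a)) v"
  proof -
    have "frag_sum N (case_prod f) ?z = frag_sum N (\<lambda>(x, y). f (\<one>\<^bsub>A\<^esub> \<otimes>\<^bsub>A\<^esub> x) (y \<otimes>\<^bsub>A\<^esub> a)) v"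
      using mult[OF _ _ v] a by simp
    also have "\<dots> = frag_sum N (\<lambda>(x, y). f x (y \<otimes>\<^bsub>A\<^esub> a)) v"
      using f a by (intro N.frag_sum_cong[OF _ _ v]) (auto simp: balanced_map_def)
    finally show ?thesis .
  qed
  ultimately show ?thesis by simp
qed

text \<open>
  Over a separable algebra a surjection that splits over \<open>R\<close> splits over \<open>A\<close>. From an \<open>R\<close>-linear section
  \<open>t\<close> one forms the average \<open>s(y) = \<Sum> a (p i t(b y))\<close> over the terms \<open>(a, b)\<close> of the representatives
  \<open>v i\<close>. It is \<open>A\<close>-linear since multiplying by an element on the left of \<open>a\<close> has the same effect as
  multiplying by it on the right of \<open>b\<close>, and it is a section since \<open>\<Sum> a (p i) b = 1\<close>.
\<close>

lemma separable_splitting: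
  fixes R :: "('r, 'k) ring_scheme" and A :: "('r, 'a, 'l) module_scheme"
    and M :: "('a, 'm, 'n) module_scheme" and N :: "('a, 'p, 'q) module_scheme"
  assumes A: "assoc_algebra R A" and sep: "separable R A"
    and M: "left_module A M" and N: "left_module A N"
    and h: "h \<in> Hom A N M"
    and t: "t \<in> Hom R (restrict_scalars R A M) (restrict_scalars R A N)"
    and ht: "\<And>y. y \<in> carrier M \<Longrightarrow> h (t y) = y"
  obtains s where "s \<in> Hom A M N" "\<And>y. y \<in> carrier M \<Longrightarrow> h (s y) = y"
proof -
  interpret A: assoc_algebra R A by fact
  interpret M: left_module A M by fact
  interpret N: left_module A N by fact
  obtain J :: "'a set" and p v where J: "finite J" and p: "p \<in> J \<rightarrow> carrier A"
    and v: "\<And>i. i \<in> J \<Longrightarrow> Poly_Mapping.keys (v i) \<subseteq> carrier A \<times> carrier A"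
    and one: "(\<Oplus>\<^bsub>A\<^esub>i\<in>J. frag_sum A (\<lambda>(a, b). a \<otimes>\<^bsub>A\<^esub> p i \<otimes>\<^bsub>A\<^esub> b) (v i)) = \<one>\<^bsub>A\<^esub>"
    and K: "\<And>i a. \<lbrakk>i \<in> J; a \<in> carrier A\<rbrakk> \<Longrightarrow>
      frag_of (a, \<one>\<^bsub>A\<^esub>) \<otimes>\<^bsub>pair_ring A (opposite_ring A)\<^esub> v i
        - frag_of (\<one>\<^bsub>A\<^esub>, a) \<otimes>\<^bsub>pair_ring A (opposite_ring A)\<^esub> v i
      \<in> tensor_relations R A (opposite_ring A)"
    by (rule separability_representatives[OF A sep]) blast
  have pA: "p i \<in> carrier A" if "i \<in> J" for i using p that by auto
  let ?S = "carrier A \<times> carrier A"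
  have tc: "t y \<in> carrier N" if "y \<in> carrier M" for y
    using Hom_D(1)[OF t, of y] that by simp
  have t_add: "t (x \<oplus>\<^bsub>M\<^esub> y) = t x \<oplus>\<^bsub>N\<^esub> t y" if "x \<in> carrier M" "y \<in> carrier M" for x y
    using Hom_D(2)[OF t, of x y] that by simp
  have t_smult: "t ((r \<odot>\<^bsub>A\<^esub> \<one>\<^bsub>A\<^esub>) \<odot>\<^bsub>M\<^esub> y) = (r \<odot>\<^bsub>A\<^esub> \<one>\<^bsub>A\<^esub>) \<odot>\<^bsub>N\<^esub> t y"
    if "r \<in> carrier R" "y \<in> carrier M" for r y
    using Hom_D(3)[OF t, of r y] that by simp
  define f where "f i y a b = a \<odot>\<^bsub>N\<^esub> (p i \<odot>\<^bsub>N\<^esub> t (b \<odot>\<^bsub>M\<^esub> y))" for i y a b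
  have fc: "f i y a b \<in> carrier N" if "i \<in> J" "y \<in> carrier M" "a \<in> carrier A" "b \<in> carrier A" for i y a b
    unfolding f_def using that pA tc by (simp add: M.smult_closed N.smult_closed)
  have bal: "balanced_map R A (opposite_ring A) N (f i y)" if i: "i \<in> J" and y: "y \<in> carrier M" for i y
  proof -
    have "f i y (r \<odot>\<^bsub>A\<^esub> a) b = f i y a (r \<odot>\<^bsub>A\<^esub> b)"
      if r: "r \<in> carrier R" and a: "a \<in> carrier A" and b: "b \<in> carrier A" for r a b
    proof -
      let ?r = "r \<odot>\<^bsub>A\<^esub> \<one>\<^bsub>A\<^esub>"
      have rA: "?r \<in> carrier A" using r by simp
      have comm: "r \<odot>\<^bsub>A\<^esub> x = ?r \<otimes>\<^bsub>A\<^esub> x" "r \<odot>\<^bsub>A\<^esub> x = x \<otimes>\<^bsub>A\<^esub> ?r" if "x \<in> carrier A" for x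
        using r that by (simp_all add: A.smult_mult_left A.smult_mult_right)
      have "f i y a (r \<odot>\<^bsub>A\<^esub> b) = a \<odot>\<^bsub>N\<^esub> (p i \<odot>\<^bsub>N\<^esub> (?r \<odot>\<^bsub>N\<^esub> t (b \<odot>\<^bsub>M\<^esub> y)))"
        unfolding f_def comm(1)[OF b] using r a b y rA by (simp add: M.smult_assoc M.smult_closed t_smult)
      also have "\<dots> = (a \<otimes>\<^bsub>A\<^esub> (p i \<otimes>\<^bsub>A\<^esub> ?r)) \<odot>\<^bsub>N\<^esub> t (b \<odot>\<^bsub>M\<^esub> y)"
        using a b y rA pA[OF i] tc by (simp add: N.smult_assoc N.smult_closed M.smult_closed)
      also have "a \<otimes>\<^bsub>A\<^esub> (p i \<otimes>\<^bsub>A\<^esub> ?r) = (r \<odot>\<^bsub>A\<^esub> a) \<otimes>\<^bsub>A\<^esub> p i"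
        using r a pA[OF i] by (simp add: A.smult_mult_left A.smult_mult_right)
      also have "\<dots> \<odot>\<^bsub>N\<^esub> t (b \<odot>\<^bsub>M\<^esub> y) = f i y (r \<odot>\<^bsub>A\<^esub> a) b"
        unfolding f_def using r a b y pA[OF i] tc by (simp add: N.smult_assoc M.smult_closed)
      finally show ?thesis by simp
    qed
    then show ?thesis
      unfolding balanced_map_def using fc[OF i y] pA[OF i] y tc
      by (simp add: f_def M.smult_closed N.smult_closed M.smult_l_distr N.smult_l_distr N.smult_r_distr t_add)
  qed
  have fS: "case_prod (f i y) \<in> ?S \<rightarrow> carrier N" if "i \<in> J" "y \<in> carrier M" for i y
    using fc that by auto
  note term_closed = N.P.frag_sum_closed[OF fS v]
  define s where "s = (\<lambda>y\<in>carrier M. \<Oplus>\<^bsub>N\<^esub>i\<in>J. frag_sum N (case_prod (f i y)) (v i))"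
  have s_eq: "s y = (\<Oplus>\<^bsub>N\<^esub>i\<in>J. frag_sum N (case_prod (f i y)) (v i))" if "y \<in> carrier M" for y
    using that by (simp add: s_def)
  have s_closed: "s y \<in> carrier N" if "y \<in> carrier M" for y
    unfolding s_eq[OF that] using that by (intro N.P.finsum_closed Pi_I term_closed)
  have s_add: "s (x \<oplus>\<^bsub>M\<^esub> y) = s x \<oplus>\<^bsub>N\<^esub> s y" if x: "x \<in> carrier M" and y: "y \<in> carrier M" for x y
  proof -
    have "s (x \<oplus>\<^bsub>M\<^esub> y) = (\<Oplus>\<^bsub>N\<^esub>i\<in>J. frag_sum N (case_prod (f i x)) (v i) \<oplus>\<^bsub>N\<^esub> frag_sum N (case_prod (f i y)) (v i))"
      unfolding s_eq[OF M.P.a_closed[OF x y]]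
    proof (intro N.P.finsum_cong' refl)
      fix i assume i: "i \<in> J"
      have "frag_sum N (case_prod (f i (x \<oplus>\<^bsub>M\<^esub> y))) (v i)
          = frag_sum N (\<lambda>q. case_prod (f i x) q \<oplus>\<^bsub>N\<^esub> case_prod (f i y) q) (v i)"
      proof (rule N.P.frag_sum_cong[OF _ _ v[OF i]])
        show "(\<lambda>q. case_prod (f i x) q \<oplus>\<^bsub>N\<^esub> case_prod (f i y) q) \<in> ?S \<rightarrow> carrier N"
          using fc[OF i x] fc[OF i y] by auto
      qed (use i x y pA tc in \<open>auto simp: f_def M.smult_closed N.smult_closed M.smult_r_distr N.smult_r_distr t_add\<close>)
      then show "frag_sum N (case_prod (f i (x \<oplus>\<^bsub>M\<^esub> y))) (v i)
          = frag_sum N (case_prod (f i x)) (v i) \<oplus>\<^bsub>N\<^esub> frag_sum N (case_prod (f i y)) (v i)"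
        using N.P.frag_sum_pointwise_add[OF fS[OF i x] fS[OF i y] v[OF i]] by simp
    qed (use x y in \<open>auto intro: term_closed\<close>)
    also have "\<dots> = s x \<oplus>\<^bsub>N\<^esub> s y"
      unfolding s_eq[OF x] s_eq[OF y] using x y by (intro N.P.finsum_addf) (auto intro: term_closed)
    finally show ?thesis .
  qed
  have s_smult: "s (a \<odot>\<^bsub>M\<^esub> y) = a \<odot>\<^bsub>N\<^esub> s y" if a: "a \<in> carrier A" and y: "y \<in> carrier M" for a y
  proof -
    have ay: "a \<odot>\<^bsub>M\<^esub> y \<in> carrier M" using a y by (rule M.smult_closed)
    have act: "(\<lambda>n. a \<odot>\<^bsub>N\<^esub> n) \<in> carrier N \<rightarrow> carrier N"
      using a by (auto intro: N.smult_closed)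
    have "a \<odot>\<^bsub>N\<^esub> s y = (\<Oplus>\<^bsub>N\<^esub>i\<in>J. a \<odot>\<^bsub>N\<^esub> frag_sum N (case_prod (f i y)) (v i))"
      unfolding s_eq[OF y] using a y
      by (intro additive_finsum[OF N.P.abelian_group_axioms N.P.abelian_group_axioms act])
        (auto simp: N.smult_r_distr intro: term_closed)
    also have "\<dots> = s (a \<odot>\<^bsub>M\<^esub> y)"
      unfolding s_eq[OF ay]
    proof (intro N.P.finsum_cong' refl)
      fix i assume i: "i \<in> J"
      have "a \<odot>\<^bsub>N\<^esub> frag_sum N (case_prod (f i y)) (v i)
          = frag_sum N (\<lambda>q. a \<odot>\<^bsub>N\<^esub> case_prod (f i y) q) (v i)"
        using a by (intro additive_frag_sum[OF N.P.abelian_group_axioms N.P.abelian_group_axioms act _ fS[OF i y] v[OF i]])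
          (auto simp: N.smult_r_distr)
      also have "\<dots> = frag_sum N (\<lambda>(b, c). f i y (a \<otimes>\<^bsub>A\<^esub> b) c) (v i)"
        by (rule N.P.frag_sum_cong[OF _ _ v[OF i]])
          (use a y i pA tc fc in \<open>auto simp: f_def N.smult_assoc M.smult_closed N.smult_closed\<close>)
      also have "\<dots> = frag_sum N (\<lambda>(b, c). f i y b (c \<otimes>\<^bsub>A\<^esub> a)) (v i)"
        by (rule balanced_map_commutes[OF A N.P.abelian_group_axioms bal[OF i y] v[OF i] a K[OF i a]])
      also have "\<dots> = frag_sum N (case_prod (f i (a \<odot>\<^bsub>M\<^esub> y))) (v i)"
        by (rule N.P.frag_sum_cong[OF _ fS[OF i ay] v[OF i]])
          (use a y in \<open>auto simp: f_def M.smult_assoc\<close>)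
      finally show "a \<odot>\<^bsub>N\<^esub> frag_sum N (case_prod (f i y)) (v i)
        = frag_sum N (case_prod (f i (a \<odot>\<^bsub>M\<^esub> y))) (v i)" .
    qed (use ay in \<open>auto intro: term_closed\<close>)
    finally show ?thesis by simp
  qed
  have "s \<in> Hom A M N"
    unfolding s_def by (rule Hom_memI) (use s_closed s_add s_smult in \<open>simp_all add: s_eq M.smult_closed\<close>)
  moreover have "h (s y) = y" if y: "y \<in> carrier M" for y
  proof -
    have act: "(\<lambda>a. a \<odot>\<^bsub>M\<^esub> y) \<in> carrier A \<rightarrow> carrier M"
      using y by (auto intro: M.smult_closed)
    have hc: "h \<in> carrier N \<rightarrow> carrier M" using Hom_D(1)[OF h] by auto
    let ?g = "\<lambda>i. \<lambda>(a, b). a \<otimes>\<^bsub>A\<^esub> p i \<otimes>\<^bsub>A\<^esub> b"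
    have gS: "?g i \<in> ?S \<rightarrow> carrier A" if "i \<in> J" for i
      using pA[OF that] by auto
    note AM = A.M.abelian_group_axioms M.P.abelian_group_axioms
    have "h (s y) = (\<Oplus>\<^bsub>M\<^esub>i\<in>J. h (frag_sum N (case_prod (f i y)) (v i)))"
      unfolding s_eq[OF y] using y
      by (intro Hom_finsum[OF N.P.abelian_group_axioms M.P.abelian_group_axioms h]) (auto intro: term_closed)
    also have "\<dots> = (\<Oplus>\<^bsub>M\<^esub>i\<in>J. frag_sum A (?g i) (v i) \<odot>\<^bsub>M\<^esub> y)"
    proof (intro M.P.finsum_cong' refl)
      fix i assume i: "i \<in> J"
      have "h (frag_sum N (case_prod (f i y)) (v i)) = frag_sum M (\<lambda>q. h (case_prod (f i y) q)) (v i)"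
        by (intro additive_frag_sum[OF N.P.abelian_group_axioms M.P.abelian_group_axioms hc Hom_D(2)[OF h] fS[OF i y] v[OF i]])
      also have "\<dots> = frag_sum M (\<lambda>q. ?g i q \<odot>\<^bsub>M\<^esub> y) (v i)"
        by (rule M.P.frag_sum_cong[OF _ _ v[OF i]])
          (use y i pA tc in \<open>auto simp: f_def Hom_D(3)[OF h] ht M.smult_assoc M.smult_closed N.smult_closed\<close>)
      also have "\<dots> = frag_sum A (?g i) (v i) \<odot>\<^bsub>M\<^esub> y"
        using y by (intro additive_frag_sum[OF AM act _ gS[OF i] v[OF i], symmetric]) (auto simp: M.smult_l_distr)
      finally show "h (frag_sum N (case_prod (f i y)) (v i)) = frag_sum A (?g i) (v i) \<odot>\<^bsub>M\<^esub> y" .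
    qed (use y in \<open>auto intro!: M.smult_closed A.M.frag_sum_closed[OF gS v]\<close>)
    also have "\<dots> = (\<Oplus>\<^bsub>A\<^esub>i\<in>J. frag_sum A (?g i) (v i)) \<odot>\<^bsub>M\<^esub> y"
      using y by (intro additive_finsum[OF AM act, symmetric])
        (auto simp: M.smult_l_distr intro!: A.M.frag_sum_closed[OF gS v])
    also have "\<dots> = y" using one y by (simp add: M.smult_one)
    finally show ?thesis .
  qed
  ultimately show ?thesis by (rule that)
qed

lemma regular_left_module:
  assumes "ring S"
  shows "left_module S (regular_module S)"
proof -
  interpret S: ring S by fact
  have "abelian_group (regular_module S)"
    using S.l_neg by (intro abelian_groupI) (auto simp: S.a_ac intro: S.a_inv_closed)
  then show ?thesis
    by (intro left_module.intro left_module_axioms.intro S.ring_axioms)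
      (auto simp: S.l_distr S.r_distr S.m_assoc)
qed

text \<open>
  A dual basis \<open>(e, d)\<close> of \<open>M\<close> over \<open>R\<close> gives the \<open>R\<close>-linear section \<open>y \<mapsto> \<Sum> d j (y) a j\<close>, where
  \<open>a j m = e j\<close>; separability makes it \<open>A\<close>-linear.
\<close>

lemma cyclic_section:
  fixes R :: "('r, 'k) ring_scheme" and A :: "('r, 'a, 'l) module_scheme"
    and M :: "('a, 'm, 'n) module_scheme"
  assumes A: "assoc_algebra R A" and sep: "separable R A" and M: "left_module A M"
    and basis: "dual_basis R (restrict_scalars R A M) J e d"
    and m: "m \<in> carrier M" and generator: "carrier M = (\<lambda>a. a \<odot>\<^bsub>M\<^esub> m) ` carrier A"
  obtains s where "s \<in> Hom A M (regular_module A)" "\<And>y. y \<in> carrier M \<Longrightarrow> s y \<odot>\<^bsub>M\<^esub> m = y"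
proof -
  interpret A: assoc_algebra R A by fact
  interpret M: left_module A M by fact
  let ?L = "restrict_scalars R A M" and ?h = "\<lambda>a\<in>carrier A. a \<odot>\<^bsub>M\<^esub> m"
  have J: "finite J" and e: "\<And>j. j \<in> J \<Longrightarrow> e j \<in> carrier M" and d: "\<And>j. j \<in> J \<Longrightarrow> d j \<in> dual R ?L"
    using basis by (auto simp: dual_basis_def)
  have L: "finsum ?L = finsum M"
    by (simp add: finsum_def finprod_def restrict_scalars_def fun_eq_iff)
  have expand: "y = (\<Oplus>\<^bsub>M\<^esub>j\<in>J. (d j y \<odot>\<^bsub>A\<^esub> \<one>\<^bsub>A\<^esub>) \<odot>\<^bsub>M\<^esub> e j)" if "y \<in> carrier M" for y
    using basis that by (simp add: dual_basis_def L)
  note dD = dual_D[OF d, simplified]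
  have "\<forall>j\<in>J. \<exists>a. a \<in> carrier A \<and> a \<odot>\<^bsub>M\<^esub> m = e j"
    using e generator by force
  from bchoice[OF this] obtain a where a: "\<And>j. j \<in> J \<Longrightarrow> a j \<in> carrier A"
    and am: "\<And>j. j \<in> J \<Longrightarrow> a j \<odot>\<^bsub>M\<^esub> m = e j" by blast
  define t where "t = (\<lambda>y\<in>carrier M. \<Oplus>\<^bsub>A\<^esub>j\<in>J. d j y \<odot>\<^bsub>A\<^esub> a j)"
  have h: "?h \<in> Hom A (regular_module A) M"
  proof -
    have "restrict ?h (carrier (regular_module A)) \<in> Hom A (regular_module A) M"
      using m by (intro Hom_memI) (auto simp: M.smult_closed M.smult_l_distr M.smult_assoc)
    then show ?thesis by simp
  qed
  have t: "t \<in> Hom R ?L (restrict_scalars R A (regular_module A))"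
  proof -
    have "t (x \<oplus>\<^bsub>M\<^esub> y) = t x \<oplus>\<^bsub>A\<^esub> t y" if x: "x \<in> carrier M" and y: "y \<in> carrier M" for x y
    proof -
      have "t (x \<oplus>\<^bsub>M\<^esub> y) = (\<Oplus>\<^bsub>A\<^esub>j\<in>J. d j x \<odot>\<^bsub>A\<^esub> a j \<oplus>\<^bsub>A\<^esub> d j y \<odot>\<^bsub>A\<^esub> a j)"
        unfolding t_def restrict_apply'[OF M.P.a_closed[OF x y]] using x y a
        by (intro A.M.finsum_cong') (auto simp: dD A.smult_l_distr)
      also have "\<dots> = (\<Oplus>\<^bsub>A\<^esub>j\<in>J. d j x \<odot>\<^bsub>A\<^esub> a j) \<oplus>\<^bsub>A\<^esub> (\<Oplus>\<^bsub>A\<^esub>j\<in>J. d j y \<odot>\<^bsub>A\<^esub> a j)"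
        using x y a by (intro A.M.finsum_addf) (auto simp: dD)
      finally show ?thesis using x y by (simp add: t_def)
    qed
    moreover have "t ((r \<odot>\<^bsub>A\<^esub> \<one>\<^bsub>A\<^esub>) \<odot>\<^bsub>M\<^esub> y) = (r \<odot>\<^bsub>A\<^esub> \<one>\<^bsub>A\<^esub>) \<otimes>\<^bsub>A\<^esub> t y"
      if r: "r \<in> carrier R" and y: "y \<in> carrier M" for r y
    proof -
      have ry: "(r \<odot>\<^bsub>A\<^esub> \<one>\<^bsub>A\<^esub>) \<odot>\<^bsub>M\<^esub> y \<in> carrier M" using r y by (simp add: M.smult_closed)
      have ty: "t y \<in> carrier A" using y a by (auto simp: t_def dD)
      have "t ((r \<odot>\<^bsub>A\<^esub> \<one>\<^bsub>A\<^esub>) \<odot>\<^bsub>M\<^esub> y) = (\<Oplus>\<^bsub>A\<^esub>j\<in>J. r \<odot>\<^bsub>A\<^esub> (d j y \<odot>\<^bsub>A\<^esub> a j))"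
        unfolding t_def restrict_apply'[OF ry] using r y a
        by (intro A.M.finsum_cong') (auto simp: dD A.smult_assoc1)
      also have "\<dots> = r \<odot>\<^bsub>A\<^esub> t y"
        using r y a by (simp add: t_def) (intro A.finsum_smult_ldistr[symmetric] J; auto simp: dD)
      also have "\<dots> = (r \<odot>\<^bsub>A\<^esub> \<one>\<^bsub>A\<^esub>) \<otimes>\<^bsub>A\<^esub> t y"
        using r ty by (simp add: A.smult_mult_left)
      finally show ?thesis .
    qed
    moreover have "t y \<in> carrier A" if "y \<in> carrier M" for y
      using that a by (auto simp: t_def dD)
    moreover have "t = restrict t (carrier ?L)" by (simp add: t_def)
    moreover have "restrict t (carrier ?L) \<in> Hom R ?L (restrict_scalars R A (regular_module A))"
      using calculation(1-3) by (intro Hom_memI) (auto simp: M.smult_closed)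
    ultimately show ?thesis by simp
  qed
  have ht: "?h (t y) = y" if y: "y \<in> carrier M" for y
  proof -
    have "t y \<in> carrier A" using y a by (auto simp: t_def dD)
    then have "?h (t y) = (\<Oplus>\<^bsub>A\<^esub>j\<in>J. d j y \<odot>\<^bsub>A\<^esub> a j) \<odot>\<^bsub>M\<^esub> m"
      using y by (simp add: t_def)
    also have "\<dots> = (\<Oplus>\<^bsub>M\<^esub>j\<in>J. (d j y \<odot>\<^bsub>A\<^esub> a j) \<odot>\<^bsub>M\<^esub> m)"
      using a y m by (intro additive_finsum[OF A.M.abelian_group_axioms M.P.abelian_group_axioms, where f = "\<lambda>a. a \<odot>\<^bsub>M\<^esub> m"])
        (auto simp: dD M.smult_l_distr M.smult_closed)
    also have "\<dots> = (\<Oplus>\<^bsub>M\<^esub>j\<in>J. (d j y \<odot>\<^bsub>A\<^esub> \<one>\<^bsub>A\<^esub>) \<odot>\<^bsub>M\<^esub> e j)"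
    proof (intro M.P.finsum_cong' refl Pi_I)
      fix j assume j: "j \<in> J"
      have dj: "d j y \<in> carrier R" using dD(1)[OF j] y by simp
      have "(d j y \<odot>\<^bsub>A\<^esub> a j) \<odot>\<^bsub>M\<^esub> m = ((d j y \<odot>\<^bsub>A\<^esub> \<one>\<^bsub>A\<^esub>) \<otimes>\<^bsub>A\<^esub> a j) \<odot>\<^bsub>M\<^esub> m"
        using dj a[OF j] by (simp add: A.smult_mult_left)
      also have "\<dots> = (d j y \<odot>\<^bsub>A\<^esub> \<one>\<^bsub>A\<^esub>) \<odot>\<^bsub>M\<^esub> (a j \<odot>\<^bsub>M\<^esub> m)"
        using dj a[OF j] m by (intro M.smult_assoc) auto
      finally show "(d j y \<odot>\<^bsub>A\<^esub> a j) \<odot>\<^bsub>M\<^esub> m = (d j y \<odot>\<^bsub>A\<^esub> \<one>\<^bsub>A\<^esub>) \<odot>\<^bsub>M\<^esub> e j"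
        by (simp add: am[OF j])
      show "(d j y \<odot>\<^bsub>A\<^esub> \<one>\<^bsub>A\<^esub>) \<odot>\<^bsub>M\<^esub> e j \<in> carrier M"
        using dj e[OF j] by (simp add: M.smult_closed)
    qed
    also have "\<dots> = y" by (rule expand[OF y, symmetric])
    finally show ?thesis .
  qed
  obtain s where s: "s \<in> Hom A M (regular_module A)" and hs: "\<And>y. y \<in> carrier M \<Longrightarrow> ?h (s y) = y"
  proof (rule separable_splitting[OF A sep M regular_left_module[OF A.ring_axioms] h t ht])
    fix s assume 1: "s \<in> Hom A M (regular_module A)" and 2: "\<And>y. y \<in> carrier M \<Longrightarrow> ?h (s y) = y"
    show thesis by (rule that[OF 1 2])
  qed
  have "s y \<odot>\<^bsub>M\<^esub> m = y" if "y \<in> carrier M" for y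
    using hs[OF that] Hom_D(1)[OF s that] by simp
  with s show ?thesis by (rule that)
qed

text \<open>
  The algebra isomorphism is only assumed to exist, but preservation of the unit and of scalars force
  it to send the endomorphism \<open>r \<cdot> 1\<close> to \<open>r\<close>.
\<close>

lemma scalar_endomorphisms:
  assumes A: "assoc_algebra R A" and M: "left_module A M"
    and iso: "algebra_iso R (End_algebra A M (smult (restrict_scalars R A M))) (regular_module R)"
  shows "f \<in> Hom A M M \<Longrightarrow> \<exists>r\<in>carrier R. \<forall>y\<in>carrier M. f y = (r \<odot>\<^bsub>A\<^esub> \<one>\<^bsub>A\<^esub>) \<odot>\<^bsub>M\<^esub> y"
    and "\<lbrakk>r \<in> carrier R; \<And>y. y \<in> carrier M \<Longrightarrow> (r \<odot>\<^bsub>A\<^esub> \<one>\<^bsub>A\<^esub>) \<odot>\<^bsub>M\<^esub> y = \<zero>\<^bsub>M\<^esub>\<rbrakk> \<Longrightarrow> r = \<zero>\<^bsub>R\<^esub>"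
proof -
  interpret A: assoc_algebra R A by fact
  interpret M: left_module A M by fact
  let ?E = "End_algebra A M (smult (restrict_scalars R A M))"
  let ?m = "\<lambda>r. \<lambda>y\<in>carrier M. (r \<odot>\<^bsub>A\<^esub> \<one>\<^bsub>A\<^esub>) \<odot>\<^bsub>M\<^esub> y"
  have E: "carrier ?E = Hom A M M" "\<one>\<^bsub>?E\<^esub> = (\<lambda>y\<in>carrier M. y)"
    by (simp_all add: End_algebra_def)
  have Em: "r \<odot>\<^bsub>?E\<^esub> \<one>\<^bsub>?E\<^esub> = ?m r" for r
    by (simp add: End_algebra_def cong: restrict_cong)
  obtain \<phi> where \<phi>: "\<phi> \<in> ring_iso ?E (regular_module R)"
    and \<phi>s: "\<And>r f. \<lbrakk>r \<in> carrier R; f \<in> carrier ?E\<rbrakk> \<Longrightarrow> \<phi> (r \<odot>\<^bsub>?E\<^esub> f) = r \<otimes>\<^bsub>R\<^esub> \<phi> f"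
    using iso by (auto simp: algebra_iso_def)
  have inj: "inj_on \<phi> (Hom A M M)" and \<phi>c: "\<And>f. f \<in> Hom A M M \<Longrightarrow> \<phi> f \<in> carrier R"
    and \<phi>1: "\<phi> \<one>\<^bsub>?E\<^esub> = \<one>\<^bsub>R\<^esub>"
    using \<phi> ring_iso_memE[OF \<phi>] by (auto simp: E(1) bij_betw_def)
  have oneE: "\<one>\<^bsub>?E\<^esub> \<in> carrier ?E"
    unfolding E by (rule Hom_memI) (auto simp: M.smult_closed)
  have \<phi>m: "\<phi> (?m r) = r" if "r \<in> carrier R" for r
    using \<phi>s[OF that oneE] \<phi>1 that unfolding Em by simp
  have m: "?m r \<in> Hom A M M" if r: "r \<in> carrier R" for r
  proof (rule Hom_memI)
    fix a y assume ay: "a \<in> carrier A" "y \<in> carrier M"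
    have "(r \<odot>\<^bsub>A\<^esub> \<one>\<^bsub>A\<^esub>) \<otimes>\<^bsub>A\<^esub> a = a \<otimes>\<^bsub>A\<^esub> (r \<odot>\<^bsub>A\<^esub> \<one>\<^bsub>A\<^esub>)"
      using r ay by (simp add: A.smult_mult_left A.smult_mult_right)
    then show "(r \<odot>\<^bsub>A\<^esub> \<one>\<^bsub>A\<^esub>) \<odot>\<^bsub>M\<^esub> (a \<odot>\<^bsub>M\<^esub> y) = a \<odot>\<^bsub>M\<^esub> ((r \<odot>\<^bsub>A\<^esub> \<one>\<^bsub>A\<^esub>) \<odot>\<^bsub>M\<^esub> y)"
      using r ay by (simp add: M.smult_assoc[symmetric])
  qed (use r in \<open>auto simp: M.smult_closed M.smult_r_distr\<close>)
  show "\<exists>r\<in>carrier R. \<forall>y\<in>carrier M. f y = (r \<odot>\<^bsub>A\<^esub> \<one>\<^bsub>A\<^esub>) \<odot>\<^bsub>M\<^esub> y" if f: "f \<in> Hom A M M"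
  proof -
    have "f = ?m (\<phi> f)"
      by (rule inj_onD[OF inj _ f m[OF \<phi>c[OF f]]]) (simp only: \<phi>m[OF \<phi>c[OF f]])
    then have "f y = (\<phi> f \<odot>\<^bsub>A\<^esub> \<one>\<^bsub>A\<^esub>) \<odot>\<^bsub>M\<^esub> y" if "y \<in> carrier M" for y
      using that by (metis restrict_apply')
    then show ?thesis using \<phi>c[OF f] by blast
  qed
  show "r = \<zero>\<^bsub>R\<^esub>"
    if r: "r \<in> carrier R" and zero: "\<And>y. y \<in> carrier M \<Longrightarrow> (r \<odot>\<^bsub>A\<^esub> \<one>\<^bsub>A\<^esub>) \<odot>\<^bsub>M\<^esub> y = \<zero>\<^bsub>M\<^esub>"
  proof -
    interpret L: module R "restrict_scalars R A M" by (rule restrict_scalars_module[OF A M])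
    have "(\<zero>\<^bsub>R\<^esub> \<odot>\<^bsub>A\<^esub> \<one>\<^bsub>A\<^esub>) \<odot>\<^bsub>M\<^esub> y = \<zero>\<^bsub>M\<^esub>" if "y \<in> carrier M" for y
      using L.smult_l_null[of y] that by simp
    then have "?m r = ?m \<zero>\<^bsub>R\<^esub>" using zero by (intro restrict_ext) simp
    then show ?thesis using \<phi>m[OF r] \<phi>m[OF A.R.zero_closed] by simp
  qed
qed

section \<open>The block of a cyclic module with scalar endomorphisms\<close>

text \<open>
  The data on which the rest of the argument depends: the symmetrizing form, a generator with an
  \<open>A\<close>-linear section of \<open>a \<mapsto> a m\<^sub>0\<close>, a dual basis of \<open>M\<close> over \<open>R\<close>, and the two halves of the statement
  that \<open>R\<close> is the full endomorphism ring of \<open>M\<close>.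
\<close>

locale split_cyclic_module = A: assoc_algebra R A + M: left_module A M
  for R :: "('r, 'k) ring_scheme" and A :: "('r, 'a, 'l) module_scheme"
    and M :: "('a, 'm, 'n) module_scheme" +
  fixes \<beta> :: "'a \<Rightarrow> 'a \<Rightarrow> 'r" and m\<^sub>0 :: 'm and s :: "'m \<Rightarrow> 'a"
    and J :: "'m set" and e :: "'m \<Rightarrow> 'm" and d :: "'m \<Rightarrow> 'm \<Rightarrow> 'r"
  assumes form: "symmetrizing_form R A \<beta>"
    and basis: "dual_basis R (restrict_scalars R A M) J e d"
    and generator: "m\<^sub>0 \<in> carrier M"
    and section_Hom: "s \<in> Hom A M (regular_module A)"
    and section_generator: "y \<in> carrier M \<Longrightarrow> s y \<odot>\<^bsub>M\<^esub> m\<^sub>0 = y"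
    and scalar_endomorphism: "f \<in> Hom A M M \<Longrightarrow>
      \<exists>r\<in>carrier R. \<forall>y\<in>carrier M. f y = (r \<odot>\<^bsub>A\<^esub> \<one>\<^bsub>A\<^esub>) \<odot>\<^bsub>M\<^esub> y"
    and faithful: "\<lbrakk>r \<in> carrier R; \<And>y. y \<in> carrier M \<Longrightarrow> (r \<odot>\<^bsub>A\<^esub> \<one>\<^bsub>A\<^esub>) \<odot>\<^bsub>M\<^esub> y = \<zero>\<^bsub>M\<^esub>\<rbrakk> \<Longrightarrow> r = \<zero>\<^bsub>R\<^esub>"
begin

abbreviation L where "L \<equiv> restrict_scalars R A M"

text \<open>
  A constant rather than an abbreviation: written out, the action of the scalar \<open>r\<close> is itself an
  instance of the left-hand side of the rule that moves scalars out of the action.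
\<close>

definition scale :: "'r \<Rightarrow> 'm \<Rightarrow> 'm" where "scale r y = (r \<odot>\<^bsub>A\<^esub> \<one>\<^bsub>A\<^esub>) \<odot>\<^bsub>M\<^esub> y"

declare restrict_scalars_simps(4) [simp del]

lemma smult_L [simp]: "r \<odot>\<^bsub>L\<^esub> y = scale r y"
  by (simp add: restrict_scalars_simps(4) scale_def)

abbreviation \<chi> :: "'a \<Rightarrow> 'r" where "\<chi> \<equiv> character R A M"

lemma L_module: "module R L"
  by (rule restrict_scalars_module[OF A.assoc_algebra_axioms M.left_module_axioms])

sublocale L: module R L
  rewrites "carrier L = carrier M" and "add L = add M" and "ring.zero L = ring.zero M"
    and "\<And>r y. r \<odot>\<^bsub>L\<^esub> y = scale r y"
  by (rule L_module) (simp_all add: fun_eq_iff)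

lemmas act_simps [simp, intro] = M.smult_closed M.smult_one

lemma smult_act:
  assumes "r \<in> carrier R" "a \<in> carrier A" "y \<in> carrier M"
  shows "(r \<odot>\<^bsub>A\<^esub> a) \<odot>\<^bsub>M\<^esub> y = scale r (a \<odot>\<^bsub>M\<^esub> y)" and "a \<odot>\<^bsub>M\<^esub> scale r y = scale r (a \<odot>\<^bsub>M\<^esub> y)"
proof -
  have "r \<odot>\<^bsub>A\<^esub> a = (r \<odot>\<^bsub>A\<^esub> \<one>\<^bsub>A\<^esub>) \<otimes>\<^bsub>A\<^esub> a" "r \<odot>\<^bsub>A\<^esub> a = a \<otimes>\<^bsub>A\<^esub> (r \<odot>\<^bsub>A\<^esub> \<one>\<^bsub>A\<^esub>)"
    using assms by (simp_all add: A.smult_mult_left A.smult_mult_right)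
  then show "(r \<odot>\<^bsub>A\<^esub> a) \<odot>\<^bsub>M\<^esub> y = scale r (a \<odot>\<^bsub>M\<^esub> y)" and "a \<odot>\<^bsub>M\<^esub> scale r y = scale r (a \<odot>\<^bsub>M\<^esub> y)"
    using assms by (simp_all add: scale_def M.smult_assoc[symmetric])
qed

lemma scalar_endomorphismE:
  assumes "f \<in> Hom A M M"
  obtains r where "r \<in> carrier R" "\<And>y. y \<in> carrier M \<Longrightarrow> f y = scale r y"
  using scalar_endomorphism[OF assms] by (auto simp: scale_def)

lemma scale_inject:
  assumes "q \<in> carrier R" "r \<in> carrier R" "\<And>y. y \<in> carrier M \<Longrightarrow> scale q y = scale r y"
  shows "q = r"
proof -
  have "q \<ominus>\<^bsub>R\<^esub> r = \<zero>\<^bsub>R\<^esub>"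
  proof (rule faithful, goal_cases)
    case (2 y)
    then have y: "y \<in> carrier M" .
    have "scale (q \<ominus>\<^bsub>R\<^esub> r) y \<oplus>\<^bsub>M\<^esub> scale r y = scale (q \<ominus>\<^bsub>R\<^esub> r \<oplus>\<^bsub>R\<^esub> r) y"
      using assms(1,2) y by (simp add: L.smult_l_distr)
    also have "\<dots> = scale r y"
      using assms y by (simp add: A.R.minus_eq A.R.a_assoc A.R.l_neg)
    finally show ?case unfolding scale_def[symmetric]
      using assms(1,2) y by (simp add: M.P.add.r_cancel_one)
  qed (use assms in simp)
  moreover have "q = q \<ominus>\<^bsub>R\<^esub> r \<oplus>\<^bsub>R\<^esub> r"
    using assms(1,2) by (simp add: A.R.minus_eq A.R.a_assoc A.R.l_neg)
  ultimately show ?thesis using assms(2) by simp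
qed

lemma form_dual:
  assumes "y \<in> carrier A"
  shows "(\<lambda>x\<in>carrier A. \<beta> x y) \<in> dual R A" "(\<lambda>x\<in>carrier A. \<beta> y x) \<in> dual R A"
  using form assms by (auto simp: symmetrizing_form_def)

lemma form_simps:
  shows "x \<in> carrier A \<Longrightarrow> y \<in> carrier A \<Longrightarrow> \<beta> x y \<in> carrier R"
    and "r \<in> carrier R \<Longrightarrow> x \<in> carrier A \<Longrightarrow> y \<in> carrier A \<Longrightarrow> \<beta> (r \<odot>\<^bsub>A\<^esub> x) y = r \<otimes>\<^bsub>R\<^esub> \<beta> x y"
    and "r \<in> carrier R \<Longrightarrow> x \<in> carrier A \<Longrightarrow> y \<in> carrier A \<Longrightarrow> \<beta> x (r \<odot>\<^bsub>A\<^esub> y) = r \<otimes>\<^bsub>R\<^esub> \<beta> x y"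
    and "x \<in> carrier A \<Longrightarrow> y \<in> carrier A \<Longrightarrow> z \<in> carrier A \<Longrightarrow> \<beta> (x \<otimes>\<^bsub>A\<^esub> y) z = \<beta> x (y \<otimes>\<^bsub>A\<^esub> z)"
    and "x \<in> carrier A \<Longrightarrow> y \<in> carrier A \<Longrightarrow> \<beta> x y = \<beta> y x"
  using dual_D(1)[OF form_dual(1)[of y], of x] dual_D(3)[OF form_dual(1)[of y], of r x]
    dual_D(3)[OF form_dual(2)[of x], of r y]
  by simp_all (use form in \<open>unfold symmetrizing_form_def, blast+\<close>)

lemma form_nondegenerate:
  assumes "a \<in> carrier A" "b \<in> carrier A" "\<And>c. c \<in> carrier A \<Longrightarrow> \<beta> c a = \<beta> c b"
  shows "a = b"
proof -
  have "inj_on (\<lambda>a. \<lambda>x\<in>carrier A. \<beta> x a) (carrier A)"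
    using form by (auto simp: symmetrizing_form_def bij_betw_def)
  moreover have "(\<lambda>x\<in>carrier A. \<beta> x a) = (\<lambda>x\<in>carrier A. \<beta> x b)"
    using assms(3) by (rule restrict_ext)
  ultimately show ?thesis
    using assms(1,2) by (auto dest: inj_onD)
qed

lemma form_represents:
  assumes "g \<in> dual R A"
  obtains b where "b \<in> carrier A" "\<And>x. x \<in> carrier A \<Longrightarrow> g x = \<beta> x b"
proof -
  have "g \<in> (\<lambda>a. \<lambda>x\<in>carrier A. \<beta> x a) ` carrier A"
    using form assms by (auto simp: symmetrizing_form_def bij_betw_def)
  then show ?thesis using that by auto
qed

lemma section_simps:
  assumes "y \<in> carrier M"
  shows "s y \<in> carrier A" "x \<in> carrier M \<Longrightarrow> s (x \<oplus>\<^bsub>M\<^esub> y) = s x \<oplus>\<^bsub>A\<^esub> s y"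
    "a \<in> carrier A \<Longrightarrow> s (a \<odot>\<^bsub>M\<^esub> y) = a \<otimes>\<^bsub>A\<^esub> s y"
  using Hom_D[OF section_Hom] assms by auto

text \<open>
  The scalar by which the \<open>A\<close>-endomorphism \<open>y \<mapsto> s(y) x\<close> acts. In terms of the idempotent
  \<open>f = s(m\<^sub>0)\<close>, for which \<open>M\<close> is isomorphic to \<open>A f\<close>, it expresses that \<open>f A f = R f\<close>.
\<close>

definition coord :: "'m \<Rightarrow> 'r" where
  "coord x = (THE r. r \<in> carrier R \<and> (\<forall>y\<in>carrier M. s y \<odot>\<^bsub>M\<^esub> x = scale r y))"

lemma coordI:
  assumes "r \<in> carrier R" "\<And>y. y \<in> carrier M \<Longrightarrow> s y \<odot>\<^bsub>M\<^esub> x = scale r y"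
  shows "coord x = r"
  unfolding coord_def
proof (rule the_equality)
  fix q assume "q \<in> carrier R \<and> (\<forall>y\<in>carrier M. s y \<odot>\<^bsub>M\<^esub> x = scale q y)"
  then show "q = r" using assms by (intro scale_inject) auto
qed (use assms in auto)

lemma coord:
  assumes x: "x \<in> carrier M"
  shows "coord x \<in> carrier R" and "\<And>y. y \<in> carrier M \<Longrightarrow> s y \<odot>\<^bsub>M\<^esub> x = scale (coord x) y"
proof -
  have "(\<lambda>y\<in>carrier M. s y \<odot>\<^bsub>M\<^esub> x) \<in> Hom A M M"
    using x by (intro Hom_memI) (auto simp: section_simps M.smult_l_distr M.smult_assoc)
  then obtain r where r: "r \<in> carrier R" "\<And>y. y \<in> carrier M \<Longrightarrow> s y \<odot>\<^bsub>M\<^esub> x = scale r y"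
    by (rule scalar_endomorphismE) fastforce
  then have "coord x = r" by (rule coordI)
  with r show "coord x \<in> carrier R" and "\<And>y. y \<in> carrier M \<Longrightarrow> s y \<odot>\<^bsub>M\<^esub> x = scale (coord x) y"
    by auto
qed

lemma coord_dual: "restrict coord (carrier M) \<in> dual R L"
proof -
  have "coord (x \<oplus>\<^bsub>M\<^esub> x') = coord x \<oplus>\<^bsub>R\<^esub> coord x'" if "x \<in> carrier M" "x' \<in> carrier M" for x x'
    using that by (intro coordI) (auto simp: coord M.smult_r_distr section_simps L.smult_l_distr)
  moreover have "coord (scale r x) = r \<otimes>\<^bsub>R\<^esub> coord x" if "r \<in> carrier R" "x \<in> carrier M" for r x
    using that by (intro coordI) (auto simp: coord smult_act section_simps L.smult_assoc1)
  ultimately show ?thesis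
    unfolding dual_def by (subst restrict_scalars_simps(1)[symmetric, of M R A], intro Hom_memI) (auto simp: coord)
qed

lemma coord_generator: "coord m\<^sub>0 = \<one>\<^bsub>R\<^esub>"
  by (rule coordI) (auto simp: section_generator)

lemma act_Hom:
  assumes "a \<in> carrier A"
  shows "(\<lambda>y\<in>carrier M. a \<odot>\<^bsub>M\<^esub> y) \<in> Hom R L L"
  using assms by (subst restrict_scalars_simps(1)[symmetric, of M R A], intro Hom_memI)
    (auto simp: M.smult_r_distr smult_act)

lemma basis_simps:
  assumes "j \<in> J"
  shows "e j \<in> carrier M" "d j \<in> dual R L" "y \<in> carrier M \<Longrightarrow> d j y \<in> carrier R"
    "x \<in> carrier M \<Longrightarrow> y \<in> carrier M \<Longrightarrow> d j (x \<oplus>\<^bsub>M\<^esub> y) = d j x \<oplus>\<^bsub>R\<^esub> d j y"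
    "r \<in> carrier R \<Longrightarrow> y \<in> carrier M \<Longrightarrow> d j (scale r y) = r \<otimes>\<^bsub>R\<^esub> d j y"
proof -
  show "e j \<in> carrier M" and d: "d j \<in> dual R L"
    using basis assms by (auto simp: dual_basis_def)
  show "y \<in> carrier M \<Longrightarrow> d j y \<in> carrier R"
    "x \<in> carrier M \<Longrightarrow> y \<in> carrier M \<Longrightarrow> d j (x \<oplus>\<^bsub>M\<^esub> y) = d j x \<oplus>\<^bsub>R\<^esub> d j y"
    "r \<in> carrier R \<Longrightarrow> y \<in> carrier M \<Longrightarrow> d j (scale r y) = r \<otimes>\<^bsub>R\<^esub> d j y"
    using dual_D[OF d] by auto
qed

lemma finite_J: "finite J"
  using basis by (simp add: dual_basis_def)

lemma finsum_L: "finsum L = finsum M"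
  by (simp add: finsum_def finprod_def restrict_scalars_def fun_eq_iff)

lemma basis_expand:
  assumes "y \<in> carrier M"
  shows "y = (\<Oplus>\<^bsub>M\<^esub>j\<in>J. scale (d j y) (e j))"
  using basis assms by (simp add: dual_basis_def finsum_L)

lemma character_basis:
  assumes "a \<in> carrier A"
  shows "\<chi> a = (\<Oplus>\<^bsub>R\<^esub>j\<in>J. d j (a \<odot>\<^bsub>M\<^esub> e j))"
proof -
  have "\<chi> a = (\<Oplus>\<^bsub>R\<^esub>j\<in>J. d j ((\<lambda>y\<in>carrier M. a \<odot>\<^bsub>M\<^esub> y) (e j)))"
    unfolding character_def by (rule module.Tr_dual_basis[OF L_module basis act_Hom[OF assms]])
  also have "\<dots> = (\<Oplus>\<^bsub>R\<^esub>j\<in>J. d j (a \<odot>\<^bsub>M\<^esub> e j))"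
    using assms by (intro A.R.finsum_cong') (auto simp: basis_simps)
  finally show ?thesis .
qed

lemma character_dual: "restrict \<chi> (carrier A) \<in> dual R A"
proof -
  have "\<chi> (a \<oplus>\<^bsub>A\<^esub> b) = \<chi> a \<oplus>\<^bsub>R\<^esub> \<chi> b" if "a \<in> carrier A" "b \<in> carrier A" for a b
  proof -
    have "\<chi> (a \<oplus>\<^bsub>A\<^esub> b) = (\<Oplus>\<^bsub>R\<^esub>j\<in>J. d j (a \<odot>\<^bsub>M\<^esub> e j) \<oplus>\<^bsub>R\<^esub> d j (b \<odot>\<^bsub>M\<^esub> e j))"
      unfolding character_basis[OF A.M.a_closed[OF that]] using that
      by (intro A.R.finsum_cong') (auto simp: basis_simps M.smult_l_distr)
    also have "\<dots> = \<chi> a \<oplus>\<^bsub>R\<^esub> \<chi> b"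
      using that by (simp add: character_basis basis_simps Pi_def)
    finally show ?thesis .
  qed
  moreover have "\<chi> (r \<odot>\<^bsub>A\<^esub> a) = r \<otimes>\<^bsub>R\<^esub> \<chi> a" if "r \<in> carrier R" "a \<in> carrier A" for r a
    using that by (simp add: character_basis, subst A.R.finsum_rdistr)
      (auto simp: basis_simps smult_act finite_J intro!: A.R.finsum_cong')
  ultimately show ?thesis
    unfolding dual_def by (intro Hom_memI) (auto simp: character_basis basis_simps)
qed

lemma character_commute:
  assumes "a \<in> carrier A" "b \<in> carrier A"
  shows "\<chi> (a \<otimes>\<^bsub>A\<^esub> b) = \<chi> (b \<otimes>\<^bsub>A\<^esub> a)"
proof -
  have "compose (carrier L) (\<lambda>y\<in>carrier M. a \<odot>\<^bsub>M\<^esub> y) (\<lambda>y\<in>carrier M. b \<odot>\<^bsub>M\<^esub> y)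
      = (\<lambda>y\<in>carrier M. (a \<otimes>\<^bsub>A\<^esub> b) \<odot>\<^bsub>M\<^esub> y)" if "a \<in> carrier A" "b \<in> carrier A" for a b
    using that by (auto simp: compose_def M.smult_assoc fun_eq_iff)
  then show ?thesis
    unfolding character_def
    using module.Tr_compose_commute[OF L_module basis act_Hom act_Hom] assms by metis
qed

lemma character_cong:
  assumes "a \<in> carrier A" "b \<in> carrier A" "\<And>y. y \<in> carrier M \<Longrightarrow> a \<odot>\<^bsub>M\<^esub> y = b \<odot>\<^bsub>M\<^esub> y"
  shows "\<chi> a = \<chi> b"
proof -
  have "(\<lambda>y\<in>carrier M. a \<odot>\<^bsub>M\<^esub> y) = (\<lambda>y\<in>carrier M. b \<odot>\<^bsub>M\<^esub> y)" using assms(3) by auto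
  then show ?thesis by (simp add: character_def)
qed

abbreviation z :: 'a where "z \<equiv> character_element R A \<beta> M"

text \<open>
  Nonsingularity of \<open>\<beta>\<close> represents \<open>\<chi>\<close> by an element, which is central because \<open>\<chi>(a c) = \<chi>(c a)\<close>.
\<close>

lemma character_element: "z \<in> center A" "a \<in> carrier A \<Longrightarrow> \<chi> a = \<beta> a z"
proof -
  obtain b where b: "b \<in> carrier A" and "\<And>x. x \<in> carrier A \<Longrightarrow> restrict \<chi> (carrier A) x = \<beta> x b"
    using form_represents[OF character_dual] by blast
  then have \<chi>b: "\<chi> x = \<beta> x b" if "x \<in> carrier A" for x using that by simp
  have "b \<otimes>\<^bsub>A\<^esub> a = a \<otimes>\<^bsub>A\<^esub> b" if a: "a \<in> carrier A" for a
  proof (rule form_nondegenerate)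
    fix c assume c: "c \<in> carrier A"
    have "\<beta> c (b \<otimes>\<^bsub>A\<^esub> a) = \<beta> (b \<otimes>\<^bsub>A\<^esub> a) c"
      using a b c form_simps(5)[OF c, of "b \<otimes>\<^bsub>A\<^esub> a"] by simp
    also have "\<dots> = \<beta> b (a \<otimes>\<^bsub>A\<^esub> c)" using a b c form_simps(4) by simp
    also have "\<dots> = \<chi> (a \<otimes>\<^bsub>A\<^esub> c)" using a b c form_simps(5)[of b "a \<otimes>\<^bsub>A\<^esub> c"] by (simp add: \<chi>b)
    also have "\<dots> = \<chi> (c \<otimes>\<^bsub>A\<^esub> a)" by (rule character_commute[OF a c])
    also have "\<dots> = \<beta> c (a \<otimes>\<^bsub>A\<^esub> b)" using a b c form_simps(4) by (simp add: \<chi>b)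
    finally show "\<beta> c (b \<otimes>\<^bsub>A\<^esub> a) = \<beta> c (a \<otimes>\<^bsub>A\<^esub> b)" .
  qed (use a b in auto)
  then have bc: "b \<in> center A" using b by (simp add: center_def)
  have "z = b"
    unfolding character_element_def
  proof (rule the_equality)
    fix b' assume "b' \<in> center A \<and> (\<forall>a\<in>carrier A. \<chi> a = \<beta> a b')"
    then show "b' = b" using b \<chi>b by (intro form_nondegenerate) (auto simp: center_def)
  qed (use bc \<chi>b in simp)
  with bc \<chi>b show "z \<in> center A" "a \<in> carrier A \<Longrightarrow> \<chi> a = \<beta> a z" by auto
qed

lemma z_closed [simp, intro]: "z \<in> carrier A" and z_commute: "a \<in> carrier A \<Longrightarrow> z \<otimes>\<^bsub>A\<^esub> a = a \<otimes>\<^bsub>A\<^esub> z"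
  using character_element(1) by (auto simp: center_def)

lemma central_character:
  assumes "x \<in> center A"
  shows "central_character R A M x \<in> carrier R"
    and "\<And>y. y \<in> carrier M \<Longrightarrow> x \<odot>\<^bsub>M\<^esub> y = scale (central_character R A M x) y"
proof -
  have x: "x \<in> carrier A" "\<And>a. a \<in> carrier A \<Longrightarrow> x \<otimes>\<^bsub>A\<^esub> a = a \<otimes>\<^bsub>A\<^esub> x"
    using assms by (auto simp: center_def)
  have "(\<lambda>y\<in>carrier M. x \<odot>\<^bsub>M\<^esub> y) \<in> Hom A M M"
    using x by (intro Hom_memI) (auto simp: M.smult_r_distr M.smult_assoc[symmetric])
  then obtain r where r: "r \<in> carrier R" "\<And>y. y \<in> carrier M \<Longrightarrow> x \<odot>\<^bsub>M\<^esub> y = scale r y"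
    by (rule scalar_endomorphismE) fastforce
  have "central_character R A M x = r"
    unfolding central_character_def
  proof (rule the_equality)
    fix q assume "q \<in> carrier R \<and> (\<forall>m\<in>carrier M. x \<odot>\<^bsub>M\<^esub> m = q \<odot>\<^bsub>L\<^esub> m)"
    then show "q = r" using r by (intro scale_inject) auto
  qed (use r in simp)
  with r show "central_character R A M x \<in> carrier R"
    and "\<And>y. y \<in> carrier M \<Longrightarrow> x \<odot>\<^bsub>M\<^esub> y = scale (central_character R A M x) y" by auto
qed

abbreviation w :: 'r where "w \<equiv> module_index R A \<beta> M"

lemma index_closed [simp, intro]: "w \<in> carrier R"
  and z_act: "y \<in> carrier M \<Longrightarrow> z \<odot>\<^bsub>M\<^esub> y = scale w y"
  using central_character[OF character_element(1)] by (auto simp: module_index_def)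

text \<open>
  The element \<open>s y\<close> acts on \<open>M\<close> as \<open>x \<mapsto> coord(x) y\<close>, which is represented by a single pure tensor.
\<close>

lemma coord_character:
  assumes y: "y \<in> carrier M"
  shows "coord y = \<chi> (s y)"
proof -
  have "Tr R L (\<lambda>x\<in>carrier M. s y \<odot>\<^bsub>M\<^esub> x) = (\<Oplus>\<^bsub>R\<^esub>k\<in>{()}. restrict coord (carrier M) y)"
    by (rule module.Tr_eqI[OF L_module basis, where x = "\<lambda>_. y" and f = "\<lambda>_. restrict coord (carrier M)"])
      (use y coord_dual in \<open>auto simp: coord finsum_L M.P.finsum_insert\<close>)
  then show ?thesis using y coord by (simp add: character_def)
qed

text \<open>
  Being central, \<open>z\<close> can be moved inside the \<open>A\<close>-linear map \<open>s\<close>, where it acts as the scalar \<open>w\<close>.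
\<close>

lemma coord_form:
  assumes y: "y \<in> carrier M"
  shows "coord y = w \<otimes>\<^bsub>R\<^esub> \<beta> (s y) \<one>\<^bsub>A\<^esub>"
proof -
  note [simp] = section_simps(1)[OF y]
  have "coord y = \<beta> (s y) z" by (simp add: coord_character[OF y] character_element(2))
  also have "\<dots> = \<beta> (s y \<otimes>\<^bsub>A\<^esub> z) \<one>\<^bsub>A\<^esub>" using form_simps(4)[of "s y" z "\<one>\<^bsub>A\<^esub>"] by simp
  also have "s y \<otimes>\<^bsub>A\<^esub> z = s (z \<odot>\<^bsub>M\<^esub> y)" using y by (simp add: section_simps z_commute)
  also have "\<dots> = w \<odot>\<^bsub>A\<^esub> s y" using y by (simp add: z_act scale_def section_simps A.smult_mult_left)
  also have "\<beta> (w \<odot>\<^bsub>A\<^esub> s y) \<one>\<^bsub>A\<^esub> = w \<otimes>\<^bsub>R\<^esub> \<beta> (s y) \<one>\<^bsub>A\<^esub>" using form_simps(2) by simp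
  finally show ?thesis .
qed

text \<open>
  The relation \<open>coord y = w \<beta>(s y, 1)\<close> at \<open>y = m\<^sub>0\<close> exhibits \<open>\<beta>(s m\<^sub>0, 1)\<close> as the inverse of \<open>w\<close>.
\<close>

lemma index_inverse: "inv\<^bsub>R\<^esub> w \<in> carrier R" "w \<otimes>\<^bsub>R\<^esub> inv\<^bsub>R\<^esub> w = \<one>\<^bsub>R\<^esub>"
proof -
  have c: "\<beta> (s m\<^sub>0) \<one>\<^bsub>A\<^esub> \<in> carrier R"
    using form_simps(1) section_simps(1) generator by simp
  have "w \<otimes>\<^bsub>R\<^esub> \<beta> (s m\<^sub>0) \<one>\<^bsub>A\<^esub> = \<one>\<^bsub>R\<^esub>"
    using coord_form[OF generator] coord_generator by simp
  then have "inv\<^bsub>R\<^esub> w = \<beta> (s m\<^sub>0) \<one>\<^bsub>A\<^esub>"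
    using A.R.comm_inv_char[of w "\<beta> (s m\<^sub>0) \<one>\<^bsub>A\<^esub>"] c by simp
  with c show "inv\<^bsub>R\<^esub> w \<in> carrier R" "w \<otimes>\<^bsub>R\<^esub> inv\<^bsub>R\<^esub> w = \<one>\<^bsub>R\<^esub>"
    using coord_form[OF generator] coord_generator by auto
qed

abbreviation \<epsilon> :: 'a where "\<epsilon> \<equiv> central_idempotent R A \<beta> M"

lemma eps_closed [simp, intro]: "\<epsilon> \<in> carrier A"
  using index_inverse by (simp add: central_idempotent_def)

lemma eps_act: "y \<in> carrier M \<Longrightarrow> \<epsilon> \<odot>\<^bsub>M\<^esub> y = y"
  using index_inverse A.R.m_comm[of w "inv\<^bsub>R\<^esub> w"]
  by (simp add: central_idempotent_def smult_act z_act L.smult_assoc1[symmetric])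

text \<open>
  The annihilator of \<open>M\<close> is killed by \<open>\<epsilon>\<close>: \<open>\<beta>(c, \<epsilon> x) = w\<^sup>-\<^sup>1 \<chi>(c x)\<close> depends on \<open>x\<close> only through its action
  on \<open>M\<close>, and \<open>\<beta>\<close> is nondegenerate.
\<close>

lemma eps_eqI:
  assumes a: "a \<in> carrier A" and b: "b \<in> carrier A"
    and eq: "\<And>y. y \<in> carrier M \<Longrightarrow> a \<odot>\<^bsub>M\<^esub> y = b \<odot>\<^bsub>M\<^esub> y"
  shows "\<epsilon> \<otimes>\<^bsub>A\<^esub> a = \<epsilon> \<otimes>\<^bsub>A\<^esub> b"
proof (rule form_nondegenerate)
  fix c assume c: "c \<in> carrier A"
  have *: "\<beta> c (\<epsilon> \<otimes>\<^bsub>A\<^esub> x) = inv\<^bsub>R\<^esub> w \<otimes>\<^bsub>R\<^esub> \<chi> (c \<otimes>\<^bsub>A\<^esub> x)" if x: "x \<in> carrier A" for x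
  proof -
    have "\<epsilon> \<otimes>\<^bsub>A\<^esub> x = inv\<^bsub>R\<^esub> w \<odot>\<^bsub>A\<^esub> (x \<otimes>\<^bsub>A\<^esub> z)"
      using x index_inverse by (simp add: central_idempotent_def A.smult_mult_left z_commute)
    then show ?thesis
      using c x index_inverse form_simps(3)[of _ c "x \<otimes>\<^bsub>A\<^esub> z"] form_simps(4)[of c x z]
      by (simp add: character_element(2))
  qed
  have "\<chi> (c \<otimes>\<^bsub>A\<^esub> a) = \<chi> (c \<otimes>\<^bsub>A\<^esub> b)"
    using a b c eq by (intro character_cong) (auto simp: M.smult_assoc)
  then show "\<beta> c (\<epsilon> \<otimes>\<^bsub>A\<^esub> a) = \<beta> c (\<epsilon> \<otimes>\<^bsub>A\<^esub> b)" using * a b by simp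
qed (use a b in auto)

lemma eps_idem: "\<epsilon> \<otimes>\<^bsub>A\<^esub> \<epsilon> = \<epsilon>"
  using eps_eqI[of \<epsilon> "\<one>\<^bsub>A\<^esub>"] by (simp add: eps_act M.smult_one)

text \<open>
  The element \<open>s(x) b\<close> acts by \<open>y \<mapsto> coord(b y) x\<close>, and \<open>coord(b y) = w \<beta>(s y, b)\<close>. So it suffices to
  choose \<open>b\<close> as \<open>w\<^sup>-\<^sup>1\<close> times the element representing \<open>a \<mapsto> g(a m\<^sub>0)\<close>, because \<open>s(y) m\<^sub>0 = y\<close>.
\<close>

lemma rank_one_action:
  assumes g: "g \<in> dual R L" and x: "x \<in> carrier M"
  obtains a where "a \<in> carrier A" "\<And>y. y \<in> carrier M \<Longrightarrow> a \<odot>\<^bsub>M\<^esub> y = scale (g y) x"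
proof -
  note gD = dual_D[OF g, simplified]
  have "(\<lambda>a\<in>carrier A. g (a \<odot>\<^bsub>M\<^esub> m\<^sub>0)) \<in> dual R A"
    unfolding dual_def using generator by (intro Hom_memI) (auto simp: gD M.smult_l_distr smult_act)
  then obtain b where b: "b \<in> carrier A" and "\<And>a. a \<in> carrier A \<Longrightarrow> (\<lambda>a\<in>carrier A. g (a \<odot>\<^bsub>M\<^esub> m\<^sub>0)) a = \<beta> a b"
    by (rule form_represents) blast
  then have gb: "\<And>a. a \<in> carrier A \<Longrightarrow> g (a \<odot>\<^bsub>M\<^esub> m\<^sub>0) = \<beta> a b" by simp
  let ?t = "inv\<^bsub>R\<^esub> w"
  let ?b = "?t \<odot>\<^bsub>A\<^esub> b"
  have bc: "?b \<in> carrier A" using b index_inverse by simp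
  have "(s x \<otimes>\<^bsub>A\<^esub> ?b) \<odot>\<^bsub>M\<^esub> y = scale (g y) x" if y: "y \<in> carrier M" for y
  proof -
    have "coord (?b \<odot>\<^bsub>M\<^esub> y) = w \<otimes>\<^bsub>R\<^esub> \<beta> (?b \<otimes>\<^bsub>A\<^esub> s y) \<one>\<^bsub>A\<^esub>"
      using y bc by (simp add: coord_form section_simps)
    also have "\<beta> (?b \<otimes>\<^bsub>A\<^esub> s y) \<one>\<^bsub>A\<^esub> = \<beta> (s y) ?b"
      using y bc form_simps(4)[of ?b "s y" "\<one>\<^bsub>A\<^esub>"] form_simps(5)[of ?b "s y"] by (simp add: section_simps)
    also have "\<dots> = ?t \<otimes>\<^bsub>R\<^esub> g y"
      using y b index_inverse form_simps(3)[of _ "s y" b] gb[of "s y"]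
      by (simp add: section_simps section_generator)
    also have "w \<otimes>\<^bsub>R\<^esub> (?t \<otimes>\<^bsub>R\<^esub> g y) = g y"
      using y index_inverse gD(1) by (simp add: A.R.m_assoc[symmetric])
    finally show ?thesis
      using x y bc by (simp add: M.smult_assoc coord section_simps)
  qed
  then show ?thesis using that[of "s x \<otimes>\<^bsub>A\<^esub> ?b"] x bc by (simp add: section_simps)
qed

text \<open>
  An endomorphism \<open>\<phi>\<close> is the sum of the rank-one maps \<open>y \<mapsto> d j (y) \<phi>(e j)\<close>.
\<close>

lemma action_surjective:
  assumes \<phi>: "\<phi> \<in> Hom R L L"
  obtains a where "a \<in> carrier A" "\<And>y. y \<in> carrier M \<Longrightarrow> a \<odot>\<^bsub>M\<^esub> y = \<phi> y"
proof -
  have \<phi>c: "\<phi> y \<in> carrier M" if "y \<in> carrier M" for y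
    using Hom_D(1)[OF \<phi>] that by simp
  have \<phi>s: "\<phi> (scale r y) = scale r (\<phi> y)" if "r \<in> carrier R" "y \<in> carrier M" for r y
    using Hom_D(3)[OF \<phi>] that by simp
  have "\<forall>j\<in>J. \<exists>a. a \<in> carrier A \<and> (\<forall>y\<in>carrier M. a \<odot>\<^bsub>M\<^esub> y = scale (d j y) (\<phi> (e j)))"
  proof
    fix j assume j: "j \<in> J"
    show "\<exists>a. a \<in> carrier A \<and> (\<forall>y\<in>carrier M. a \<odot>\<^bsub>M\<^esub> y = scale (d j y) (\<phi> (e j)))"
      by (rule rank_one_action[OF basis_simps(2)[OF j] \<phi>c[OF basis_simps(1)[OF j]]]) blast
  qed
  from bchoice[OF this] obtain a where a: "\<And>j. j \<in> J \<Longrightarrow> a j \<in> carrier A"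
    and act: "\<And>j y. j \<in> J \<Longrightarrow> y \<in> carrier M \<Longrightarrow> a j \<odot>\<^bsub>M\<^esub> y = scale (d j y) (\<phi> (e j))"
    by blast
  have "(\<Oplus>\<^bsub>A\<^esub>j\<in>J. a j) \<odot>\<^bsub>M\<^esub> y = \<phi> y" if y: "y \<in> carrier M" for y
  proof -
    have "(\<Oplus>\<^bsub>A\<^esub>j\<in>J. a j) \<odot>\<^bsub>M\<^esub> y = (\<Oplus>\<^bsub>M\<^esub>j\<in>J. a j \<odot>\<^bsub>M\<^esub> y)"
      using a y by (intro additive_finsum[OF A.M.abelian_group_axioms M.P.abelian_group_axioms, where f = "\<lambda>a. a \<odot>\<^bsub>M\<^esub> y"])
        (auto simp: M.smult_l_distr)
    also have "\<dots> = (\<Oplus>\<^bsub>M\<^esub>j\<in>J. \<phi> (scale (d j y) (e j)))"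
      using a y by (intro M.P.finsum_cong') (auto simp: act \<phi>c \<phi>s basis_simps)
    also have "\<dots> = \<phi> (\<Oplus>\<^bsub>M\<^esub>j\<in>J. scale (d j y) (e j))"
      using y by (intro additive_finsum[OF M.P.abelian_group_axioms M.P.abelian_group_axioms, symmetric])
        (use Hom_D(1,2)[OF \<phi>] in \<open>auto simp: basis_simps\<close>)
    finally show ?thesis using basis_expand[OF y] by simp
  qed
  then show ?thesis using that[of "\<Oplus>\<^bsub>A\<^esub>j\<in>J. a j"] a by auto
qed

abbreviation Block where "Block \<equiv> ideal_algebra A \<epsilon>"

lemma Block_simps [simp]:
  "carrier Block = (\<lambda>a. \<epsilon> \<otimes>\<^bsub>A\<^esub> a) ` carrier A"
  "x \<oplus>\<^bsub>Block\<^esub> y = x \<oplus>\<^bsub>A\<^esub> y" "x \<otimes>\<^bsub>Block\<^esub> y = x \<otimes>\<^bsub>A\<^esub> y"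
  "\<zero>\<^bsub>Block\<^esub> = \<zero>\<^bsub>A\<^esub>" "\<one>\<^bsub>Block\<^esub> = \<epsilon>" "r \<odot>\<^bsub>Block\<^esub> x = r \<odot>\<^bsub>A\<^esub> x"
  by (simp_all add: ideal_algebra_def)

lemma carrier_Block: "carrier Block = {x \<in> carrier A. \<epsilon> \<otimes>\<^bsub>A\<^esub> x = x}"
proof -
  have "\<epsilon> \<otimes>\<^bsub>A\<^esub> (\<epsilon> \<otimes>\<^bsub>A\<^esub> a) = \<epsilon> \<otimes>\<^bsub>A\<^esub> a" if "a \<in> carrier A" for a
    using that by (simp add: A.m_assoc[symmetric] eps_idem)
  then show ?thesis by (auto intro: rev_image_eqI)
qed

lemma eps_mult_act:
  assumes "a \<in> carrier A" "y \<in> carrier M"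
  shows "(\<epsilon> \<otimes>\<^bsub>A\<^esub> a) \<odot>\<^bsub>M\<^esub> y = a \<odot>\<^bsub>M\<^esub> y"
  using assms by (simp add: M.smult_assoc eps_act)

lemma block_iso_End: "algebra_iso R Block (End_algebra R L (smult L))"
  unfolding algebra_iso_def
proof (intro bexI ballI)
  let ?E = "End_algebra R L (smult L)"
  let ?\<phi> = "\<lambda>a. \<lambda>y\<in>carrier M. a \<odot>\<^bsub>M\<^esub> y"
  have E: "carrier ?E = Hom R L L" "\<one>\<^bsub>?E\<^esub> = (\<lambda>y\<in>carrier M. y)"
    "f \<otimes>\<^bsub>?E\<^esub> g = compose (carrier M) f g" "f \<oplus>\<^bsub>?E\<^esub> g = (\<lambda>y\<in>carrier M. f y \<oplus>\<^bsub>M\<^esub> g y)"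
    "r \<odot>\<^bsub>?E\<^esub> f = (\<lambda>y\<in>carrier M. scale r (f y))" for f g r
    by (simp_all add: End_algebra_def)
  show "?\<phi> (r \<odot>\<^bsub>Block\<^esub> x) = r \<odot>\<^bsub>?E\<^esub> ?\<phi> x" if "r \<in> carrier R" "x \<in> carrier Block" for r x
    using that unfolding carrier_Block by (auto simp: E smult_act)
  show "?\<phi> \<in> ring_iso Block ?E"
  proof (rule ring_iso_memI)
    show "?\<phi> x \<in> carrier ?E" if "x \<in> carrier Block" for x
      using that act_Hom unfolding carrier_Block E by simp
    show "?\<phi> (x \<otimes>\<^bsub>Block\<^esub> y) = ?\<phi> x \<otimes>\<^bsub>?E\<^esub> ?\<phi> y" if "x \<in> carrier Block" "y \<in> carrier Block" for x y
      using that unfolding carrier_Block E by (auto simp: compose_def M.smult_assoc)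
    show "?\<phi> (x \<oplus>\<^bsub>Block\<^esub> y) = ?\<phi> x \<oplus>\<^bsub>?E\<^esub> ?\<phi> y" if "x \<in> carrier Block" "y \<in> carrier Block" for x y
      using that unfolding carrier_Block E by (auto simp: M.smult_l_distr)
    show "?\<phi> \<one>\<^bsub>Block\<^esub> = \<one>\<^bsub>?E\<^esub>"
      unfolding E Block_simps by (rule restrict_ext) (rule eps_act)
    show "bij_betw ?\<phi> (carrier Block) (carrier ?E)"
      unfolding bij_betw_def
    proof
      show "inj_on ?\<phi> (carrier Block)"
      proof (rule inj_onI)
        fix x y assume xy: "x \<in> carrier Block" "y \<in> carrier Block" and eq: "?\<phi> x = ?\<phi> y"
        have "x \<odot>\<^bsub>M\<^esub> m = y \<odot>\<^bsub>M\<^esub> m" if "m \<in> carrier M" for m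
          using fun_cong[OF eq, of m] that by simp
        then have "\<epsilon> \<otimes>\<^bsub>A\<^esub> x = \<epsilon> \<otimes>\<^bsub>A\<^esub> y"
          using xy unfolding carrier_Block by (intro eps_eqI) auto
        then show "x = y" using xy unfolding carrier_Block by simp
      qed
      show "?\<phi> ` carrier Block = carrier ?E"
      proof (intro equalityI subsetI)
        fix \<psi> assume "\<psi> \<in> carrier ?E"
        then have \<psi>: "\<psi> \<in> Hom R L L" by (simp add: E)
        obtain a where a: "a \<in> carrier A" "\<And>y. y \<in> carrier M \<Longrightarrow> a \<odot>\<^bsub>M\<^esub> y = \<psi> y"
          by (rule action_surjective[OF \<psi>]) blast
        have "?\<phi> (\<epsilon> \<otimes>\<^bsub>A\<^esub> a) = \<psi>"
          using a Hom_D(4)[OF \<psi>] by (auto simp: eps_mult_act fun_eq_iff extensional_def)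
        then show "\<psi> \<in> ?\<phi> ` carrier Block" using a by auto
      qed (use act_Hom in \<open>auto simp: E carrier_Block simp del: Block_simps(1)\<close>)
    qed
  qed
qed

lemma Block_module: "module R Block"
proof (rule moduleI)
  show "abelian_group Block"
  proof (rule abelian_groupI)
    fix x assume x: "x \<in> carrier Block"
    then have "\<ominus>\<^bsub>A\<^esub> x \<in> carrier Block" "\<ominus>\<^bsub>A\<^esub> x \<oplus>\<^bsub>A\<^esub> x = \<zero>\<^bsub>A\<^esub>"
      unfolding carrier_Block by (auto simp: A.r_minus A.M.l_neg)
    then show "\<exists>y\<in>carrier Block. y \<oplus>\<^bsub>Block\<^esub> x = \<zero>\<^bsub>Block\<^esub>" unfolding Block_simps(2,4) by blast
  qed (unfold carrier_Block, auto simp: A.r_distr A.M.a_ac)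
qed (unfold carrier_Block, auto simp: A.R.is_cring A.smult_mult_right A.smult_l_distr A.smult_r_distr A.smult_assoc1)

lemma matrix_units:
  obtains u where "u \<in> J \<times> J \<rightarrow> carrier Block"
    "\<And>k l y. \<lbrakk>k \<in> J; l \<in> J; y \<in> carrier M\<rbrakk> \<Longrightarrow> u (k, l) \<odot>\<^bsub>M\<^esub> y = scale (d l y) (e k)"
proof -
  have "\<exists>a\<in>carrier Block. \<forall>y\<in>carrier M. a \<odot>\<^bsub>M\<^esub> y = scale (d (snd q) y) (e (fst q))" if "q \<in> J \<times> J" for q
  proof -
    have "d (snd q) \<in> dual R L" "e (fst q) \<in> carrier M" using that basis_simps by auto
    then obtain a where "a \<in> carrier A" "\<And>y. y \<in> carrier M \<Longrightarrow> a \<odot>\<^bsub>M\<^esub> y = scale (d (snd q) y) (e (fst q))"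
      by (rule rank_one_action) blast
    then show ?thesis by (intro bexI[of _ "\<epsilon> \<otimes>\<^bsub>A\<^esub> a"]) (auto simp: eps_mult_act)
  qed
  then obtain u where "\<forall>q\<in>J \<times> J. u q \<in> carrier Block \<and> (\<forall>y\<in>carrier M. u q \<odot>\<^bsub>M\<^esub> y = scale (d (snd q) y) (e (fst q)))"
    by metis
  then show ?thesis by (intro that[of u]) auto
qed

text \<open>
  Both sides act equally on \<open>M\<close>: expanding \<open>y\<close> and then each \<open>x e\<^sub>l\<close> in the dual basis gives
  \<open>x y = \<Sum> d\<^sub>l(y) d\<^sub>k(x e\<^sub>l) e\<^sub>k\<close>.
\<close>

lemma matrix_unit_expansion:
  assumes u: "u \<in> J \<times> J \<rightarrow> carrier Block"
    and act: "\<And>k l y. \<lbrakk>k \<in> J; l \<in> J; y \<in> carrier M\<rbrakk> \<Longrightarrow> u (k, l) \<odot>\<^bsub>M\<^esub> y = scale (d l y) (e k)"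
    and x: "x \<in> carrier A"
  shows "\<epsilon> \<otimes>\<^bsub>A\<^esub> x = (\<Oplus>\<^bsub>A\<^esub>q\<in>J \<times> J. d (fst q) (x \<odot>\<^bsub>M\<^esub> e (snd q)) \<odot>\<^bsub>A\<^esub> u q)" (is "_ = ?S")
proof -
  let ?c = "\<lambda>q. d (fst q) (x \<odot>\<^bsub>M\<^esub> e (snd q))"
  have c: "?c q \<in> carrier R" if "q \<in> J \<times> J" for q
    using that x by (auto simp: basis_simps)
  have uA: "u q \<in> carrier A" and eu: "\<epsilon> \<otimes>\<^bsub>A\<^esub> u q = u q" if "q \<in> J \<times> J" for q
    using u that unfolding carrier_Block by auto
  have S: "?S \<in> carrier A" using c uA by auto
  have "\<epsilon> \<otimes>\<^bsub>A\<^esub> x = \<epsilon> \<otimes>\<^bsub>A\<^esub> ?S"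
  proof (rule eps_eqI[OF x S])
    fix y assume y: "y \<in> carrier M"
    have "?S \<odot>\<^bsub>M\<^esub> y = (\<Oplus>\<^bsub>M\<^esub>q\<in>J \<times> J. (?c q \<odot>\<^bsub>A\<^esub> u q) \<odot>\<^bsub>M\<^esub> y)"
      using c uA y by (intro additive_finsum[OF A.M.abelian_group_axioms M.P.abelian_group_axioms, where f = "\<lambda>a. a \<odot>\<^bsub>M\<^esub> y"])
        (auto simp: M.smult_l_distr)
    also have "\<dots> = (\<Oplus>\<^bsub>M\<^esub>q\<in>J \<times> J. scale (d (snd q) y) (scale (d (fst q) (x \<odot>\<^bsub>M\<^esub> e (snd q))) (e (fst q))))"
      using c uA y x by (intro M.P.finsum_cong')
        (auto simp: smult_act act basis_simps L.smult_assoc1[symmetric] A.R.m_comm)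
    also have "\<dots> = (\<Oplus>\<^bsub>M\<^esub>k\<in>J. \<Oplus>\<^bsub>M\<^esub>l\<in>J. scale (d l y) (scale (d k (x \<odot>\<^bsub>M\<^esub> e l)) (e k)))"
      using finite_J x y by (intro M.P.finsum_product) (auto simp: basis_simps)
    also have "\<dots> = (\<Oplus>\<^bsub>M\<^esub>l\<in>J. \<Oplus>\<^bsub>M\<^esub>k\<in>J. scale (d l y) (scale (d k (x \<odot>\<^bsub>M\<^esub> e l)) (e k)))"
      using finite_J x y by (intro M.P.finsum_swap) (auto simp: basis_simps)
    also have "\<dots> = (\<Oplus>\<^bsub>M\<^esub>l\<in>J. x \<odot>\<^bsub>M\<^esub> scale (d l y) (e l))"
    proof (intro M.P.finsum_cong' refl)
      fix l assume l: "l \<in> J"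
      have "(\<Oplus>\<^bsub>M\<^esub>k\<in>J. scale (d l y) (scale (d k (x \<odot>\<^bsub>M\<^esub> e l)) (e k)))
          = scale (d l y) (\<Oplus>\<^bsub>M\<^esub>k\<in>J. scale (d k (x \<odot>\<^bsub>M\<^esub> e l)) (e k))"
        using x y l by (intro additive_finsum[OF M.P.abelian_group_axioms M.P.abelian_group_axioms, symmetric])
          (auto simp: basis_simps L.smult_r_distr)
      then show "(\<Oplus>\<^bsub>M\<^esub>k\<in>J. scale (d l y) (scale (d k (x \<odot>\<^bsub>M\<^esub> e l)) (e k))) = x \<odot>\<^bsub>M\<^esub> scale (d l y) (e l)"
        using basis_expand[of "x \<odot>\<^bsub>M\<^esub> e l"] x y l by (simp add: basis_simps smult_act)
    qed (use x y in \<open>auto simp: basis_simps\<close>)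
    also have "\<dots> = x \<odot>\<^bsub>M\<^esub> (\<Oplus>\<^bsub>M\<^esub>l\<in>J. scale (d l y) (e l))"
      using x y by (intro additive_finsum[OF M.P.abelian_group_axioms M.P.abelian_group_axioms, symmetric])
        (auto simp: basis_simps M.smult_r_distr)
    also have "\<dots> = x \<odot>\<^bsub>M\<^esub> y" using basis_expand[OF y] by simp
    finally show "x \<odot>\<^bsub>M\<^esub> y = ?S \<odot>\<^bsub>M\<^esub> y" by simp
  qed
  also have "\<dots> = (\<Oplus>\<^bsub>A\<^esub>q\<in>J \<times> J. \<epsilon> \<otimes>\<^bsub>A\<^esub> (?c q \<odot>\<^bsub>A\<^esub> u q))"
    using c uA by (intro additive_finsum[OF A.M.abelian_group_axioms A.M.abelian_group_axioms]) (auto simp: A.r_distr)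
  also have "\<dots> = ?S"
    using c uA eu by (intro A.M.finsum_cong') (auto simp: A.smult_mult_right)
  finally show ?thesis .
qed

lemma rank_basis: "hs_rank R L = (\<Oplus>\<^bsub>R\<^esub>j\<in>J. d j (e j))"
proof -
  have "(\<lambda>y\<in>carrier L. y) = (\<lambda>y\<in>carrier M. \<one>\<^bsub>A\<^esub> \<odot>\<^bsub>M\<^esub> y)"
    unfolding restrict_scalars_simps(1) by (rule restrict_ext) simp
  then have "hs_rank R L = \<chi> \<one>\<^bsub>A\<^esub>"
    unfolding hs_rank_def character_def by (rule arg_cong)
  also have "\<dots> = (\<Oplus>\<^bsub>R\<^esub>j\<in>J. d j (e j))"
    unfolding character_basis[OF A.one_closed] by (intro A.R.finsum_cong') (auto simp: basis_simps)
  finally show ?thesis .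
qed

text \<open>
  Since \<open>u\<^sub>k\<^sub>l e\<^sub>l = d\<^sub>l(e\<^sub>l) e\<^sub>k\<close>, the double sum factors into the trace of the identity and that of \<open>a\<close>.
\<close>

lemma matrix_unit_trace:
  assumes u: "u \<in> J \<times> J \<rightarrow> carrier Block"
    and act: "\<And>k l y. \<lbrakk>k \<in> J; l \<in> J; y \<in> carrier M\<rbrakk> \<Longrightarrow> u (k, l) \<odot>\<^bsub>M\<^esub> y = scale (d l y) (e k)"
    and a: "a \<in> carrier A"
  shows "(\<Oplus>\<^bsub>R\<^esub>q\<in>J \<times> J. d (fst q) ((a \<otimes>\<^bsub>A\<^esub> u q) \<odot>\<^bsub>M\<^esub> e (snd q))) = hs_rank R L \<otimes>\<^bsub>R\<^esub> \<chi> a"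
proof -
  have uA: "u q \<in> carrier A" if "q \<in> J \<times> J" for q
    using u that unfolding carrier_Block by auto
  have "(\<Oplus>\<^bsub>R\<^esub>q\<in>J \<times> J. d (fst q) ((a \<otimes>\<^bsub>A\<^esub> u q) \<odot>\<^bsub>M\<^esub> e (snd q)))
      = (\<Oplus>\<^bsub>R\<^esub>q\<in>J \<times> J. d (snd q) (e (snd q)) \<otimes>\<^bsub>R\<^esub> d (fst q) (a \<odot>\<^bsub>M\<^esub> e (fst q)))"
    using a uA by (intro A.R.finsum_cong') (auto simp: M.smult_assoc act basis_simps smult_act)
  also have "\<dots> = (\<Oplus>\<^bsub>R\<^esub>k\<in>J. \<Oplus>\<^bsub>R\<^esub>l\<in>J. d l (e l) \<otimes>\<^bsub>R\<^esub> d k (a \<odot>\<^bsub>M\<^esub> e k))"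
    using finite_J a by (intro A.R.finsum_product) (auto simp: basis_simps)
  also have "\<dots> = (\<Oplus>\<^bsub>R\<^esub>k\<in>J. hs_rank R L \<otimes>\<^bsub>R\<^esub> d k (a \<odot>\<^bsub>M\<^esub> e k))"
    unfolding rank_basis using finite_J a
    by (intro A.R.finsum_cong') (auto simp: basis_simps A.R.finsum_ldistr Pi_def)
  also have "\<dots> = hs_rank R L \<otimes>\<^bsub>R\<^esub> \<chi> a"
    unfolding character_basis[OF a] rank_basis using finite_J a
    by (intro A.R.finsum_rdistr[symmetric]) (auto simp: basis_simps)
  finally show ?thesis .
qed

lemma matrix_functional:
  assumes "a \<in> carrier A" "k \<in> J" "l \<in> J"
  shows "(\<lambda>x\<in>carrier A. d k ((a \<otimes>\<^bsub>A\<^esub> x) \<odot>\<^bsub>M\<^esub> e l)) \<in> dual R A"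
    and "(\<lambda>x\<in>carrier Block. d k (x \<odot>\<^bsub>M\<^esub> e l)) \<in> dual R Block"
proof -
  show "(\<lambda>x\<in>carrier A. d k ((a \<otimes>\<^bsub>A\<^esub> x) \<odot>\<^bsub>M\<^esub> e l)) \<in> dual R A"
    unfolding dual_def using assms
    by (intro Hom_memI) (auto simp: basis_simps A.r_distr M.smult_l_distr A.smult_mult_right smult_act)
  interpret Block: module R Block by (rule Block_module)
  show "(\<lambda>x\<in>carrier Block. d k (x \<odot>\<^bsub>M\<^esub> e l)) \<in> dual R Block"
    unfolding dual_def using assms Block.M.a_closed Block.smult_closed
    by (intro Hom_memI; unfold carrier_Block) (auto simp: basis_simps M.smult_l_distr smult_act)
qed

text \<open>
  By the expansion of \<open>\<epsilon> x = x\<close>, the matrix units and the functionals \<open>x \<mapsto> d\<^sub>k(x e\<^sub>l)\<close> form a dual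
  basis of the block.
\<close>

lemma rank_block: "hs_rank R Block = hs_rank R L [^]\<^bsub>R\<^esub> (2 :: nat)"
proof -
  interpret Block: module R Block by (rule Block_module)
  obtain u where u: "u \<in> J \<times> J \<rightarrow> carrier Block"
    and act: "\<And>k l y. \<lbrakk>k \<in> J; l \<in> J; y \<in> carrier M\<rbrakk> \<Longrightarrow> u (k, l) \<odot>\<^bsub>M\<^esub> y = scale (d l y) (e k)"
    by (rule matrix_units) blast
  let ?g = "\<lambda>q. \<lambda>x\<in>carrier Block. d (fst q) (x \<odot>\<^bsub>M\<^esub> e (snd q))"
  have g: "?g \<in> J \<times> J \<rightarrow> dual R Block" using matrix_functional(2)[OF A.one_closed] by auto
  have c: "d (fst q) (x \<odot>\<^bsub>M\<^esub> e (snd q)) \<in> carrier R" if "q \<in> J \<times> J" "x \<in> carrier A" for q x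
    using that by (auto simp: basis_simps)
  have expand: "x = (\<Oplus>\<^bsub>Block\<^esub>q\<in>J \<times> J. ?g q x \<odot>\<^bsub>Block\<^esub> u q)" if x: "x \<in> carrier Block" for x
  proof -
    have xA: "x \<in> carrier A" using x unfolding carrier_Block by simp
    have BA: "y \<in> carrier A" if "y \<in> carrier Block" for y
      using that unfolding carrier_Block by simp
    have "(\<Oplus>\<^bsub>Block\<^esub>q\<in>J \<times> J. ?g q x \<odot>\<^bsub>Block\<^esub> u q) = (\<Oplus>\<^bsub>A\<^esub>q\<in>J \<times> J. ?g q x \<odot>\<^bsub>Block\<^esub> u q)"
    proof (rule additive_finsum[OF Block.M.abelian_group_axioms A.M.abelian_group_axioms, where f = "\<lambda>x. x"])
      show "(\<lambda>q. ?g q x \<odot>\<^bsub>Block\<^esub> u q) \<in> J \<times> J \<rightarrow> carrier Block"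
        by (intro Pi_I Block.smult_closed dual_D(1)[OF funcset_mem[OF g] x] funcset_mem[OF u])
      show "y \<oplus>\<^bsub>Block\<^esub> y' = y \<oplus>\<^bsub>A\<^esub> y'" for y y' by (rule Block_simps(2))
    qed (use BA in blast)
    also have "\<dots> = (\<Oplus>\<^bsub>A\<^esub>q\<in>J \<times> J. d (fst q) (x \<odot>\<^bsub>M\<^esub> e (snd q)) \<odot>\<^bsub>A\<^esub> u q)"
    proof (intro A.M.finsum_cong' refl Pi_I)
      fix q assume q: "q \<in> J \<times> J"
      show "d (fst q) (x \<odot>\<^bsub>M\<^esub> e (snd q)) \<odot>\<^bsub>A\<^esub> u q \<in> carrier A"
        using c[OF q xA] BA[OF funcset_mem[OF u q]] by simp
      show "?g q x \<odot>\<^bsub>Block\<^esub> u q = d (fst q) (x \<odot>\<^bsub>M\<^esub> e (snd q)) \<odot>\<^bsub>A\<^esub> u q"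
        using x by (simp only: restrict_apply if_True Block_simps(6))
    qed
    also have "\<dots> = \<epsilon> \<otimes>\<^bsub>A\<^esub> x"
      by (rule matrix_unit_expansion[OF u act xA, symmetric])
    also have "\<dots> = x" using x unfolding carrier_Block by simp
    finally show ?thesis by simp
  qed
  have basis': "dual_basis R Block (J \<times> J) u ?g"
    unfolding dual_basis_def using u g expand finite_J by blast
  have "hs_rank R Block = (\<Oplus>\<^bsub>R\<^esub>q\<in>J \<times> J. ?g q (u q))"
    unfolding hs_rank_def
  proof (rule Block.Tr_eqI[OF basis' _ u g])
    show "restrict (\<lambda>x. x) (carrier Block) x = (\<Oplus>\<^bsub>Block\<^esub>q\<in>J \<times> J. ?g q x \<odot>\<^bsub>Block\<^esub> u q)"
      if "x \<in> carrier Block" for x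
      using expand[OF that] that by (simp only: restrict_apply if_True)
  qed (use finite_J in simp)
  also have "\<dots> = (\<Oplus>\<^bsub>R\<^esub>q\<in>J \<times> J. d (fst q) ((\<one>\<^bsub>A\<^esub> \<otimes>\<^bsub>A\<^esub> u q) \<odot>\<^bsub>M\<^esub> e (snd q)))"
  proof (intro A.R.finsum_cong' refl Pi_I)
    fix q assume q: "q \<in> J \<times> J"
    note uB = funcset_mem[OF u q]
    have uA: "u q \<in> carrier A" using uB unfolding carrier_Block by simp
    show "d (fst q) ((\<one>\<^bsub>A\<^esub> \<otimes>\<^bsub>A\<^esub> u q) \<odot>\<^bsub>M\<^esub> e (snd q)) \<in> carrier R"
      using c[OF q uA] uA by simp
    show "?g q (u q) = d (fst q) ((\<one>\<^bsub>A\<^esub> \<otimes>\<^bsub>A\<^esub> u q) \<odot>\<^bsub>M\<^esub> e (snd q))"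
      unfolding A.l_one[OF uA] using uB by (simp only: restrict_apply if_True)
  qed
  also have "\<dots> = hs_rank R L \<otimes>\<^bsub>R\<^esub> \<chi> \<one>\<^bsub>A\<^esub>"
    by (rule matrix_unit_trace[OF u act A.one_closed])
  also have "\<chi> \<one>\<^bsub>A\<^esub> = hs_rank R L"
    unfolding rank_basis character_basis[OF A.one_closed] by (intro A.R.finsum_cong') (auto simp: basis_simps)
  finally have "hs_rank R Block = hs_rank R L \<otimes>\<^bsub>R\<^esub> hs_rank R L" .
  moreover have "hs_rank R L \<in> carrier R"
    unfolding rank_basis by (intro A.R.finsum_closed) (auto simp: basis_simps)
  ultimately show ?thesis by (simp add: numeral_2_eq_2)
qed

text \<open>
  Left multiplication by \<open>\<epsilon> a\<close> on \<open>A\<close> is represented by the matrix units and the functionals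
  \<open>x \<mapsto> d\<^sub>k(a x e\<^sub>l)\<close>. The dual basis of \<open>A\<close> is what makes the trace on \<open>A\<close> well defined.
\<close>

lemma regular_character_block:
  assumes a: "a \<in> carrier A" and A_basis: "dual_basis R A I b c"
  shows "regular_character R A (\<epsilon> \<otimes>\<^bsub>A\<^esub> a) = hs_rank R L \<otimes>\<^bsub>R\<^esub> \<chi> a"
proof -
  obtain u where u: "u \<in> J \<times> J \<rightarrow> carrier Block"
    and act: "\<And>k l y. \<lbrakk>k \<in> J; l \<in> J; y \<in> carrier M\<rbrakk> \<Longrightarrow> u (k, l) \<odot>\<^bsub>M\<^esub> y = scale (d l y) (e k)"
    by (rule matrix_units) blast
  have uA: "u q \<in> carrier A" if "q \<in> J \<times> J" for q
    using u that unfolding carrier_Block by auto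
  let ?g = "\<lambda>q. \<lambda>x\<in>carrier A. d (fst q) ((a \<otimes>\<^bsub>A\<^esub> x) \<odot>\<^bsub>M\<^esub> e (snd q))"
  have g: "?g \<in> J \<times> J \<rightarrow> dual R A" using matrix_functional(1)[OF a] by auto
  have "regular_character R A (\<epsilon> \<otimes>\<^bsub>A\<^esub> a) = (\<Oplus>\<^bsub>R\<^esub>q\<in>J \<times> J. ?g q (u q))"
    unfolding regular_character_def
  proof (rule A.Tr_eqI[OF A_basis _ _ g])
    fix x assume x: "x \<in> carrier A"
    then show "(\<lambda>x\<in>carrier A. (\<epsilon> \<otimes>\<^bsub>A\<^esub> a) \<otimes>\<^bsub>A\<^esub> x) x = (\<Oplus>\<^bsub>A\<^esub>q\<in>J \<times> J. ?g q x \<odot>\<^bsub>A\<^esub> u q)"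
      using a matrix_unit_expansion[OF u act, of "a \<otimes>\<^bsub>A\<^esub> x"] by (simp add: A.m_assoc)
  qed (use uA finite_J in auto)
  also have "\<dots> = (\<Oplus>\<^bsub>R\<^esub>q\<in>J \<times> J. d (fst q) ((a \<otimes>\<^bsub>A\<^esub> u q) \<odot>\<^bsub>M\<^esub> e (snd q)))"
    using uA a by (intro A.R.finsum_cong') (auto simp: basis_simps)
  also have "\<dots> = hs_rank R L \<otimes>\<^bsub>R\<^esub> \<chi> a"
    by (rule matrix_unit_trace[OF u act a])
  finally show ?thesis .
qed

end

theorem proposition5:
  fixes R :: "('r, 'k) ring_scheme"
    and A :: "('r, 'a, 'l) module_scheme"
    and M :: "('a, 'm, 'n) module_scheme"
    and \<beta> :: "'a \<Rightarrow> 'a \<Rightarrow> 'r"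
  assumes "cring R"
    and "assoc_algebra R A"
    and "separable R A"
    and "finitely_generated R A" and "projective R A"
    and "left_module A M"
    and "finitely_generated R (restrict_scalars R A M)"
    and "projective R (restrict_scalars R A M)"
    and "cyclic_module A M"
    and "algebra_iso R (End_algebra A M (smult (restrict_scalars R A M))) (regular_module R)"
    and "symmetrizing_form R A \<beta>"
  shows
    "(algebra_iso R (ideal_algebra A (central_idempotent R A \<beta> M))
        (End_algebra R (restrict_scalars R A M) (smult (restrict_scalars R A M))) \<and>
      hs_rank R (ideal_algebra A (central_idempotent R A \<beta> M)) =
        hs_rank R (restrict_scalars R A M) [^]\<^bsub>R\<^esub> (2 :: nat)) \<and>
     (\<forall>a\<in>carrier A.
        regular_character R A (central_idempotent R A \<beta> M \<otimes>\<^bsub>A\<^esub> a) =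
        hs_rank R (restrict_scalars R A M) \<otimes>\<^bsub>R\<^esub> character R A M a)"
proof -
  note A = assms(2) and M = assms(6)
  have "module R A" using A by (rule assoc_algebra.axioms)
  then obtain I :: "'a set" and b c where A_basis: "dual_basis R A I b c"
    using assms(4,5) by (rule finitely_generated_projective_dual_basis)
  obtain J :: "'m set" and e d where M_basis: "dual_basis R (restrict_scalars R A M) J e d"
    by (rule finitely_generated_projective_dual_basis[OF restrict_scalars_module[OF A M] assms(7,8)])
  obtain m where m: "m \<in> carrier M" "carrier M = (\<lambda>a. a \<odot>\<^bsub>M\<^esub> m) ` carrier A"
    using assms(9) by (auto simp: cyclic_module_def)
  obtain s where s: "s \<in> Hom A M (regular_module A)" "\<And>y. y \<in> carrier M \<Longrightarrow> s y \<odot>\<^bsub>M\<^esub> m = y"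
    by (rule cyclic_section[OF A assms(3) M M_basis m]) blast
  interpret split_cyclic_module R A M \<beta> m s J e d
    by (intro split_cyclic_module.intro A M split_cyclic_module_axioms.intro assms(11) M_basis m(1) s
        scalar_endomorphisms[OF A M assms(10)])
  show ?thesis
    using block_iso_End rank_block regular_character_block[OF _ A_basis] by blast
qed

end
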